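(* Let $n$ be an odd positive cube-free integer. If $f_{cf,odd}(n)$ is the number of groups of order $n$ up to isomorphism, then $$f_{cf,odd}(n) \leq 2^{-\omega(n)\mu(n)}\, n^{2\mu(n) - 1/4}.$$
   Context: A positive integer is cube-free if it is not divisible by the cube of any prime. For a positive integer $n$, $\omega(n)$ denotes the number of (distinct) prime divisors of $n$, and $\mu(n)$ denotes the highest power (exponent) to which any prime divides $n$. *)

theory Defs
  imports Complex_Main "HOL-Computational_Algebra.Primes" "HOL-Algebra.Coset"
begin

definition cube_free :: "nat \<Rightarrow> bool" where
  "cube_free n \<longleftrightarrow> (\<forall>p. prime p \<longrightarrow> \<not> p ^ 3 dvd n)"

definition num_prime_divisors :: "nat \<Rightarrow> nat" where
  "num_prime_divisors n = card {p. prime p \<and> p dvd n}"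

text \<open>
  The maximum ranges over all primes, so it is taken over a nonempty set that
  is finite for \<^term>\<open>n > 0\<close>; in particular the value at 1 is 0.
\<close>

definition max_prime_exponent :: "nat \<Rightarrow> nat" where
  "max_prime_exponent n = Max {multiplicity p n | p. prime p}"

lemma finite_prime_exponents:
  assumes "n > 0"
  shows "finite {multiplicity p n | p. prime (p :: nat)}"
proof -
  have "{multiplicity p n | p. prime (p :: nat)}
      \<subseteq> insert 0 ((\<lambda>p. multiplicity p n) ` {p. p dvd n})"
    using not_dvd_imp_multiplicity_0 by auto
  moreover have "finite {p. p dvd n}"
    using assms by simp
  ultimately show ?thesis
    by (meson finite_imageI finite_insert finite_subset)
qed

text \<open>
  For \<^term>\<open>n > 0\<close> every group of order \<^term>\<open>n\<close>, over any type, is isomorphic to one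
  whose carrier is a set of natural numbers, so it suffices to count isomorphism
  classes of the latter. The lemmas below show that this is so, and that the set of
  classes is finite, so that its cardinality is meaningful.
\<close>

definition groups_of_order :: "nat \<Rightarrow> nat monoid set" where
  "groups_of_order n = {G. group G \<and> order G = n}"

definition group_iso_rel :: "nat \<Rightarrow> (nat monoid \<times> nat monoid) set" where
  "group_iso_rel n = {(G, H). G \<in> groups_of_order n \<and> H \<in> groups_of_order n \<and> G \<cong> H}"

definition num_groups :: "nat \<Rightarrow> nat" where
  "num_groups n = card (groups_of_order n // group_iso_rel n)"

lemma equiv_group_iso_rel: "equiv (groups_of_order n) (group_iso_rel n)"
proof (rule equivI)
  show "group_iso_rel n \<subseteq> groups_of_order n \<times> groups_of_order n"
    by (auto simp: group_iso_rel_def)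
  show "refl_on (groups_of_order n) (group_iso_rel n)"
    by (auto simp: refl_on_def group_iso_rel_def)
  show "sym (group_iso_rel n)"
    by (auto simp: sym_def group_iso_rel_def groups_of_order_def intro: group.iso_sym)
  show "trans (group_iso_rel n)"
    by (auto simp: trans_def group_iso_rel_def intro: iso_trans)
qed

lemma groups_of_order_complete:
  fixes G :: "('a, 'b) monoid_scheme"
  assumes "group G" "order G = n" "n > 0"
  shows "\<exists>H \<in> groups_of_order n. G \<cong> H"
proof -
  interpret group G by fact
  have fin: "finite (carrier G)"
    using assms by (metis card.infinite less_irrefl order_def)
  then obtain h where h: "bij_betw h (carrier G) {0..<card (carrier G)}"
    using ex_bij_betw_finite_nat by blast
  let ?g = "inv_into (carrier G) h"
  define H :: "nat monoid" where
    "H = \<lparr>carrier = h ` carrier G, mult = (\<lambda>i j. h (?g i \<otimes>\<^bsub>G\<^esub> ?g j)), one = h \<one>\<^bsub>G\<^esub>\<rparr>"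
  have inj: "inj_on h (carrier G)"
    using h by (rule bij_betw_imp_inj_on)
  have iso: "h \<in> iso G H"
    using inj by (auto simp: iso_def hom_def H_def bij_betw_def)
  then have "group (H\<lparr>one := h \<one>\<^bsub>G\<^esub>\<rparr>)"
    by (rule iso_imp_img_group)
  then have "group H"
    by (simp add: H_def)
  moreover have "order H = n"
    using inj assms by (simp add: order_def H_def card_image)
  ultimately show ?thesis
    using iso by (auto simp: groups_of_order_def is_iso_def)
qed

lemma finite_group_classes:
  assumes "n > 0"
  shows "finite (groups_of_order n // group_iso_rel n)"
proof -
  define \<phi> where "\<phi> = (\<lambda>G :: nat monoid. SOME f. bij_betw f {0..<n} (carrier G))"
  define t where "t = (\<lambda>G :: nat monoid. {(i, j, k). i < n \<and> j < n \<and> k < n \<and>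
    \<phi> G i \<otimes>\<^bsub>G\<^esub> \<phi> G j = \<phi> G k})"
  let ?cl = "\<lambda>G. group_iso_rel n `` {G}"
  have bij: "bij_betw (\<phi> G) {0..<n} (carrier G)" if "G \<in> groups_of_order n" for G
  proof -
    have "card (carrier G) = n"
      using that by (simp add: groups_of_order_def order_def)
    moreover from this have "finite (carrier G)"
      using assms by (metis card.infinite less_irrefl)
    ultimately have "\<exists>f. bij_betw f {0..<n} (carrier G)"
      using ex_bij_betw_nat_finite by blast
    then show ?thesis
      unfolding \<phi>_def by (rule someI_ex)
  qed
  have same: "G \<cong> H"
    if G: "G \<in> groups_of_order n" and H: "H \<in> groups_of_order n" and eq: "t G = t H" for G H
  proof -
    interpret G: group G using G by (simp add: groups_of_order_def)
    let ?u = "inv_into {0..<n} (\<phi> G)"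
    have u: "bij_betw ?u (carrier G) {0..<n}"
      by (rule bij_betw_inv_into[OF bij[OF G]])
    have u_less: "?u x < n" if "x \<in> carrier G" for x
      using u that by (auto simp: bij_betw_def)
    have u_inv: "\<phi> G (?u x) = x" if "x \<in> carrier G" for x
      using bij[OF G] that by (simp add: bij_betw_inv_into_right)
    let ?h = "\<phi> H \<circ> ?u"
    have h: "bij_betw ?h (carrier G) (carrier H)"
      using u bij[OF H] by (rule bij_betw_trans)
    have "?h (x \<otimes>\<^bsub>G\<^esub> y) = ?h x \<otimes>\<^bsub>H\<^esub> ?h y" if "x \<in> carrier G" "y \<in> carrier G" for x y
    proof -
      have "(?u x, ?u y, ?u (x \<otimes>\<^bsub>G\<^esub> y)) \<in> t G"
        using that by (simp add: t_def u_less u_inv)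
      then show ?thesis
        unfolding eq by (simp add: t_def)
    qed
    moreover have "?h \<in> carrier G \<rightarrow> carrier H"
      using h by (rule bij_betw_imp_funcset)
    ultimately have "?h \<in> iso G H"
      unfolding iso_def hom_def using h by blast
    then show ?thesis
      by (rule is_isoI)
  qed
  have cl: "?cl G = ?cl H"
    if "G \<in> groups_of_order n" "H \<in> groups_of_order n" "t G = t H" for G H
  proof (rule equiv_class_eq[OF equiv_group_iso_rel])
    show "(G, H) \<in> group_iso_rel n"
      using that same[OF that] by (simp add: group_iso_rel_def)
  qed
  have "t ` groups_of_order n \<subseteq> Pow ({..<n} \<times> {..<n} \<times> {..<n})"
    by (auto simp: t_def)
  then have fin: "finite (t ` groups_of_order n)"
    by (rule finite_subset) simp
  let ?s = "\<lambda>s. SOME G. G \<in> groups_of_order n \<and> t G = s"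
  let ?r = "\<lambda>s. ?cl (?s s)"
  have "?cl G = ?r (t G)" if "G \<in> groups_of_order n" for G
  proof -
    have "\<exists>H. H \<in> groups_of_order n \<and> t H = t G"
      using that by blast
    from someI_ex[OF this] have "?s (t G) \<in> groups_of_order n" "t G = t (?s (t G))"
      by simp_all
    with that show ?thesis
      by (rule cl)
  qed
  then have "groups_of_order n // group_iso_rel n \<subseteq> ?r ` t ` groups_of_order n"
    unfolding quotient_def by blast
  with fin show ?thesis
    by (meson finite_imageI finite_subset)
qed

end

theory Submission
  imports Defs "HOL-Algebra.Group_Action" "HOL-Algebra.Sylow" "HOL-Algebra.Elementary_Groups"
    "HOL-Algebra.Multiplicative_Group" "HOL-Number_Theory.Cong"
begin

text \<open>
  Let \<open>G\<close> have odd cube-free order and let \<open>p\<close> be the smallest prime divisor of its order. A Sylow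
  \<open>p\<close>-subgroup \<open>P\<close> has order \<open>p\<close> or \<open>p\<^sup>2\<close>, so it is abelian, and a prime \<open>r > p\<close> that is the order of
  an automorphism of \<open>P\<close> would have to be \<open>p + 1\<close>, which is even. Hence \<open>P\<close> is central in its normalizer
  (\<open>normalizing_imp_centralizing\<close>), and Burnside's transfer argument gives a normal complement
  (\<open>normal_complement_of_central_sylow\<close>). Iterating, \<open>G\<close> has a Sylow tower
  (\<open>odd_cube_free_group_induct\<close>), at the bottom of which sits a normal Sylow subgroup \<open>Q\<close> for the largest
  prime \<open>q\<close> (\<open>largest_prime_sylow_normal\<close>). By the abelian case of the Schur-Zassenhaus theorem \<open>G\<close> is a
  semidirect product of \<open>Q\<close> with a group \<open>H\<close> of order \<open>m = n / q\<^sup>e\<close>. The isomorphism type of \<open>G\<close> is therefore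
  determined by the types of \<open>H\<close> and of \<open>Q\<close> and by a homomorphism from \<open>H\<close> to the automorphism group of \<open>Q\<close>.

  These homomorphisms are few. Their images are abelian (\<open>odd_cube_free_image_abelian\<close>): this is clear
  if \<open>Q\<close> is cyclic, and for \<open>Q\<close> elementary abelian it is a statement about groups of \<open>2 \<times> 2\<close> matrices of
  odd order prime to \<open>q\<close>. And if no prime divides \<open>n\<close> more than \<open>\<mu>\<close> times, then \<open>H\<close> has \<open>\<mu>\<close> elements whose
  images determine any homomorphism with abelian image (\<open>odd_cube_free_determining_elements\<close>). So for
  \<open>\<mu> = 2\<close> it is enough to count commuting pairs of automorphisms. Altogether
  \<open>f(n) \<le> B f(m)\<close> for the number \<open>f\<close> of groups (\<open>num_groups_recursion\<close>), where \<open>B\<close> is \<open>(q - 1)\<^sup>\<mu>\<close> if \<open>e = 1\<close>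
  and \<open>(q\<^sup>2 - 1)\<^sup>2 (q\<^sup>2 + q - 1)\<close> if \<open>e = 2\<close>. In each case \<open>B\<close> is at most the contribution
  of \<open>q\<^sup>e\<close> to the right-hand side of the theorem, which is multiplicative over coprime factors when \<open>\<mu>\<close> is held fixed.
\<close>

section \<open>Fixed points of actions of groups of prime power order\<close>

text \<open>
  An orbit has size a power of \<open>p\<close>, so that every orbit other than a fixed point has size divisible by \<open>p\<close>.
\<close>

lemma prime_power_action_fixed_points:
  fixes G (structure)
  assumes "group G" and ord: "order G = p ^ k" and p: "prime (p::nat)" and fin: "finite E"
    and closed: "\<And>g x. g \<in> carrier G \<Longrightarrow> x \<in> E \<Longrightarrow> f g x \<in> E"
    and one: "\<And>x. x \<in> E \<Longrightarrow> f \<one>\<^bsub>G\<^esub> x = x"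
    and mult: "\<And>g h x. g \<in> carrier G \<Longrightarrow> h \<in> carrier G \<Longrightarrow> x \<in> E \<Longrightarrow> f (g \<otimes>\<^bsub>G\<^esub> h) x = f g (f h x)"
  shows "[card E = card {x \<in> E. \<forall>g \<in> carrier G. f g x = x}] (mod p)"
proof -
  interpret group G by fact
  have bij: "bij_betw (f g) E E" if g: "g \<in> carrier G" for g
  proof (rule bij_betwI[where g = "f (inv g)"])
    show "f (inv g) (f g x) = x" if "x \<in> E" for x
      using mult[of "inv g" g x] g that one by simp
    show "f g (f (inv g) x) = x" if "x \<in> E" for x
      using mult[of g "inv g" x] g that one by simp
  qed (use closed g in auto)
  let ?\<phi> = "\<lambda>g. restrict (f g) E"
  have Bij: "?\<phi> g \<in> Bij E" if "g \<in> carrier G" for g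
    using bij[OF that] by (simp add: Bij_def cong: bij_betw_cong)
  have comp: "?\<phi> (g \<otimes> h) = compose E (?\<phi> g) (?\<phi> h)" if "g \<in> carrier G" "h \<in> carrier G" for g h
    by (rule ext) (simp add: compose_def closed mult that)
  have "?\<phi> \<in> hom G (BijGroup E)"
    by (rule homI) (simp_all only: BijGroup_def partial_object.select_convs monoid.select_convs Bij comp restrict_apply if_True m_closed)
  then interpret A: group_action G E ?\<phi>
    by (simp add: group_action_def group_hom_def group_hom_axioms_def group_BijGroup is_group)
  let ?O = "orbits G E ?\<phi>"
  let ?F = "{x \<in> E. \<forall>g \<in> carrier G. f g x = x}"
  have finO: "finite ?O" "\<And>B. B \<in> ?O \<Longrightarrow> finite B"
    using fin A.orbits_coverture by (auto intro: finite_UnionD finite_subset)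
  have fixed: "orbit G ?\<phi> x = {x}" if "x \<in> ?F" for x
    using that by (force simp: orbit_def)
  have "int p dvd (\<Sum>B\<in>?O. int (card B) - int (card (B \<inter> ?F)))"
  proof (rule dvd_sum)
    fix B assume B: "B \<in> ?O"
    then obtain x where x: "x \<in> E" "B = orbit G ?\<phi> x" by (auto simp: orbits_def)
    have "card B dvd p ^ k"
      using A.orbit_stabilizer_theorem[OF x(1)] ord x(2) by (metis dvd_triv_left)
    then obtain j where j: "card B = p ^ j" using p by (auto simp: divides_primepow_nat)
    show "int p dvd int (card B) - int (card (B \<inter> ?F))"
    proof (cases "j = 0")
      case True
      then have "card B = 1" using j by simp
      then obtain y where "B = {y}" by (auto simp: card_1_singleton_iff)
      moreover have "x \<in> B" using A.orbit_refl x by simp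
      ultimately have Bx: "B = {x}" by simp
      have "f g x = x" if "g \<in> carrier G" for g
      proof -
        have "f g x \<in> B" using that x unfolding x(2) orbit_def by force
        then show ?thesis using Bx by simp
      qed
      then have "B \<inter> ?F = {x}" using Bx x by auto
      then show ?thesis using Bx by simp
    next
      case False
      have "B \<inter> ?F = {}"
      proof (rule ccontr)
        assume "B \<inter> ?F \<noteq> {}"
        then obtain y where y: "y \<in> B" "y \<in> ?F" by blast
        have "x \<in> orbit G ?\<phi> y" using A.orbit_sym[of x y] y x by auto
        then have "B = {y}" using y fixed[OF y(2)] fixed x(2) by auto
        then have "p ^ j = 1" using j by simp
        then show False using False p by simp
      qed
      then show ?thesis using j False by (simp add: dvd_power)
    qed
  qed
  also have "(\<Sum>B\<in>?O. int (card B) - int (card (B \<inter> ?F))) = int (card E) - int (card ?F)"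
  proof -
    have disj: "\<forall>B\<in>?O. \<forall>C\<in>?O. B \<noteq> C \<longrightarrow> B \<inter> C = {}" using A.disjoint_union by blast
    have "card (\<Union>?O) = (\<Sum>B\<in>?O. card B)"
      using disj finO by (intro card_Union_disjoint) (auto simp: pairwise_def disjnt_def)
    moreover have "card (\<Union>B\<in>?O. B \<inter> ?F) = (\<Sum>B\<in>?O. card (B \<inter> ?F))"
      using disj finO by (intro card_UN_disjoint) auto
    moreover have "(\<Union>B\<in>?O. B \<inter> ?F) = ?F" using A.orbits_coverture by blast
    ultimately show ?thesis using A.orbits_coverture by (simp add: sum_subtractf)
  qed
  finally show ?thesis
    by (simp add: cong_iff_dvd_diff flip: cong_int_iff)
qed

text \<open>
  The cyclic group of order \<open>p\<close> acts by iterating \<open>f\<close>.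
\<close>

lemma prime_period_fixed_points:
  assumes p: "prime (p::nat)" and fin: "finite E" and f: "f \<in> E \<rightarrow> E"
    and per: "\<And>x. x \<in> E \<Longrightarrow> (f ^^ p) x = x"
  shows "[card E = card {x \<in> E. f x = x}] (mod p)"
proof -
  let ?Z = "integer_mod_group p"
  have p0: "p > 1" using p by (rule prime_gt_1_nat)
  have cl: "(f ^^ i) x \<in> E" if "x \<in> E" for i x
    using that f by (induction i) auto
  have perk: "((f ^^ p) ^^ k) x = x" if "x \<in> E" for k x
    using that per by (induction k) auto
  have modp: "(f ^^ (i mod p)) x = (f ^^ i) x" if "x \<in> E" for i x
  proof -
    have "(f ^^ i) x = (f ^^ (i mod p + p * (i div p))) x" by simp
    also have "\<dots> = (f ^^ (i mod p)) (((f ^^ p) ^^ (i div p)) x)"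
      unfolding funpow_add by (simp add: funpow_mult)
    finally show ?thesis using perk that by simp
  qed
  have car: "carrier ?Z = {0..<int p}" using p0 by (simp add: carrier_integer_mod_group)
  have "[card E = card {x \<in> E. \<forall>g \<in> carrier ?Z. (f ^^ nat g) x = x}] (mod p)"
  proof (rule prime_power_action_fixed_points[where k = 1, OF _ _ p fin])
    fix g h x assume gh: "g \<in> carrier ?Z" "h \<in> carrier ?Z" "x \<in> E"
    then have "nat ((g + h) mod int p) = (nat g + nat h) mod p"
      using p0 by (simp add: car nat_mod_distrib nat_add_distrib)
    then show "(f ^^ nat (g \<otimes>\<^bsub>?Z\<^esub> h)) x = (f ^^ nat g) ((f ^^ nat h) x)"
      using gh by (simp add: modp funpow_add)
  qed (use cl car in \<open>auto simp: order_def\<close>)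
  moreover have "{x \<in> E. \<forall>g \<in> carrier ?Z. (f ^^ nat g) x = x} = {x \<in> E. f x = x}"
  proof -
    have "(f ^^ i) x = x" if "f x = x" for i x using that by (induction i) auto
    moreover have "f x = x" if "\<forall>g \<in> carrier ?Z. (f ^^ nat g) x = x" for x
      using that[THEN bspec, of 1] p0 car by simp
    ultimately show ?thesis by blast
  qed
  ultimately show ?thesis by simp
qed

lemma (in group) card_subgroup_dvd_order: "subgroup H G \<Longrightarrow> card H dvd order G"
  using lagrange[of H] by (metis dvd_triv_right)

lemma (in group) centralizer_subgroup:
  assumes x: "x \<in> carrier G"
  shows "subgroup {y \<in> carrier G. x \<otimes> y = y \<otimes> x} G"
proof (rule subgroupI)
  fix a assume "a \<in> {y \<in> carrier G. x \<otimes> y = y \<otimes> x}"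
  then have a: "a \<in> carrier G" "x \<otimes> a = a \<otimes> x" by auto
  have "inv a \<otimes> x = inv a \<otimes> (x \<otimes> a) \<otimes> inv a" using a(1) x by (simp add: m_assoc)
  also have "\<dots> = x \<otimes> inv a" unfolding a(2) using a(1) x by (simp flip: m_assoc)
  finally show "inv a \<in> {y \<in> carrier G. x \<otimes> y = y \<otimes> x}" using a by simp
next
  fix a b assume "a \<in> {y \<in> carrier G. x \<otimes> y = y \<otimes> x}" "b \<in> {y \<in> carrier G. x \<otimes> y = y \<otimes> x}"
  then show "a \<otimes> b \<in> {y \<in> carrier G. x \<otimes> y = y \<otimes> x}"
    using x by (auto simp: m_assoc) (metis m_assoc)
qed (use x in auto)

text \<open>
  The centre consists of the fixed points of conjugation, so its order is divisible by \<open>p\<close> unless \<open>e = 0\<close>. The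
  centralizer of a noncentral element would lie strictly between the centre and the whole group, and the order \<open>p\<^sup>2\<close> leaves no room for this.
\<close>

lemma (in group) order_prime_power_le_2_abelian:
  assumes p: "prime p" and ord: "order G = p ^ e" and e: "e \<le> 2"
  shows "comm_group G"
proof (cases "e = 0")
  case True
  then have "carrier G = {\<one>}" using ord order_one_triv_iff by simp
  then show ?thesis by (intro group_comm_groupI) auto
next
  case False
  have fin: "finite (carrier G)" using ord p by (metis order_gt_0_iff_finite prime_gt_0_nat zero_less_power)
  let ?Z = "{x \<in> carrier G. \<forall>g \<in> carrier G. g \<otimes> x = x \<otimes> g}"
  have Z: "?Z = (\<Inter>x\<in>carrier G. {y \<in> carrier G. x \<otimes> y = y \<otimes> x})" by auto
  have Zsub: "subgroup ?Z G"
    unfolding Z using centralizer_subgroup by (intro subgroups_Inter) auto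
  have "card ?Z dvd p ^ e" using card_subgroup_dvd_order[OF Zsub] ord by simp
  then obtain j where j: "j \<le> e" "card ?Z = p ^ j" using p by (auto simp: divides_primepow_nat)
  have "[card (carrier G) = card {x \<in> carrier G. \<forall>g \<in> carrier G. g \<otimes> x \<otimes> inv g = x}] (mod p)"
    by (rule prime_power_action_fixed_points[OF is_group ord p fin]) (auto simp: inv_mult_group m_assoc)
  moreover have "{x \<in> carrier G. \<forall>g \<in> carrier G. g \<otimes> x \<otimes> inv g = x} = ?Z"
    by (auto simp: inv_solve_right')
  ultimately have "[p ^ e = p ^ j] (mod p)" using ord j by (simp add: order_def)
  then have "p dvd p ^ j" using False by (metis cong_dvd_iff dvd_power_iff_le dvd_power gr0I)
  then have "j \<noteq> 0" using p by (cases j) auto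
  have "x \<in> ?Z" if x: "x \<in> carrier G" for x
  proof (rule ccontr)
    assume nx: "x \<notin> ?Z"
    let ?C = "{y \<in> carrier G. x \<otimes> y = y \<otimes> x}"
    have "?Z \<subset> ?C" using x nx by auto
    moreover have "finite ?C" using fin by simp
    ultimately have "card ?Z < card ?C" by (intro psubset_card_mono)
    moreover have "card ?C dvd p ^ e" using card_subgroup_dvd_order[OF centralizer_subgroup[OF x]] ord by simp
    then obtain i where i: "i \<le> e" "card ?C = p ^ i" using p by (auto simp: divides_primepow_nat)
    ultimately have "j < i" using j p by (metis nat_power_less_imp_less prime_gt_0_nat)
    then have "i = e" using i \<open>j \<noteq> 0\<close> e by simp
    then have "?C = carrier G" using i ord fin by (intro card_subset_eq) (auto simp: order_def)
    then have "x \<otimes> y = y \<otimes> x" if "y \<in> carrier G" for y using that by blast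
    then show False using nx x by auto
  qed
  then show ?thesis by (intro group_comm_groupI) auto
qed

text \<open>
  The conjugacy half of Sylow's theorem. The subgroup \<open>Q\<close> acts by translation on the cosets of \<open>P\<close>, whose
  number is prime to \<open>p\<close>. So it fixes a coset \<open>P t\<close>, and conjugation by \<open>t\<close> maps \<open>Q\<close> into \<open>P\<close>.
\<close>

lemma (in group) p_subgroup_conjugate_into:
  assumes fin: "finite (carrier G)" and p: "prime p"
    and Q: "subgroup Q G" "card Q = p ^ k"
    and P: "subgroup P G" "\<not> p dvd card (rcosets P)"
  shows "\<exists>g\<in>carrier G. \<forall>x\<in>Q. g \<otimes> x \<otimes> inv g \<in> P"
proof -
  interpret Q: subgroup Q G by fact
  interpret P: subgroup P G by fact
  have grp: "group (G\<lparr>carrier := Q\<rparr>)" using Q(1) by (rule subgroup_imp_group)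
  have finR: "finite (rcosets P)" using fin P(1) rcosets_subset_PowG by (meson finite_Pow_iff finite_subset)
  have "[card (rcosets P) = card {C \<in> rcosets P. \<forall>g \<in> carrier (G\<lparr>carrier := Q\<rparr>). C #> inv g = C}] (mod p)"
    by (rule prime_power_action_fixed_points[OF grp _ p finR, where k = k])
       (use Q P in \<open>auto simp: order_def RCOSETS_def coset_mult_assoc inv_mult_group P.subset m_assoc\<close>)
  then have "{C \<in> rcosets P. \<forall>g \<in> Q. C #> inv g = C} \<noteq> {}"
    using P(2) by (auto simp: cong_0_iff simp del: Collect_empty_eq)
  then obtain t where t: "t \<in> carrier G" "\<forall>g\<in>Q. P #> t #> inv g = P #> t"
    by (auto simp: RCOSETS_def)
  have "t \<otimes> x \<otimes> inv t \<in> P" if x: "x \<in> Q" for x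
  proof -
    have "P #> (t \<otimes> x) = P #> t"
      using t(2)[THEN bspec, of "inv x"] x t by (simp add: coset_mult_assoc P.subset)
    then have "t \<otimes> x \<in> P #> t" using t x by (metis P(1) Q.mem_carrier m_closed rcos_self)
    then show ?thesis using t x P.rcos_module[OF is_group t(1)] by simp
  qed
  then show ?thesis using t(1) by blast
qed

section \<open>Burnside transfer and normal complements\<close>

lemma (in group) subgroup_nat_pow_closed:
  assumes "subgroup H G" "x \<in> H" shows "x [^] (n::nat) \<in> H"
  using assms by (induction n) (auto simp: subgroup.one_closed subgroup.m_closed)

lemma (in normal) pow_index_mem:
  assumes x: "x \<in> carrier G"
  shows "x [^] card (rcosets H) \<in> H"
proof -
  interpret F: group "G Mod H" by (rule factorgroup_is_group)
  have "H #> x \<in> carrier (G Mod H)" using x by (auto simp: FactGroup_def RCOSETS_def)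
  then have "(H #> x) [^]\<^bsub>G Mod H\<^esub> order (G Mod H) = \<one>\<^bsub>G Mod H\<^esub>" by (rule F.pow_order_eq_1)
  then have "H #> (x [^] card (rcosets H)) = H"
    using FactGroup_pow[OF x] by (simp add: order_def FactGroup_def)
  then show ?thesis using coset_join1 x subgroup_axioms by blast
qed

lemma (in group) subgroup_index_dvd_index:
  assumes fin: "finite (carrier G)" and "subgroup P G" "subgroup C G" "P \<subseteq> C"
  shows "card (rcosets\<^bsub>G\<lparr>carrier := C\<rparr>\<^esub> P) dvd card (rcosets P)"
proof -
  have "card (rcosets\<^bsub>G\<lparr>carrier := C\<rparr>\<^esub> P) * card P = card C"
    using group.lagrange[OF subgroup_imp_group subgroup_incl] assms by (auto simp: order_def)
  moreover have "card (rcosets P) * card P = order G" "card C dvd order G"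
    using assms lagrange card_subgroup_dvd_order by auto
  moreover have "card P > 0"
    using subgroup.finite_imp_card_positive[OF \<open>subgroup P G\<close> fin] .
  ultimately show ?thesis by (metis nat_mult_dvd_cancel_disj mult.commute neq0_conv)
qed

lemma (in group) conj_pow_iter:
  assumes "z \<in> carrier G" "u \<in> carrier G"
  shows "((\<lambda>u. z \<otimes> u \<otimes> inv z) ^^ k) u = z [^] k \<otimes> u \<otimes> inv (z [^] k)"
proof (induction k)
  case (Suc k)
  have "z \<otimes> z [^] k = z [^] k \<otimes> z" using assms by (metis nat_pow_Suc nat_pow_Suc2)
  then have "z [^] Suc k = z \<otimes> z [^] k" by simp
  then show ?case using Suc assms by (simp add: inv_mult_group m_assoc)
qed (use assms in simp)

text \<open>
  Let \<open>z\<close> normalize \<open>P\<close> and let \<open>z\<^sup>r\<close> centralize \<open>P\<close> for a prime \<open>r \<noteq> p\<close> that divides the order of the group, so that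
  \<open>r > p\<close>. If \<open>F\<close> is the subgroup of \<open>P\<close> fixed by \<open>z\<close>, then \<open>r\<close> divides \<open>card P - card F\<close>, hence \<open>p - 1\<close> or \<open>p\<^sup>2 - 1\<close>
  unless \<open>F = P\<close>. But \<open>p - 1\<close> is too small, and \<open>r\<close> dividing \<open>p + 1\<close> means \<open>r = p + 1\<close>, an even number. This is
  the step \<open>prime_step\<close>. In general the power of \<open>x\<close> by the index of \<open>P\<close> in its normalizer lies in the abelian
  group \<open>P\<close>, and \<open>descend\<close> removes the prime factors of this exponent one at a time.
\<close>

lemma (in group) normalizing_imp_centralizing:
  assumes fin: "finite (carrier G)" and odd: "odd (order G)"
    and p: "prime p" and least: "\<And>r. prime r \<Longrightarrow> r dvd order G \<Longrightarrow> p \<le> r"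
    and P: "subgroup P G" "card P = p ^ e" "e \<le> 2" and index: "\<not> p dvd card (rcosets P)"
    and x: "x \<in> carrier G" "\<And>u. u \<in> P \<Longrightarrow> x \<otimes> u \<otimes> inv x \<in> P" and u: "u \<in> P"
  shows "x \<otimes> u = u \<otimes> x"
proof -
  interpret P: subgroup P G by fact
  interpret PP: comm_group "G\<lparr>carrier := P\<rparr>"
    using group.order_prime_power_le_2_abelian[OF subgroup_imp_group[OF P(1)] p _ P(3)] P(2)
    by (simp add: order_def)
  have finP: "finite P" using fin P.subset finite_subset by blast
  let ?N = "{y \<in> carrier G. \<forall>u\<in>P. y \<otimes> u \<otimes> inv y \<in> P}"
  have N: "subgroup ?N G"
  proof (rule subgroupI)
    fix a assume a: "a \<in> ?N"
    have "inj_on (\<lambda>u. a \<otimes> u \<otimes> inv a) P" using a by (auto simp: inj_on_def)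
    then have surj: "(\<lambda>u. a \<otimes> u \<otimes> inv a) ` P = P" using a finP by (intro endo_inj_surj) auto
    have "inv a \<otimes> w \<otimes> a \<in> P" if "w \<in> P" for w
    proof -
      have "w \<in> (\<lambda>u. a \<otimes> u \<otimes> inv a) ` P" unfolding surj by (rule that)
      then obtain v where "v \<in> P" "w = a \<otimes> v \<otimes> inv a" by (elim imageE)
      then show ?thesis using conjugation_is_surj[of "inv a" v] a by simp
    qed
    then show "inv a \<in> ?N" using a by simp
  next
    fix a b assume ab: "a \<in> ?N" "b \<in> ?N"
    have "a \<otimes> b \<otimes> w \<otimes> inv (a \<otimes> b) \<in> P" if "w \<in> P" for w
    proof -
      have "b \<otimes> w \<otimes> inv b \<in> P" using ab that by blast
      then have "a \<otimes> (b \<otimes> w \<otimes> inv b) \<otimes> inv a \<in> P" using ab by blast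
      then show ?thesis using ab that by (simp add: inv_mult_group m_assoc)
    qed
    then show "a \<otimes> b \<in> ?N" using ab by simp
  qed auto
  have PN: "P \<subseteq> ?N" by auto
  interpret NG: group "G\<lparr>carrier := ?N\<rparr>" using N by (rule subgroup_imp_group)
  interpret PN: normal P "G\<lparr>carrier := ?N\<rparr>"
    using PN by (intro NG.normal_invI subgroup_incl P(1) N) (auto simp: m_inv_consistent[OF N])
  let ?s = "card (rcosets\<^bsub>G\<lparr>carrier := ?N\<rparr>\<^esub> P)"
  have s: "?s dvd card (rcosets P)" using subgroup_index_dvd_index[OF fin P(1) N PN] .
  have so: "card (rcosets P) dvd order G" using lagrange[OF P(1)] by (metis dvd_triv_left)
  have prime_step: "\<forall>v\<in>P. z \<otimes> v = v \<otimes> z"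
    if z: "z \<in> ?N" and r: "prime r" "r dvd order G" "r \<noteq> p" and zr: "\<forall>v\<in>P. z [^] r \<otimes> v = v \<otimes> z [^] r" for z r
  proof (rule ccontr)
    assume not: "\<not> ?thesis"
    let ?F = "{v \<in> P. z \<otimes> v \<otimes> inv z = v}"
    have cong: "[card P = card ?F] (mod r)"
    proof (rule prime_period_fixed_points[OF r(1) finP])
      fix v assume "v \<in> P"
      then show "((\<lambda>v. z \<otimes> v \<otimes> inv z) ^^ r) v = v"
        using z zr by (simp add: conj_pow_iter inv_solve_right')
    qed (use z in auto)
    have F: "?F = {y \<in> carrier G. z \<otimes> y = y \<otimes> z} \<inter> P"
      using z by (auto simp: inv_solve_right')
    have Fsub: "subgroup ?F G" unfolding F using z by (intro subgroups_Inter_pair centralizer_subgroup P(1)) auto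
    have "card ?F dvd p ^ e"
      using group.card_subgroup_dvd_order[OF subgroup_imp_group[OF P(1)] subgroup_incl[OF Fsub P(1)]] P(2)
      by (auto simp: order_def)
    then obtain j where j: "j \<le> e" "card ?F = p ^ j" using p by (auto simp: divides_primepow_nat)
    have "j \<noteq> e"
    proof
      assume "j = e"
      then have "?F = P" using j P(2) finP by (intro card_subset_eq) auto
      then show False using not F by blast
    qed
    then have je: "j < e" using j by simp
    have pr: "p < r" using least[OF r(1,2)] r(3) by simp
    have p1: "p > 1" using p by (rule prime_gt_1_nat)
    have "p dvd order G" using je P(2) card_subgroup_dvd_order[OF P(1)]
      by (metis dvd_power dvd_trans gr0I not_less0)
    then have oddp: "odd p" using odd by (meson dvd_trans)
    have "r dvd p ^ e - p ^ j"
      using cong P(2) j je p1 by (simp add: cong_altdef_nat power_increasing)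
    also have "p ^ e - p ^ j = p ^ j * (p ^ (e - j) - 1)"
      using je by (simp add: algebra_simps flip: power_add)
    finally have "r dvd p ^ j \<or> r dvd p ^ (e - j) - 1" using r(1) by (simp add: prime_dvd_mult_iff)
    moreover have "\<not> r dvd p ^ j" using r p pr by (metis prime_dvd_power primes_dvd_imp_eq)
    ultimately have rd: "r dvd p ^ (e - j) - 1" by blast
    have nr: "\<not> r dvd p - 1" using p1 pr by (auto dest!: dvd_imp_le)
    have "e - j = 1 \<or> e - j = 2" using je P(3) by linarith
    then show False
    proof
      assume "e - j = 1" then show False using rd nr by simp
    next
      assume ej: "e - j = 2"
      have "p ^ 2 - 1 = (p - 1) * (p + 1)" by (simp add: algebra_simps power2_eq_square)
      then have "r dvd (p - 1) * (p + 1)" using rd ej by metis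
      then have "r dvd p + 1" using nr r(1) prime_dvd_multD by blast
      then have "r = p + 1" using pr by (auto dest!: dvd_imp_le)
      then have "even r" using oddp by simp
      then show False using r(2) odd by (meson dvd_trans)
    qed
  qed
  have descend: "\<forall>v\<in>P. y \<otimes> v = v \<otimes> y"
    if "y \<in> ?N" "s dvd card (rcosets P)" "\<forall>v\<in>P. y [^] s \<otimes> v = v \<otimes> y [^] s" for s y
    using that
  proof (induction s arbitrary: y rule: less_induct)
    case (less s)
    show ?case
    proof (cases "s = 1")
      case True
      then show ?thesis using less.prems by simp
    next
      case False
      then obtain r where r: "prime r" "r dvd s" using prime_factor_nat by blast
      then obtain t where t: "s = r * t" by blast
      have "s \<noteq> 0" using less.prems(2) index by (auto intro: gr0I)
      then have ts: "t < s" using t r(1) prime_gt_1_nat by auto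
      have rp: "r \<noteq> p" "r dvd order G" using r less.prems(2) index so by (auto intro: dvd_trans)
      have yt: "y [^] t \<in> ?N" using subgroup_nat_pow_closed[OF N less.prems(1)] .
      have "(y [^] t) [^] r = y [^] s" using less.prems(1) t by (simp add: nat_pow_pow mult.commute)
      then have "\<forall>v\<in>P. y [^] t \<otimes> v = v \<otimes> y [^] t"
        using prime_step[OF yt r(1) rp(2,1)] less.prems(3) by metis
      then show ?thesis using less.IH[OF ts less.prems(1)] t less.prems(2) by (metis dvd_trans dvd_triv_right)
    qed
  qed
  have xN: "x \<in> ?N" using x by simp
  have "x [^] ?s \<in> P" using PN.pow_index_mem[of x] xN by (simp flip: nat_pow_consistent)
  then have "\<forall>v\<in>P. x [^] ?s \<otimes> v = v \<otimes> x [^] ?s" using PP.m_comm by simp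
  then show ?thesis using descend[OF xN s] u by blast
qed

lemma (in group) inv_mult_cancel:
  assumes "x \<in> carrier G" "y \<in> carrier G"
  shows "inv x \<otimes> (x \<otimes> y) = y" "x \<otimes> (inv x \<otimes> y) = y"
  using assms by (simp_all flip: m_assoc)

text \<open>
  Burnside's fusion argument: both \<open>P\<close> and its conjugate by \<open>t\<close> are Sylow subgroups of the centralizer \<open>C\<close> of
  \<open>t u t\<^sup>-\<^sup>1\<close>. They are conjugate by some \<open>c\<close> in \<open>C\<close>, so \<open>c t\<close> normalizes \<open>P\<close> and therefore commutes with \<open>u\<close>.
\<close>

lemma (in group) sylow_fusion:
  assumes fin: "finite (carrier G)" and p: "prime p"
    and P: "subgroup P G" "card P = p ^ e" "\<not> p dvd card (rcosets P)"
    and comm: "\<And>u v. u \<in> P \<Longrightarrow> v \<in> P \<Longrightarrow> u \<otimes> v = v \<otimes> u"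
    and central: "\<And>x u. x \<in> carrier G \<Longrightarrow> (\<And>v. v \<in> P \<Longrightarrow> x \<otimes> v \<otimes> inv x \<in> P) \<Longrightarrow> u \<in> P \<Longrightarrow> x \<otimes> u = u \<otimes> x"
    and u: "u \<in> P" and t: "t \<in> carrier G" "t \<otimes> u \<otimes> inv t \<in> P"
  shows "t \<otimes> u \<otimes> inv t = u"
proof -
  interpret P: subgroup P G by fact
  define v where "v = t \<otimes> u \<otimes> inv t"
  have v: "v \<in> P" "v \<in> carrier G" using t v_def by auto
  let ?C = "{y \<in> carrier G. v \<otimes> y = y \<otimes> v}"
  have C: "subgroup ?C G" using v by (intro centralizer_subgroup) auto
  have PC: "P \<subseteq> ?C" using comm v by auto
  let ?Q = "(\<lambda>a. t \<otimes> a \<otimes> inv t) ` P"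
  have Q: "subgroup ?Q G"
  proof (rule subgroupI)
    fix a assume "a \<in> ?Q"
    then obtain b where "b \<in> P" "a = t \<otimes> b \<otimes> inv t" by auto
    then show "inv a \<in> ?Q" using t by (intro image_eqI[of _ _ "inv b"]) (auto simp: inv_mult_group m_assoc)
  next
    fix a b assume "a \<in> ?Q" "b \<in> ?Q"
    then obtain c d where cd: "c \<in> P" "a = t \<otimes> c \<otimes> inv t" "d \<in> P" "b = t \<otimes> d \<otimes> inv t" by auto
    then have "a \<otimes> b = t \<otimes> (c \<otimes> d) \<otimes> inv t" using t by (simp add: m_assoc inv_mult_cancel)
    then show "a \<otimes> b \<in> ?Q" using cd by (intro image_eqI[of _ _ "c \<otimes> d"]) auto
  qed (use t in auto)
  have "inj_on (\<lambda>a. t \<otimes> a \<otimes> inv t) P" using t by (auto simp: inj_on_def)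
  then have cQ: "card ?Q = p ^ e" using P(2) by (simp add: card_image)
  have QC: "?Q \<subseteq> ?C"
  proof
    fix y assume "y \<in> ?Q"
    then obtain a where a: "a \<in> P" "y = t \<otimes> a \<otimes> inv t" by auto
    have "v \<otimes> y = t \<otimes> (u \<otimes> a) \<otimes> inv t" using a u t by (simp add: v_def m_assoc inv_mult_cancel)
    also have "\<dots> = t \<otimes> (a \<otimes> u) \<otimes> inv t" using comm[OF u a(1)] by simp
    also have "\<dots> = y \<otimes> v" using a u t by (simp add: v_def m_assoc inv_mult_cancel)
    finally show "y \<in> ?C" using a t by auto
  qed
  interpret CG: group "G\<lparr>carrier := ?C\<rparr>" using C by (rule subgroup_imp_group)
  have "\<not> p dvd card (rcosets\<^bsub>G\<lparr>carrier := ?C\<rparr>\<^esub> P)"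
    using subgroup_index_dvd_index[OF fin P(1) C PC] P(3) dvd_trans by blast
  then have "\<exists>g\<in>?C. \<forall>x\<in>?Q. g \<otimes> x \<otimes> inv\<^bsub>G\<lparr>carrier := ?C\<rparr>\<^esub> g \<in> P"
    using CG.p_subgroup_conjugate_into[OF _ p subgroup_incl[OF Q C QC] cQ subgroup_incl[OF P(1) C PC]] fin by simp
  then obtain c where c1: "c \<in> ?C" and "\<forall>x\<in>?Q. c \<otimes> x \<otimes> inv\<^bsub>G\<lparr>carrier := ?C\<rparr>\<^esub> c \<in> P" by (elim bexE)
  then have "\<forall>x\<in>?Q. c \<otimes> x \<otimes> inv c \<in> P" unfolding m_inv_consistent[OF C c1] by simp
  with c1 have c: "c \<in> ?C" "\<And>x. x \<in> ?Q \<Longrightarrow> c \<otimes> x \<otimes> inv c \<in> P" by (simp, blast)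
  have ct: "c \<otimes> t \<in> carrier G" using c t by auto
  have norm: "c \<otimes> t \<otimes> a \<otimes> inv (c \<otimes> t) \<in> P" if "a \<in> P" for a
    using c(2)[of "t \<otimes> a \<otimes> inv t"] that c(1) t by (simp add: inv_mult_group m_assoc)
  have "c \<otimes> t \<otimes> u = u \<otimes> (c \<otimes> t)" using central[OF ct norm u] by simp
  then have "u = c \<otimes> t \<otimes> u \<otimes> inv (c \<otimes> t)" using ct u by (simp add: inv_solve_right)
  also have "\<dots> = c \<otimes> v \<otimes> inv c" using c(1) t u by (simp add: v_def inv_mult_group m_assoc)
  also have "\<dots> = v" using c(1) v by (auto simp: inv_solve_right')
  finally show ?thesis by (simp add: v_def)
qed

text \<open>
  The setting for the transfer of \<open>G\<close> into \<open>P\<close>. The group \<open>G\<close> acts by right translation on the right cosets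
  of \<open>P\<close>, and the factor \<open>tr g C\<close> in \<open>P\<close> measures how far the chosen representatives are from being compatible with
  translation by \<open>g\<close>. These factors satisfy the cocycle identity \<open>tr_mult\<close>, so their product over all cosets is
  a homomorphism, the transfer.
\<close>

locale abelian_subgroup_cosets = group G + P: subgroup P G for G (structure) and P +
  assumes fin: "finite (carrier G)"
    and comm: "u \<in> P \<Longrightarrow> v \<in> P \<Longrightarrow> u \<otimes> v = v \<otimes> u"
begin

abbreviation "A \<equiv> G\<lparr>carrier := P\<rparr>"

definition rep where "rep C = (SOME x. x \<in> C)"

sublocale A: comm_group A
  using subgroup_imp_group[OF P.subgroup_axioms] comm by (intro group.group_comm_groupI) auto

lemma rep_mem: "C \<in> rcosets P \<Longrightarrow> rep C \<in> C"
  using P.rcosets_non_empty unfolding rep_def by (metis some_in_eq)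

lemma rep_closed: "C \<in> rcosets P \<Longrightarrow> rep C \<in> carrier G"
  using rep_mem P.rcosets_carrier[OF is_group] by blast

lemma coset_translate: "C \<in> rcosets P \<Longrightarrow> g \<in> carrier G \<Longrightarrow> C #> g \<in> rcosets P"
  by (auto simp: RCOSETS_def coset_mult_assoc P.subset)

lemma coset_translate_mult: "C \<in> rcosets P \<Longrightarrow> g \<in> carrier G \<Longrightarrow> h \<in> carrier G \<Longrightarrow> C #> (g \<otimes> h) = (C #> g) #> h"
  by (rule coset_mult_assoc[symmetric]) (use P.rcosets_carrier[OF is_group] in auto)

lemma coset_translate_one: "C \<in> rcosets P \<Longrightarrow> C #> \<one> = C"
  by (rule coset_mult_one) (use P.rcosets_carrier[OF is_group] in auto)

lemma finite_rcosets: "finite (rcosets P)"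
  using fin rcosets_subset_PowG[OF P.subgroup_axioms] by (meson finite_Pow_iff finite_subset)

lemma coset_translate_bij: "g \<in> carrier G \<Longrightarrow> bij_betw (\<lambda>C. C #> g) (rcosets P) (rcosets P)"
  by (rule bij_betwI[where g = "\<lambda>C. C #> inv g"])
     (auto simp: coset_translate coset_translate_one simp flip: coset_translate_mult)

definition tr where "tr g C = rep C \<otimes> g \<otimes> inv (rep (C #> g))"

lemma tr_closed:
  assumes "C \<in> rcosets P" "g \<in> carrier G"
  shows "tr g C \<in> P"
proof -
  have "rep C \<otimes> g \<in> C #> g" using rep_mem[OF assms(1)] by (auto simp: r_coset_def)
  then show ?thesis
    unfolding tr_def
    using diff_neutralizes[OF P.subgroup_axioms coset_translate[OF assms]] rep_mem[OF coset_translate[OF assms]] by blast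
qed

lemma tr_mult:
  assumes "C \<in> rcosets P" "g \<in> carrier G" "h \<in> carrier G"
  shows "tr (g \<otimes> h) C = tr g C \<otimes> tr h (C #> g)"
  using assms rep_closed coset_translate
  by (simp add: tr_def coset_translate_mult m_assoc inv_mult_cancel)

definition transfer where "transfer g = finprod A (tr g) (rcosets P)"

lemma transfer_hom: "transfer \<in> hom G A"
proof (rule homI)
  fix g h assume g: "g \<in> carrier G" and h: "h \<in> carrier G"
  let ?R = "rcosets P"
  have "transfer (g \<otimes> h) = finprod A (\<lambda>C. tr g C \<otimes>\<^bsub>A\<^esub> tr h (C #> g)) ?R"
    unfolding transfer_def using g h by (intro A.finprod_cong') (auto simp: tr_mult tr_closed coset_translate)
  also have "\<dots> = finprod A (tr g) ?R \<otimes>\<^bsub>A\<^esub> finprod A (\<lambda>C. tr h (C #> g)) ?R"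
    using g h by (intro A.finprod_multf) (auto simp: tr_closed coset_translate)
  also have "finprod A (\<lambda>C. tr h (C #> g)) ?R = finprod A (tr h) ((\<lambda>C. C #> g) ` ?R)"
    using coset_translate_bij[OF g] h by (intro A.finprod_reindex[symmetric]) (auto simp: bij_betw_def tr_closed coset_translate g)
  finally show "transfer (g \<otimes> h) = transfer g \<otimes>\<^bsub>A\<^esub> transfer h"
    using coset_translate_bij[OF g] by (simp add: transfer_def bij_betw_def)
qed (use A.finprod_closed[of "tr _" "rcosets P"] tr_closed in \<open>auto simp: transfer_def\<close>)

text \<open>
  The product telescopes along the translates of \<open>C\<close>.
\<close>

lemma tr_prod_powers:
  assumes C: "C \<in> rcosets P" and u: "u \<in> carrier G"
  shows "finprod A (\<lambda>i. tr u (C #> u [^] i)) {..<n} = tr (u [^] (n::nat)) C"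
proof (induction n)
  case 0
  show ?case using C by (simp add: tr_def coset_translate_one rep_closed)
next
  case (Suc n)
  have Cu: "C #> u [^] i \<in> rcosets P" for i :: nat using C u coset_translate by simp
  have "finprod A (\<lambda>i. tr u (C #> u [^] i)) {..<Suc n} = tr u (C #> u [^] n) \<otimes>\<^bsub>A\<^esub> tr (u [^] n) C"
    unfolding lessThan_Suc Suc[symmetric] using Cu u by (intro A.finprod_insert) (auto simp: tr_closed)
  also have "\<dots> = tr (u [^] n) C \<otimes> tr u (C #> u [^] n)"
    using comm tr_closed Cu C u by simp
  also have "\<dots> = tr (u [^] Suc n) C" using tr_mult[of C "u [^] n" u] C u by simp
  finally show ?case .
qed

text \<open>
  The cosets in \<open>S\<close> fall into orbits of length \<open>p\<close> under translation by \<open>u\<close>, and over an orbit the product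
  telescopes to \<open>tr (u\<^sup>p) C = \<one>\<close>.
\<close>

lemma tr_prod_moved_cosets:
  assumes p: "prime p" and u: "u \<in> carrier G" "u [^] (p::nat) = \<one>"
    and S: "S \<subseteq> rcosets P" "\<And>C. C \<in> S \<Longrightarrow> C #> u \<in> S" "\<And>C. C \<in> S \<Longrightarrow> C #> u \<noteq> C"
  shows "finprod A (tr u) S = \<one>"
proof -
  have "finite S" using S(1) finite_rcosets finite_subset by blast
  then show ?thesis using S
  proof (induction S rule: finite_psubset_induct)
    case (psubset S)
    show ?case
    proof (cases "S = {}")
      case False
      then obtain C where C: "C \<in> S" by blast
      have CR: "C \<in> rcosets P" using C psubset.prems by blast
      have CS: "C #> u [^] i \<in> S" for i :: nat
      proof (induction i)
        case (Suc i)
        then show ?case using psubset.prems(2)[OF Suc] CR u by (simp add: coset_translate_mult)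
      qed (use C CR coset_translate_one in simp)
      let ?f = "\<lambda>i::nat. C #> u [^] i"
      have per: "?f (i + p * k) = ?f i" for i k
      proof -
        have "u [^] (i + p * k) = u [^] i" using u by (simp flip: nat_pow_mult nat_pow_pow)
        then show ?thesis by simp
      qed
      have shift: "?f (i + j) = ?f i #> u [^] j" for i j
        using CR u by (simp add: coset_translate_mult flip: nat_pow_mult)
      have fixn: "?f (d * k) = C" if "?f d = C" for d k
      proof (induction k)
        case (Suc k)
        have "?f (d * Suc k) = ?f (d + d * k)" by simp
        also have "\<dots> = ?f d #> u [^] (d * k)" by (rule shift)
        finally show ?case using Suc that by simp
      qed (use CR coset_translate_one in simp)
      \<comment> \<open>as \<open>p\<close> is prime, a coset fixed by such a power of \<open>u\<close> would be fixed by \<open>u\<close>\<close>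
      have free: "\<not> ?f d = C" if d: "0 < d" "d < p" for d
      proof
        assume eq: "?f d = C"
        have "coprime d p" using d p by (metis coprime_commute nat_dvd_not_less prime_imp_coprime)
        then obtain x y where xy: "d * x = p * y + 1" using bezout_nat[of d p] d by (metis coprime_imp_gcd_eq_1 neq0_conv)
        have "C = ?f (1 + p * y)" using fixn[OF eq, of x] xy by simp
        also have "\<dots> = C #> u" using per[of 1 y] u by simp
        finally show False using psubset.prems(3)[OF C] by simp
      qed
      have ne: "?f i \<noteq> ?f j" if ij: "i < j" "j < p" for i j
      proof
        assume eq: "?f i = ?f j"
        have "?f (j - i) = ?f (j + (p - i))"
          using per[of "j - i" 1] ij by simp
        also have "\<dots> = ?f (i + (p - i))" using eq by (simp only: shift)
        also have "\<dots> = C" using per[of 0 1] ij CR by (simp add: coset_translate_one)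
        finally show False using free[of "j - i"] ij by simp
      qed
      then have inj: "inj_on ?f {..<p}" by (intro linorder_inj_onI) auto
      let ?O = "?f ` {..<p}"
      have OS: "?O \<subseteq> S" using CS by auto
      have p0: "0 < p" using p prime_gt_0_nat by blast
      have tri: "tr u D \<in> carrier A" if "D \<in> S" for D using that psubset.prems(1) u tr_closed by auto
      have "finprod A (tr u) ?O = finprod A (\<lambda>i. tr u (?f i)) {..<p}"
        using inj tri CS by (intro A.finprod_reindex) auto
      also have "\<dots> = \<one>" using tr_prod_powers[OF CR u(1), of p] u(2) CR by (simp add: tr_def coset_translate_one rep_closed)
      finally have O1: "finprod A (tr u) ?O = \<one>" .
      have "finprod A (tr u) (S - ?O) = \<one>"
      proof (rule psubset.IH)
        have "C \<in> ?O"
          by (rule image_eqI[of _ _ 0]) (use coset_translate_one[OF CR] p0 in simp_all)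
        then show "S - ?O \<subset> S" using C by blast
        show "S - ?O \<subseteq> rcosets P" using psubset.prems(1) by blast
        fix D assume D: "D \<in> S - ?O"
        have DR: "D \<in> rcosets P" using D psubset.prems(1) by blast
        show "D #> u \<noteq> D" using D psubset.prems(3) by blast
        have "D #> u \<notin> ?O"
        proof
          assume "D #> u \<in> ?O"
          then obtain i where i: "D #> u = ?f i" by auto
          have "D = D #> u [^] p" using u DR coset_translate_one by simp
          also have "u [^] p = u \<otimes> u [^] (p - 1)" using u p0 by (metis Suc_pred' One_nat_def nat_pow_Suc2)
          also have "D #> (u \<otimes> u [^] (p - 1)) = ?f i #> u [^] (p - 1)"
            using DR u i by (simp add: coset_translate_mult)
          also have "\<dots> = ?f (i + (p - 1))" by (simp only: shift)
          also have "\<dots> = ?f ((i + (p - 1)) mod p)"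
            using per[of "(i + (p - 1)) mod p" "(i + (p - 1)) div p"] by simp
          finally show False using D p0 by auto
        qed
        then show "D #> u \<in> S - ?O" using D psubset.prems(2) by blast
      qed
      moreover have "finprod A (tr u) (?O \<union> (S - ?O)) = finprod A (tr u) ?O \<otimes>\<^bsub>A\<^esub> finprod A (tr u) (S - ?O)"
        using psubset.hyps OS tri by (intro A.finprod_Un_disjoint) (auto intro: finite_subset)
      ultimately show ?thesis using OS O1 by (simp add: Un_absorb1)
    qed simp
  qed
qed

end

text \<open>
  Burnside's transfer theorem. For \<open>u\<close> of order \<open>p\<close> in \<open>P\<close> only the cosets fixed by \<open>u\<close> contribute to the transfer
  of \<open>u\<close>, and each contributes a conjugate of \<open>u\<close> that lies in \<open>P\<close>, which is \<open>u\<close> itself by fusion. The number of these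
  cosets is congruent to the index of \<open>P\<close> modulo \<open>p\<close>, so the transfer of \<open>u\<close> is nontrivial. Hence the transfer is
  injective on \<open>P\<close>, it maps onto \<open>P\<close>, and its kernel is the subgroup sought.
\<close>

lemma (in group) normal_complement_of_central_sylow:
  assumes fin: "finite (carrier G)" and p: "prime p"
    and P: "subgroup P G" "card P = p ^ e" "\<not> p dvd card (rcosets P)"
    and comm: "\<And>u v. u \<in> P \<Longrightarrow> v \<in> P \<Longrightarrow> u \<otimes> v = v \<otimes> u"
    and central: "\<And>x u. x \<in> carrier G \<Longrightarrow> (\<And>v. v \<in> P \<Longrightarrow> x \<otimes> v \<otimes> inv x \<in> P) \<Longrightarrow> u \<in> P \<Longrightarrow> x \<otimes> u = u \<otimes> x"
  shows "\<exists>K. K \<lhd> G \<and> card K * card P = order G"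
proof -
  interpret abelian_subgroup_cosets G P
    using P(1) fin comm by (intro abelian_subgroup_cosets.intro abelian_subgroup_cosets_axioms.intro is_group) auto
  interpret V: group_hom G A transfer
    by (intro group_hom.intro group_hom_axioms.intro is_group A.is_group transfer_hom)
  have on_order_p: "transfer u \<noteq> \<one>" if u: "u \<in> P" "u \<noteq> \<one>" "u [^] p = \<one>" for u
  proof -
    have uG: "u \<in> carrier G" using u by simp
    let ?F = "{C \<in> rcosets P. C #> u = C}"
    let ?M = "{C \<in> rcosets P. C #> u \<noteq> C}"
    have "finprod A (tr u) ?M = \<one>"
    proof (rule tr_prod_moved_cosets[OF p uG u(3)])
      fix C assume C: "C \<in> ?M"
      have "C #> u #> u \<noteq> C #> u"
        using C coset_translate_bij[OF uG] coset_translate[of C u] uG by (auto simp: bij_betw_def inj_on_def)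
      then show "C #> u \<in> ?M" using C coset_translate uG by simp
    qed auto
    moreover have "finprod A (tr u) ?F = u [^]\<^bsub>A\<^esub> card ?F"
    proof -
      have "tr u C = u" if C: "C \<in> ?F" for C
      proof -
        have tr: "tr u C = rep C \<otimes> u \<otimes> inv (rep C)" using C by (simp add: tr_def)
        have "rep C \<otimes> u \<otimes> inv (rep C) = u"
        proof (rule sylow_fusion[OF fin p P])
          show "rep C \<otimes> u \<otimes> inv (rep C) \<in> P" using tr_closed[of C u] C uG tr by simp
          show "rep C \<in> carrier G" using C rep_closed by simp
        qed (fact u(1) comm central)+
        then show ?thesis using tr by simp
      qed
      then have "finprod A (tr u) ?F = finprod A (\<lambda>_. u) ?F" using u by (intro A.finprod_cong') auto
      then show ?thesis using u by (simp add: A.finprod_const)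
    qed
    moreover have "finprod A (tr u) (?F \<union> ?M) = finprod A (tr u) ?F \<otimes>\<^bsub>A\<^esub> finprod A (tr u) ?M"
      using finite_rcosets tr_closed uG by (intro A.finprod_Un_disjoint) auto
    moreover have "?F \<union> ?M = rcosets P" by auto
    ultimately have V: "transfer u = u [^] card ?F"
      using u uG by (simp add: transfer_def flip: nat_pow_consistent)
    have "[card (rcosets P) = card ?F] (mod p)"
    proof (rule prime_period_fixed_points[OF p finite_rcosets])
      fix C assume C: "C \<in> rcosets P"
      have "((\<lambda>C. C #> u) ^^ k) C = C #> u [^] k" for k
        by (induction k) (use C uG in \<open>auto simp: coset_translate_one coset_translate_mult\<close>)
      then show "((\<lambda>C. C #> u) ^^ p) C = C" using u(3) C coset_translate_one by simp
    qed (use coset_translate uG in auto)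
    then have "\<not> p dvd card ?F" using P(3) by (simp add: cong_dvd_iff)
    moreover have "ord u = p"
    proof -
      have "ord u dvd p" "ord u \<noteq> 1" using u uG pow_eq_id ord_eq_1 by auto
      then show ?thesis using p prime_nat_iff by blast
    qed
    ultimately show ?thesis using V pow_eq_id[OF uG] by simp
  qed
  have inj: "inj_on transfer P"
  proof -
    have "x = \<one>" if x: "x \<in> P" "transfer x = \<one>" for x
    proof (rule ccontr)
      assume x1: "x \<noteq> \<one>"
      have xG: "x \<in> carrier G" using x by simp
      have "x [^]\<^bsub>A\<^esub> order A = \<one>\<^bsub>A\<^esub>" using x by (intro A.pow_order_eq_1) auto
      then have "x [^] p ^ e = \<one>" using P(2) by (simp add: order_def flip: nat_pow_consistent)
      then have "ord x dvd p ^ e" using pow_eq_id xG by simp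
      then obtain i where i: "ord x = p ^ i" using p by (auto simp: divides_primepow_nat)
      have "i \<noteq> 0" using i x1 xG ord_eq_1 by (metis power_0)
      then have i': "ord x = p ^ (i - 1) * p" using i by (metis Suc_diff_1 gr0I power_Suc2)
      let ?u = "x [^] p ^ (i - 1)"
      have "?u \<in> P" using x P(1) by (intro subgroup_nat_pow_closed)
      moreover have "?u \<noteq> \<one>"
      proof
        assume "?u = \<one>"
        then have "p ^ (i - 1) * p dvd p ^ (i - 1)" using pow_eq_id xG i' by metis
        then show False using p by (simp add: prime_gt_0_nat)
      qed
      moreover have "?u [^] p = \<one>" using xG i' by (metis nat_pow_pow pow_ord_eq_1)
      moreover have "transfer ?u = \<one>" using V.hom_nat_pow[OF xG] x A.nat_pow_one by simp
      ultimately show False using on_order_p by blast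
    qed
    then show ?thesis
      using V.inj_on_subgroup_iff_trivial_ker[OF P(1)] unfolding kernel_def by auto
  qed
  have "transfer ` P = P"
    using inj fin P.subset finite_subset V.hom_closed by (intro endo_inj_surj) auto
  then have "transfer ` carrier G = carrier A"
    using V.hom_closed image_mono[OF P.subset, of transfer] by auto
  then have "order (G Mod kernel G A transfer) = card P"
    using V.FactGroup_iso iso_same_card by (fastforce simp: order_def)
  then have "card (rcosets (kernel G A transfer)) = card P"
    by (simp add: order_def FactGroup_def)
  then have "card (kernel G A transfer) * card P = order G"
    using lagrange[OF V.subgroup_kernel] by (simp add: mult.commute)
  then show ?thesis using V.normal_kernel by blast
qed

section \<open>The Sylow tower of a group of odd cube-free order\<close>

lemma (in group) inj_on_mult_of_trivial_Int:
  assumes H: "subgroup H G" and K: "subgroup K G" and triv: "\<And>x. x \<in> H \<Longrightarrow> x \<in> K \<Longrightarrow> x = \<one>"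
  shows "inj_on (\<lambda>(h, k). h \<otimes> k) (H \<times> K)"
proof (intro inj_onI, clarsimp)
  interpret H: subgroup H G by fact
  interpret K: subgroup K G by fact
  fix h k h' k' assume *: "h \<in> H" "k \<in> K" "h' \<in> H" "k' \<in> K" and eq: "h \<otimes> k = h' \<otimes> k'"
  have "inv h' \<otimes> h = inv h' \<otimes> (h \<otimes> k) \<otimes> inv k" using *(1-3) by (simp add: m_assoc)
  also have "\<dots> = k' \<otimes> inv k" using * unfolding eq by (simp add: m_assoc inv_mult_cancel)
  finally have "inv h' \<otimes> h \<in> K" using * by simp
  moreover have "inv h' \<otimes> h \<in> H" using * by simp
  ultimately have "inv h' \<otimes> h = \<one>" using triv by blast
  then have "h = h'" using * by (metis H.mem_carrier inv_closed inv_equality inv_inv)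
  then show "h = h' \<and> k = k'" using * eq by simp
qed

lemma (in group) coprime_subgroups_factorize:
  assumes fin: "finite (carrier G)" and H: "subgroup H G" and K: "subgroup K G"
    and cop: "coprime (card H) (card K)" and ord: "card H * card K = order G"
  shows "bij_betw (\<lambda>(h, k). h \<otimes> k) (H \<times> K) (carrier G)"
proof -
  interpret H: subgroup H G by fact
  interpret K: subgroup K G by fact
  have triv: "x = \<one>" if x: "x \<in> H" "x \<in> K" for x
  proof -
    have "ord x dvd card S" if S: "subgroup S G" "x \<in> S" for S
    proof -
      interpret S: group "G\<lparr>carrier := S\<rparr>" using S(1) by (rule subgroup_imp_group)
      have "x [^]\<^bsub>G\<lparr>carrier := S\<rparr>\<^esub> order (G\<lparr>carrier := S\<rparr>) = \<one>"
        using S.pow_order_eq_1[of x] S(2) by simp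
      then show ?thesis
        using pow_eq_id[of x] subgroup.mem_carrier[OF S] by (simp add: order_def flip: nat_pow_consistent)
    qed
    then have "ord x = 1" using H K x cop coprime_common_divisor_nat by blast
    then show ?thesis using ord_eq_1 x by simp
  qed
  have inj: "inj_on (\<lambda>(h, k). h \<otimes> k) (H \<times> K)"
    using inj_on_mult_of_trivial_Int[OF H K triv] .
  moreover have "(\<lambda>(h, k). h \<otimes> k) ` (H \<times> K) = carrier G"
    using inj ord fin by (intro card_subset_eq) (auto simp: card_image card_cartesian_product order_def)
  ultimately show ?thesis by (simp add: bij_betw_def)
qed

text \<open>
  If \<open>x\<close> has order dividing the order of \<open>N\<close>, then both this power of \<open>x\<close> and the power by the index lie in \<open>N\<close>.
  In particular \<open>N\<close> is a characteristic subgroup.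
\<close>

lemma (in group) normal_coprime_index_eq_torsion:
  assumes fin: "finite (carrier G)" and N: "N \<lhd> G" and cop: "coprime (card N) (card (rcosets N))"
  shows "N = {x \<in> carrier G. x [^] card N = \<one>}"
proof -
  interpret N: normal N G by fact
  interpret NG: group "G\<lparr>carrier := N\<rparr>" by (rule subgroup_imp_group[OF N.subgroup_axioms])
  have "x [^] card N = \<one>" if "x \<in> N" for x
    using NG.pow_order_eq_1[of x] that by (simp add: order_def flip: nat_pow_consistent)
  moreover have "x \<in> N" if x: "x \<in> carrier G" "x [^] card N = \<one>" for x
  proof -
    have "card (rcosets N) \<noteq> 0"
      using lagrange[OF N.subgroup_axioms] fin by (metis gr0I mult_is_0 order_gt_0_iff_finite less_irrefl)
    then obtain a b where ab: "card (rcosets N) * a = card N * b + 1"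
      using bezout_nat[of "card (rcosets N)" "card N"] cop by (metis coprime_commute coprime_imp_gcd_eq_1)
    have "x [^] card (rcosets N) \<in> N" using x N.pow_index_mem by blast
    then have "x [^] (card (rcosets N) * a) \<in> N"
      using subgroup_nat_pow_closed[OF N.subgroup_axioms] x by (simp flip: nat_pow_pow)
    moreover have "x [^] (card N * b + 1) = x" using x by (simp flip: nat_pow_mult nat_pow_pow)
    ultimately show ?thesis using ab by simp
  qed
  ultimately show ?thesis using N.subset by blast
qed

lemma (in group) normal_coprime_index_trans:
  assumes fin: "finite (carrier G)" and K: "K \<lhd> G" and Q: "Q \<lhd> G\<lparr>carrier := K\<rparr>"
    and cop: "coprime (card Q) (card (rcosets\<^bsub>G\<lparr>carrier := K\<rparr>\<^esub> Q))"
  shows "Q \<lhd> G"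
proof (rule normal_invI)
  interpret K: normal K G by fact
  interpret KG: group "G\<lparr>carrier := K\<rparr>" by (rule subgroup_imp_group[OF K.subgroup_axioms])
  have Qsub: "subgroup Q (G\<lparr>carrier := K\<rparr>)" using Q by (rule normal_imp_subgroup)
  show "subgroup Q G" using incl_subgroup[OF K.subgroup_axioms Qsub] .
  have Q_eq: "Q = {x \<in> K. x [^] card Q = \<one>}"
    using KG.normal_coprime_index_eq_torsion[OF _ Q cop] finite_subset[OF K.subset fin]
    by (simp flip: nat_pow_consistent)
  fix x h assume x: "x \<in> carrier G" "h \<in> Q"
  have h: "h \<in> K" "h [^] card Q = \<one>" using x(2) Q_eq by blast+
  have "(x \<otimes> h \<otimes> inv x) [^] n = x \<otimes> h [^] n \<otimes> inv x" for n :: nat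
    by (induction n) (use x h in \<open>auto simp: m_assoc inv_mult_cancel\<close>)
  then have "(x \<otimes> h \<otimes> inv x) [^] card Q = \<one>" using h x by simp
  then show "x \<otimes> h \<otimes> inv x \<in> Q" using Q_eq K.inv_op_closed2 x h by blast
qed

lemma prime_power_decompose:
  assumes "prime (q::nat)" "n \<noteq> 0"
  obtains m where "n = q ^ multiplicity q n * m" "\<not> q dvd m"
proof (rule multiplicity_decompose'[of n q])
  show "n \<noteq> 0" "\<not> is_unit q" using assms by auto
qed (rule that)

lemma cube_free_dvd: "cube_free n \<Longrightarrow> m dvd n \<Longrightarrow> cube_free m"
  unfolding cube_free_def using dvd_trans by blast

lemma cube_free_pos: "cube_free n \<Longrightarrow> n > 0"
  unfolding cube_free_def using two_is_prime_nat by (metis dvd_0_right gr0I)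

lemma cube_free_multiplicity_le: "cube_free n \<Longrightarrow> prime p \<Longrightarrow> multiplicity p n \<le> 2"
proof (rule ccontr)
  assume "cube_free n" "prime p" "\<not> multiplicity p n \<le> 2"
  then have "p ^ 3 dvd n" by (intro multiplicity_dvd') simp
  then show False using \<open>cube_free n\<close> \<open>prime p\<close> by (simp add: cube_free_def)
qed

lemma (in group) odd_cube_free_normal_complement:
  assumes odd: "odd (order G)" and cf: "cube_free (order G)" and ne: "order G \<noteq> 1"
  obtains p e K P where "prime p" "\<And>r. prime r \<Longrightarrow> r dvd order G \<Longrightarrow> p \<le> r" "1 \<le> e" "e \<le> 2"
    "K \<lhd> G" "subgroup P G" "card P = p ^ e" "card K * card P = order G" "coprime (card K) (card P)"
proof -
  have fin: "finite (carrier G)" using cube_free_pos[OF cf] order_gt_0_iff_finite by simp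
  define p where "p = (LEAST p. prime p \<and> p dvd order G)"
  have "\<exists>p. prime p \<and> p dvd order G" using ne prime_factor_nat by blast
  then have "prime p \<and> p dvd order G" unfolding p_def by (rule LeastI_ex)
  then have p: "prime p" "p dvd order G" by auto
  have least: "p \<le> r" if "prime r" "r dvd order G" for r
    unfolding p_def using that by (intro Least_le) simp
  define e where "e = multiplicity p (order G)"
  obtain m where m: "order G = p ^ e * m" "\<not> p dvd m"
    using prime_power_decompose[OF p(1)] cube_free_pos[OF cf] unfolding e_def by blast
  have "e > 0" using p cube_free_pos[OF cf] unfolding e_def by (subst prime_multiplicity_gt_zero_iff) auto
  then have e: "1 \<le> e" "e \<le> 2" using cube_free_multiplicity_le[OF cf p(1)] e_def by auto
  obtain P where P: "subgroup P G" "card P = p ^ e"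
    using sylow_thm[OF p(1) is_group m(1) fin] by blast
  have index: "card (rcosets P) = m"
    using lagrange[OF P(1)] m P(2) p(1) by (simp add: prime_gt_0_nat)
  interpret PP: comm_group "G\<lparr>carrier := P\<rparr>"
    using group.order_prime_power_le_2_abelian[OF subgroup_imp_group[OF P(1)] p(1) _ e(2)] P(2)
    by (simp add: order_def)
  have "\<exists>K. K \<lhd> G \<and> card K * card P = order G"
  proof (rule normal_complement_of_central_sylow[OF fin p(1) P])
    show "\<not> p dvd card (rcosets P)" using index m by simp
    show "u \<otimes> v = v \<otimes> u" if "u \<in> P" "v \<in> P" for u v using PP.m_comm that by simp
    show "x \<otimes> u = u \<otimes> x" if "x \<in> carrier G" "\<And>v. v \<in> P \<Longrightarrow> x \<otimes> v \<otimes> inv x \<in> P" "u \<in> P" for x u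
      using normalizing_imp_centralizing[OF fin odd p(1) least P e(2) _ that] index m by blast
  qed
  then obtain K where K: "K \<lhd> G" "card K * card P = order G" by blast
  then have "card K = m" using m P(2) p(1) by (simp add: prime_gt_0_nat)
  then have "coprime (card K) (card P)"
    using P(2) m(2) p(1) by (metis coprime_commute coprime_power_right_iff prime_imp_coprime)
  then show ?thesis using that[OF p(1) least e K(1) P K(2)] by blast
qed

text \<open>
  Induction along the Sylow tower, in which every step adds a Sylow subgroup for a prime smaller than the previous ones.
\<close>

lemma odd_cube_free_group_induct [consumes 3, case_names trivial extension]:
  fixes G :: "('a, 'b) monoid_scheme"
  assumes "group G" "odd (order G)" "cube_free (order G)"
    and trivial: "\<And>G :: ('a, 'b) monoid_scheme. group G \<Longrightarrow> order G = 1 \<Longrightarrow> Q G"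
    and extension: "\<And>(G :: ('a, 'b) monoid_scheme) p e K P.
      \<lbrakk>group G; odd (order G); cube_free (order G); prime p;
       \<And>r. prime r \<Longrightarrow> r dvd order G \<Longrightarrow> p \<le> r; 1 \<le> e; e \<le> 2;
       K \<lhd> G; subgroup P G; card P = p ^ e; card K * card P = order G; coprime (card K) (card P);
       Q (G\<lparr>carrier := K\<rparr>)\<rbrakk> \<Longrightarrow> Q G"
  shows "Q G"
  using assms(1-3)
proof (induction "order G" arbitrary: G rule: less_induct)
  case less
  then interpret group G by simp
  show ?case
  proof (cases "order G = 1")
    case True
    then show ?thesis using trivial less by blast
  next
    case False
    obtain p e K P where *: "prime p" "\<And>r. prime r \<Longrightarrow> r dvd order G \<Longrightarrow> p \<le> r" "1 \<le> e" "e \<le> 2"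
      "K \<lhd> G" "subgroup P G" "card P = p ^ e" "card K * card P = order G" "coprime (card K) (card P)"
      using odd_cube_free_normal_complement[OF less.prems(2,3) False] by blast
    have "1 < card P" using one_less_power[OF prime_gt_1_nat[OF *(1)], of e] *(3,7) by simp
    moreover have "0 < card K" using *(8) cube_free_pos[OF less.prems(3)] by (intro gr0I) simp
    ultimately have "card K < order G" using *(8) by (metis mult.right_neutral nat_mult_less_cancel1)
    moreover have "card K dvd order G" using *(8) by (metis dvd_triv_left)
    ultimately have "Q (G\<lparr>carrier := K\<rparr>)"
      using less.prems cube_free_dvd
      by (intro less.hyps) (auto simp: order_def intro: subgroup_imp_group[OF normal_imp_subgroup[OF *(5)]] dvd_trans)
    then show ?thesis using extension[OF less.prems *] by blast
  qed
qed

text \<open>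
  The bottom of the tower is characteristic in each term of the tower, hence normal in the next one.
\<close>

lemma largest_prime_sylow_normal:
  fixes G :: "('a, 'b) monoid_scheme"
  assumes "group G" "odd (order G)" "cube_free (order G)"
    and "prime q" "q dvd order G" "\<And>r. prime r \<Longrightarrow> r dvd order G \<Longrightarrow> r \<le> q"
  shows "\<exists>Q. Q \<lhd> G \<and> card Q = q ^ multiplicity q (order G)"
  using assms
proof (induction rule: odd_cube_free_group_induct)
  case (trivial G)
  then show ?case by simp
next
  case (extension G p e K P)
  interpret group G by fact
  interpret K: normal K G by fact
  interpret KG: group "G\<lparr>carrier := K\<rparr>" by (rule subgroup_imp_group[OF K.subgroup_axioms])
  have fin: "finite (carrier G)" using cube_free_pos[OF extension.hyps(3)] order_gt_0_iff_finite by simp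
  have n0: "card K \<noteq> 0" using extension.hyps cube_free_pos by (metis mult_is_0 less_irrefl)
  show ?case
  proof (cases "q = p")
    case True
    have "card K = 1"
    proof (rule ccontr)
      assume "card K \<noteq> 1"
      then obtain r where r: "prime r" "r dvd card K" using prime_factor_nat by blast
      have "r dvd order G" using r(2) extension.hyps by (metis dvd_mult2)
      then have "r = p" using True extension.prems(3) extension.hyps(5) r(1) by (metis le_antisym)
      then have "r dvd card P" using extension.hyps by (simp add: dvd_power)
      then show False using r extension.hyps by (metis coprime_common_divisor_nat not_prime_1)
    qed
    then have "order G = q ^ e" using extension.hyps True by simp
    then have "card (carrier G) = q ^ multiplicity q (order G)"
      using extension.prems(1) by (simp add: order_def)
    then show ?thesis using normal_self by blast
  next
    case False
    have "\<not> q dvd p ^ e" using False extension.prems(1) extension.hyps(4) by (metis prime_dvd_power primes_dvd_imp_eq)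
    then have "q dvd card K" using extension.hyps extension.prems by (metis prime_dvd_multD)
    moreover have "r \<le> q" if "prime r" "r dvd card K" for r
      using extension.prems(3) extension.hyps(11) that by (metis dvd_mult2)
    ultimately obtain Q where Q: "Q \<lhd> G\<lparr>carrier := K\<rparr>" "card Q = q ^ multiplicity q (card K)"
      using extension.IH extension.prems(1) by (auto simp: order_def)
    have "multiplicity q (card K * p ^ e) = multiplicity q (card K) + multiplicity q (p ^ e)"
      using n0 extension.prems(1) extension.hyps(4) by (intro prime_elem_multiplicity_mult_distrib) auto
    then have mult: "multiplicity q (order G) = multiplicity q (card K)"
      using \<open>\<not> q dvd p ^ e\<close> extension.hyps(10,11) by (metis add_0_right not_dvd_imp_multiplicity_0)
    have Qsub: "subgroup Q (G\<lparr>carrier := K\<rparr>)" using Q(1) by (rule normal_imp_subgroup)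
    obtain m where m: "card K = q ^ multiplicity q (card K) * m" "\<not> q dvd m"
      using prime_power_decompose[OF extension.prems(1) n0] by blast
    have "card (rcosets\<^bsub>G\<lparr>carrier := K\<rparr>\<^esub> Q) * card Q = card K"
      using KG.lagrange[OF Qsub] by (simp add: order_def)
    also have "\<dots> = m * card Q" using m(1) Q(2) by (metis mult.commute)
    finally have "card (rcosets\<^bsub>G\<lparr>carrier := K\<rparr>\<^esub> Q) * card Q = m * card Q" .
    then have "card (rcosets\<^bsub>G\<lparr>carrier := K\<rparr>\<^esub> Q) = m"
      using Q(2) extension.prems(1) by (simp add: prime_gt_0_nat)
    then have "coprime (card Q) (card (rcosets\<^bsub>G\<lparr>carrier := K\<rparr>\<^esub> Q))"
      using Q(2) m(2) extension.prems(1) by (metis coprime_power_left_iff prime_imp_coprime)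
    then have "Q \<lhd> G" using normal_coprime_index_trans[OF fin extension.hyps(8) Q(1)] by blast
    then show ?thesis using Q(2) mult by auto
  qed
qed

text \<open>
  The Schur-Zassenhaus theorem for an abelian normal subgroup. Multiplying the deviations \<open>w g C\<close> of translation by
  \<open>g\<close> from a fixed choice of coset representatives gives a crossed homomorphism \<open>W\<close> from \<open>G\<close> to \<open>Q\<close>. On \<open>Q\<close> it is the power
  map for the index of \<open>Q\<close>, a bijection, and so the elements with \<open>W g = \<one>\<close> form a complement.
\<close>

lemma (in group) normal_abelian_coprime_complement:
  assumes fin: "finite (carrier G)" and Q: "Q \<lhd> G"
    and comm: "\<And>u v. u \<in> Q \<Longrightarrow> v \<in> Q \<Longrightarrow> u \<otimes> v = v \<otimes> u"
    and cop: "coprime (card Q) (card (rcosets Q))"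
  shows "\<exists>H. subgroup H G \<and> card H * card Q = order G"
proof -
  interpret Q: normal Q G by fact
  interpret abelian_subgroup_cosets G Q
    using Q.subgroup_axioms fin comm by (intro abelian_subgroup_cosets.intro abelian_subgroup_cosets_axioms.intro is_group) auto
  let ?R = "rcosets Q"
  define w where "w g C = inv (rep (C #> g)) \<otimes> rep C \<otimes> g" for g C
  define W where "W g = finprod A (w g) ?R" for g
  have w_closed: "w g C \<in> Q" if C: "C \<in> ?R" and g: "g \<in> carrier G" for g C
  proof -
    have "rep C \<otimes> g \<in> C #> g" using rep_mem[OF C] by (auto simp: r_coset_def)
    then have "rep C \<otimes> g \<otimes> inv (rep (C #> g)) \<in> Q"
      using diff_neutralizes[OF Q.subgroup_axioms coset_translate[OF C g]] rep_mem[OF coset_translate[OF C g]] by blast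
    from Q.inv_op_closed1[OF rep_closed[OF coset_translate[OF C g]] this]
    show ?thesis using C g rep_closed coset_translate by (simp add: w_def m_assoc)
  qed
  have W_closed: "W g \<in> Q" if "g \<in> carrier G" for g
    using A.finprod_closed[of "w g" ?R] w_closed that by (auto simp: W_def)
  have conj_prod: "finprod A (\<lambda>C. inv h \<otimes> f C \<otimes> h) S = inv h \<otimes> finprod A f S \<otimes> h"
    if h: "h \<in> carrier G" and S: "finite S" "f \<in> S \<rightarrow> Q" for h f S
    using S
  proof (induction S rule: finite_induct)
    case (insert C S)
    have fS: "finprod A f S \<in> Q" using A.finprod_closed[of f S] insert by auto
    have "finprod A (\<lambda>C. inv h \<otimes> f C \<otimes> h) (insert C S) = (inv h \<otimes> f C \<otimes> h) \<otimes>\<^bsub>A\<^esub> finprod A (\<lambda>C. inv h \<otimes> f C \<otimes> h) S"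
      using insert h Q.inv_op_closed1 by (intro A.finprod_insert) auto
    also have "\<dots> = inv h \<otimes> (f C \<otimes>\<^bsub>A\<^esub> finprod A f S) \<otimes> h"
      using insert h fS by (simp add: m_assoc inv_mult_cancel)
    finally show ?case using insert by simp
  qed (use h in simp)
  have W_mult: "W (g \<otimes> h) = W h \<otimes> (inv h \<otimes> W g \<otimes> h)" if g: "g \<in> carrier G" and h: "h \<in> carrier G" for g h
  proof -
    have wgh: "w (g \<otimes> h) C = w h (C #> g) \<otimes> (inv h \<otimes> w g C \<otimes> h)" if C: "C \<in> ?R" for C
      using C g h rep_closed coset_translate by (simp add: w_def coset_translate_mult m_assoc inv_mult_cancel)
    have "W (g \<otimes> h) = finprod A (\<lambda>C. w h (C #> g) \<otimes>\<^bsub>A\<^esub> (inv h \<otimes> w g C \<otimes> h)) ?R"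
      unfolding W_def using g h wgh by (intro A.finprod_cong') (auto simp: w_closed coset_translate Q.inv_op_closed1)
    also have "\<dots> = finprod A (\<lambda>C. w h (C #> g)) ?R \<otimes>\<^bsub>A\<^esub> finprod A (\<lambda>C. inv h \<otimes> w g C \<otimes> h) ?R"
      using g h by (intro A.finprod_multf) (auto simp: w_closed coset_translate Q.inv_op_closed1)
    also have "finprod A (\<lambda>C. w h (C #> g)) ?R = finprod A (w h) ((\<lambda>C. C #> g) ` ?R)"
      using coset_translate_bij[OF g] h by (intro A.finprod_reindex[symmetric]) (auto simp: bij_betw_def w_closed coset_translate g)
    also have "(\<lambda>C. C #> g) ` ?R = ?R" using coset_translate_bij[OF g] by (simp add: bij_betw_def)
    also have "finprod A (\<lambda>C. inv h \<otimes> w g C \<otimes> h) ?R = inv h \<otimes> W g \<otimes> h"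
      unfolding W_def using g h finite_rcosets w_closed by (intro conj_prod) auto
    finally show ?thesis by (simp add: W_def)
  qed
  have W_Q: "W u = u [^] card ?R" if u: "u \<in> Q" for u
  proof -
    have "w u C = u" if C: "C \<in> ?R" for C
    proof -
      obtain x where x: "x \<in> carrier G" "C = Q #> x" using C by (auto simp: RCOSETS_def)
      have "x \<otimes> u = (x \<otimes> u \<otimes> inv x) \<otimes> x" using x u by (simp add: m_assoc)
      then have "x \<otimes> u \<in> Q #> x" using Q.inv_op_closed2[OF x(1) u] by (auto simp: r_coset_def)
      then have "Q #> (x \<otimes> u) = Q #> x" using repr_independence x Q.subgroup_axioms by metis
      then have "C #> u = C" using x u by (simp add: coset_mult_assoc Q.subset)
      then show ?thesis using rep_closed[OF C] u by (simp add: w_def)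
    qed
    then have "W u = finprod A (\<lambda>_. u) ?R" unfolding W_def using u by (intro A.finprod_cong') auto
    also have "\<dots> = u [^]\<^bsub>A\<^esub> card ?R" using u by (simp add: A.finprod_const)
    finally show ?thesis by (simp flip: nat_pow_consistent)
  qed
  define H where "H = {g \<in> carrier G. W g = \<one>}"
  have W_one: "W \<one> = \<one>" using W_Q[of \<one>] by simp
  have H: "subgroup H G"
  proof (rule subgroupI)
    show "H \<noteq> {}" using W_one by (auto simp: H_def)
    show "a \<otimes> b \<in> H" if "a \<in> H" "b \<in> H" for a b using that by (simp add: H_def W_mult)
    show "inv a \<in> H" if "a \<in> H" for a
    proof -
      have a: "a \<in> carrier G" "W a = \<one>" using that by (auto simp: H_def)
      have "W (a \<otimes> inv a) = W (inv a) \<otimes> (inv (inv a) \<otimes> W a \<otimes> inv a)" using a by (intro W_mult) auto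
      then have "W (inv a) = \<one>" using a W_one W_closed[of "inv a"] by simp
      then show ?thesis using a by (simp add: H_def)
    qed
  qed (auto simp: H_def)
  have HQ: "g \<in> Q \<Longrightarrow> g \<in> H \<Longrightarrow> g = \<one>" for g
  proof -
    assume g: "g \<in> Q" "g \<in> H"
    have gG: "g \<in> carrier G" using g(1) by simp
    have "g [^] card ?R = \<one>" using W_Q[OF g(1)] g(2) by (simp add: H_def)
    then have "ord g dvd card ?R" using pow_eq_id[OF gG] by simp
    moreover from g(1) have "g [^] card Q = \<one>"
      using normal_coprime_index_eq_torsion[OF fin Q cop] by blast
    then have "ord g dvd card Q" using pow_eq_id[OF gG] by simp
    ultimately have "ord g = 1" using cop coprime_common_divisor_nat by blast
    then show "g = \<one>" using ord_eq_1 g by simp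
  qed
  have R0: "card ?R \<noteq> 0" using lagrange[OF Q.subgroup_axioms] fin by (metis gr0I mult_is_0 order_gt_0_iff_finite less_irrefl)
  have HQ_onto: "\<exists>h\<in>H. \<exists>u\<in>Q. g = h \<otimes> u" if g: "g \<in> carrier G" for g
  proof -
    obtain a b where ab: "card ?R * a = card Q * b + 1"
      using bezout_nat[OF R0, of "card Q"] cop by (metis coprime_commute coprime_imp_gcd_eq_1)
    \<comment> \<open>this \<open>u\<close> in \<open>Q\<close> has \<open>W u = (W g)\<^sup>-\<^sup>1\<close>\<close>
    let ?u = "inv (W g) [^] a"
    have Wi: "inv (W g) \<in> Q" using W_closed[OF g] by simp
    have u: "?u \<in> Q" using subgroup_nat_pow_closed[OF Q.subgroup_axioms Wi] .
    have tors: "inv (W g) [^] card Q = \<one>" using normal_coprime_index_eq_torsion[OF fin Q cop] Wi by blast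
    have "?u [^] card ?R = inv (W g) [^] (card Q * b + 1)"
      using Wi ab by (simp add: nat_pow_pow mult.commute del: nat_pow_Suc)
    also have "\<dots> = inv (W g)" using Wi tors by (simp flip: nat_pow_pow)
    finally have Wu: "W ?u = inv (W g)" using W_Q[OF u] by simp
    have "inv ?u \<otimes> W g \<otimes> ?u = W g" 
      using u W_closed[OF g] by (simp add: m_assoc comm[OF W_closed[OF g] u] inv_mult_cancel)
    then have "W (g \<otimes> ?u) = \<one>" using W_mult[of g ?u] g u Wu W_closed[OF g] by simp
    then have "g \<otimes> ?u \<in> H" using g u by (simp add: H_def)
    moreover have "g = (g \<otimes> ?u) \<otimes> inv ?u" using g u by (simp add: m_assoc)
    ultimately show ?thesis using u by blast
  qed
  interpret H: subgroup H G by fact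
  have "bij_betw (\<lambda>(h, u). h \<otimes> u) (H \<times> Q) (carrier G)"
    unfolding bij_betw_def
  proof
    show "inj_on (\<lambda>(h, u). h \<otimes> u) (H \<times> Q)"
      using inj_on_mult_of_trivial_Int[OF H Q.subgroup_axioms] HQ by blast
    show "(\<lambda>(h, u). h \<otimes> u) ` (H \<times> Q) = carrier G" using HQ_onto by (fastforce simp: image_iff)
  qed
  then have "card (H \<times> Q) = order G" unfolding order_def by (rule bij_betw_same_card)
  then show ?thesis using H by (auto simp: card_cartesian_product)
qed

section \<open>Endomorphisms of an elementary abelian group of order a prime squared\<close>

lemma endo_int_pow:
  "group G \<Longrightarrow> f \<in> hom G G \<Longrightarrow> x \<in> carrier G \<Longrightarrow> f (x [^]\<^bsub>G\<^esub> (n::int)) = f x [^]\<^bsub>G\<^esub> n"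
  by (rule hom_int_pow)

text \<open>
  A plane over the field with \<open>q\<close> elements, written multiplicatively: \<open>x [^] i\<close> is a scalar multiple,
  and \<open>comb v w i j\<close> below is a linear combination with integer coordinates, unique modulo \<open>q\<close> if \<open>v\<close> and \<open>w\<close> form
  a basis.
\<close>

locale elementary_abelian_square = comm_group G for G (structure) +
  fixes q :: nat
  assumes q: "prime q" and order_eq: "order G = q ^ 2"
    and exponent: "x \<in> carrier G \<Longrightarrow> x [^] q = \<one>"
begin

lemma pow_dvd_eq_one:
  assumes "x \<in> carrier G" "int q dvd i" shows "x [^] i = \<one>"
proof -
  obtain k where "i = int q * k" using assms by blast
  then have "x [^] i = (x [^] int q) [^] k" using assms(1) int_pow_pow by simp
  then show ?thesis using exponent[OF assms(1)] by (simp add: int_pow_int)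
qed

lemma pow_cong:
  assumes "x \<in> carrier G" "int q dvd i - j" shows "x [^] i = x [^] j"
proof -
  have "x [^] i = x [^] (i - j) \<otimes> x [^] j" using assms(1) by (simp flip: int_pow_mult)
  then show ?thesis using pow_dvd_eq_one[OF assms] assms(1) by simp
qed

lemma pow_eq_one_imp_dvd:
  assumes x: "x \<in> carrier G" "x \<noteq> \<one>" and "x [^] i = \<one>" shows "int q dvd i"
proof -
  have "ord x dvd q" "ord x \<noteq> 1" using x exponent[OF x(1)] pow_eq_id ord_eq_1 by auto
  then have "ord x = q" using q prime_nat_iff by blast
  then show ?thesis using assms int_pow_eq_id by auto
qed

definition comb :: "'a \<Rightarrow> 'a \<Rightarrow> int \<Rightarrow> int \<Rightarrow> 'a" where
  "comb v w i j = v [^] i \<otimes> w [^] j"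

definition basis :: "'a \<Rightarrow> 'a \<Rightarrow> bool" where
  "basis v w \<longleftrightarrow> v \<in> carrier G \<and> w \<in> carrier G \<and> (\<forall>i::int. w \<noteq> v [^] i) \<and> v \<noteq> \<one>"

lemma basis_closed: "basis v w \<Longrightarrow> v \<in> carrier G" "basis v w \<Longrightarrow> w \<in> carrier G"
  by (auto simp: basis_def)

lemma comb_closed: "basis v w \<Longrightarrow> comb v w i j \<in> carrier G"
  by (auto simp: basis_def comb_def)

lemma comb_mult: "basis v w \<Longrightarrow> comb v w i j \<otimes> comb v w k l = comb v w (i + k) (j + l)"
  unfolding basis_def comb_def by (auto simp: int_pow_mult m_ac)

lemma comb_pow: "basis v w \<Longrightarrow> comb v w i j [^] (k::int) = comb v w (i * k) (j * k)"
  unfolding basis_def comb_def by (auto simp: int_pow_distrib int_pow_pow)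

lemma comb_cong: "basis v w \<Longrightarrow> int q dvd i - k \<Longrightarrow> int q dvd j - l \<Longrightarrow> comb v w i j = comb v w k l"
  unfolding basis_def comb_def using pow_cong by metis

lemma comb_eq_one:
  assumes b: "basis v w" and 1: "comb v w i j = \<one>"
  shows "int q dvd i \<and> int q dvd j"
proof -
  have v: "v \<in> carrier G" "v \<noteq> \<one>" and w: "w \<in> carrier G" "\<And>k::int. w \<noteq> v [^] k"
    using b by (auto simp: basis_def)
  have j: "int q dvd j"
  proof (rule ccontr)
    assume "\<not> int q dvd j"
    moreover have "prime (int q)" using q by simp
    ultimately have "coprime j (int q)" using prime_imp_coprime coprime_commute by blast
    then obtain r where r: "[j * r = 1] (mod int q)" using cong_solve_coprime_int by blast
    have "w [^] j = inv (v [^] i)"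
      using 1 v w unfolding comb_def by (metis int_pow_closed inv_equality m_comm)
    then have "w [^] j = v [^] (- i)" using v by (simp add: int_pow_neg)
    then have "w [^] (j * r) = v [^] (- i * r)" using v w by (metis int_pow_pow)
    moreover have "w [^] (j * r) = w [^] (1::int)"
      using r w by (intro pow_cong) (auto simp: cong_iff_dvd_diff)
    ultimately show False using w by simp
  qed
  then have "v [^] i = \<one>" using 1 v w pow_dvd_eq_one unfolding comb_def by simp
  then show ?thesis using j pow_eq_one_imp_dvd v by blast
qed

lemma comb_eq_iff:
  assumes b: "basis v w"
  shows "comb v w i j = comb v w k l \<longleftrightarrow> int q dvd i - k \<and> int q dvd j - l"
proof
  assume eq: "comb v w i j = comb v w k l"
  have "comb v w (i - k) (j - l) = comb v w i j \<otimes> comb v w (- k) (- l)"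
    using b by (simp add: comb_mult)
  also have "\<dots> = comb v w 0 0" unfolding eq using b by (simp add: comb_mult)
  also have "\<dots> = \<one>" by (simp add: comb_def)
  finally show "int q dvd i - k \<and> int q dvd j - l" using comb_eq_one[OF b] by blast
qed (use comb_cong[OF b] in blast)

lemma basis_spans:
  assumes b: "basis v w" and x: "x \<in> carrier G"
  obtains i j where "x = comb v w i j"
proof -
  let ?I = "{0..<int q} \<times> {0..<int q}"
  let ?c = "\<lambda>(i, j). comb v w i j"
  have small: "i = k" if "int q dvd i - k" "0 \<le> i" "i < int q" "0 \<le> k" "k < int q" for i k
    using that by (metis mod_eq_dvd_iff mod_pos_pos_trivial)
  have inj: "inj_on ?c ?I"
    by (auto simp: inj_on_def comb_eq_iff[OF b] intro: small)
  have fin: "finite (carrier G)" using order_eq q by (metis order_gt_0_iff_finite prime_gt_0_nat zero_less_power)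
  have "?c ` ?I = carrier G"
    using inj fin order_eq comb_closed[OF b]
    by (intro card_subset_eq) (auto simp: card_image card_cartesian_product order_def power2_eq_square)
  then have "x \<in> ?c ` ?I" using x by simp
  then show ?thesis using that by auto
qed

lemma hom_comb:
  assumes b: "basis v w" and f: "f \<in> hom G G"
  shows "f (comb v w i j) = f v [^] i \<otimes> f w [^] j"
  using basis_closed[OF b] f unfolding comb_def
  by (simp add: hom_mult endo_int_pow[OF is_group f])

lemma hom_eq_on_basis:
  assumes b: "basis v w" and f: "f \<in> hom G G" and g: "g \<in> hom G G"
    and "f v = g v" "f w = g w" "x \<in> carrier G"
  shows "f x = g x"
  by (rule basis_spans[OF b assms(6)]) (simp add: hom_comb[OF b f] hom_comb[OF b g] assms)

lemma hom_pow_mult_hom: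
  assumes "f \<in> hom G G" "g \<in> hom G G"
  shows "(\<lambda>x. f x [^] (i::int) \<otimes> g x [^] (j::int)) \<in> hom G G"
  using assms by (intro homI) (auto simp: hom_in_carrier hom_mult int_pow_distrib m_ac)

lemma id_hom: "(\<lambda>x. x) \<in> hom G G" by (auto simp: hom_def)

definition scalar :: "('a \<Rightarrow> 'a) \<Rightarrow> bool" where
  "scalar f \<longleftrightarrow> (\<exists>i::int. \<forall>x\<in>carrier G. f x = x [^] i)"

text \<open>
  If every vector is an eigenvector of \<open>f\<close>, then comparing the images of basis vectors \<open>v\<close> and \<open>u\<close> and of their
  combination \<open>v \<otimes> u\<close> shows that all eigenvalues agree.
\<close>

lemma not_scalar_imp_basis:
  assumes f: "f \<in> hom G G" and ns: "\<not> scalar f"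
  obtains v where "basis v (f v)"
proof (rule ccontr)
  assume "\<not> thesis"
  then have nb: "\<not> basis v (f v)" for v using that by blast
  have mult: "\<exists>i::int. f v = v [^] i" if "v \<in> carrier G" for v
    using nb[of v] that hom_in_carrier[OF f that] hom_one[OF f is_group is_group]
    by (cases "v = \<one>") (auto simp: basis_def)
  have "carrier G \<noteq> {\<one>}"
    using order_eq q order_one_triv_iff prime_gt_1_nat[OF q] by (metis one_less_power less_irrefl zero_less_numeral)
  then obtain v where v: "v \<in> carrier G" "v \<noteq> \<one>" by blast
  have "\<exists>u\<in>carrier G. \<forall>i::int. u \<noteq> v [^] i"
  proof (rule ccontr)
    assume "\<not> ?thesis"
    then obtain i where i: "f v = v [^] (i::int)" and all: "\<And>u. u \<in> carrier G \<Longrightarrow> \<exists>j::int. u = v [^] j"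
      using mult[OF v(1)] by blast
    have "f x = x [^] i" if x: "x \<in> carrier G" for x
    proof -
      obtain j where j: "x = v [^] (j::int)" using all[OF x] by blast
      have "f x = f v [^] j" unfolding j by (rule endo_int_pow[OF is_group f v(1)])
      also have "\<dots> = x [^] i" unfolding j i using v by (simp add: int_pow_pow mult.commute)
      finally show ?thesis .
    qed
    then show False using ns unfolding scalar_def by blast
  qed
  then obtain u where b: "basis v u" using v by (auto simp: basis_def)
  obtain i j k where ijk: "f v = v [^] (i::int)" "f u = u [^] (j::int)" "f (v \<otimes> u) = (v \<otimes> u) [^] (k::int)"
    using mult basis_closed[OF b] by (metis m_closed)
  have "comb v u i j = f (v \<otimes> u)" using basis_closed[OF b] ijk(1,2) by (simp add: hom_mult[OF f] comb_def)
  also have "\<dots> = comb v u k k" using ijk(3) basis_closed[OF b] by (simp add: comb_def int_pow_distrib)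
  finally have "int q dvd i - k" "int q dvd j - k" using comb_eq_iff[OF b] by auto
  then have "f v = v [^] k" "f u = u [^] k" using ijk basis_closed[OF b] pow_cong by auto
  then have "f x = x [^] k" if "x \<in> carrier G" for x
    using hom_eq_on_basis[OF b f hom_pow_mult_hom[OF id_hom id_hom, of k 0] _ _ that] that basis_closed[OF b] by simp
  then show False using ns unfolding scalar_def by blast
qed

text \<open>
  Since \<open>v\<close> is a cyclic vector for \<open>g\<close>, every endomorphism commuting with \<open>g\<close> is a polynomial in \<open>g\<close>.
\<close>

lemma commuting_hom_eq_polynomial:
  assumes f: "f \<in> hom G G" and g: "g \<in> hom G G" and b: "basis v (g v)"
    and comm: "\<And>x. x \<in> carrier G \<Longrightarrow> f (g x) = g (f x)" and fv: "f v = comb v (g v) \<alpha> \<beta>"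
    and x: "x \<in> carrier G"
  shows "f x = x [^] \<alpha> \<otimes> g x [^] \<beta>"
proof (rule hom_eq_on_basis[OF b f hom_pow_mult_hom[OF id_hom g] _ _ x])
  show "f v = v [^] \<alpha> \<otimes> g v [^] \<beta>" using fv by (simp add: comb_def)
  have "f (g v) = g (comb v (g v) \<alpha> \<beta>)" using comm basis_closed[OF b] fv by simp
  then show "f (g v) = g v [^] \<alpha> \<otimes> g (g v) [^] \<beta>" by (simp add: hom_comb[OF b g])
qed

lemma commuting_with_nonscalar_commute:
  assumes f: "f \<in> hom G G" and h: "h \<in> hom G G" and g: "g \<in> hom G G" and b: "basis v (g v)"
    and fg: "\<And>x. x \<in> carrier G \<Longrightarrow> f (g x) = g (f x)" and hg: "\<And>x. x \<in> carrier G \<Longrightarrow> h (g x) = g (h x)"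
    and x: "x \<in> carrier G"
  shows "f (h x) = h (f x)"
proof -
  obtain \<alpha> \<beta> where "f v = comb v (g v) \<alpha> \<beta>"
    using basis_spans[OF b hom_in_carrier[OF f basis_closed(1)[OF b]]] .
  then have f_eq: "f y = y [^] \<alpha> \<otimes> g y [^] \<beta>" if "y \<in> carrier G" for y
    using commuting_hom_eq_polynomial[OF f g b fg] that by blast
  have "h (f x) = h x [^] \<alpha> \<otimes> h (g x) [^] \<beta>"
    using f_eq[OF x] x hom_in_carrier[OF g x] by (simp add: hom_mult[OF h] endo_int_pow[OF is_group h])
  also have "\<dots> = f (h x)" using f_eq[OF hom_in_carrier[OF h x]] hg[OF x] by simp
  finally show ?thesis by simp
qed

text \<open>
  In additive notation \<open>g\<^sup>2 = t g - d\<close>. If the discriminant vanished, then \<open>N = 2 g - t\<close> would satisfy \<open>N\<^sup>2 = 0\<close>, and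
  \<open>(2 g)\<^sup>k = t\<^sup>k + k t\<^sup>k\<^sup>-\<^sup>1 N\<close>. As \<open>g\<^sup>k = 1\<close> and \<open>N\<close> is not scalar, \<open>q\<close> divides \<open>2 k t\<^sup>k\<^sup>-\<^sup>1\<close>, so it divides \<open>t\<close> and then \<open>d\<close>, and \<open>g\<^sup>2 = 0\<close>, which is
  impossible for a map of finite order.
\<close>

lemma nonscalar_discriminant:
  assumes oddq: "odd q" and g: "g \<in> hom G G" and b: "basis v (g v)"
    and gw: "g (g v) = comb v (g v) (- d) t"
    and per: "\<And>x. x \<in> carrier G \<Longrightarrow> (g ^^ k) x = x" and k: "\<not> q dvd k"
  shows "\<not> int q dvd t\<^sup>2 - 4 * d"
proof
  assume disc: "int q dvd t\<^sup>2 - 4 * d"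
  define w where "w = g v"
  have b: "basis v w" and gw: "g w = comb v w (- d) t" using b gw by (auto simp: w_def)
  have v: "v \<in> carrier G" and w: "w \<in> carrier G" using basis_closed[OF b] .
  have g_comb: "g (comb v w i j) = comb v w (- d * j) (i + t * j)" for i j
  proof -
    have "w [^] i = comb v w 0 i" using v w by (simp add: comb_def)
    then show ?thesis
      using b unfolding hom_comb[OF b g] by (simp add: gw comb_pow comb_mult flip: w_def)
  qed
  have iter: "(g ^^ j) x \<in> carrier G" if "x \<in> carrier G" for j x
    using that hom_in_carrier[OF g] by (induction j) auto
  \<comment> \<open>the coordinates of \<open>(2 g)\<^sup>j\<^sup>+\<^sup>1 v = t\<^sup>j\<^sup>+\<^sup>1 v + (j + 1) t\<^sup>j N v\<close>\<close>
  have power: "(g ^^ Suc j) v [^] (2 ^ Suc j :: int) = comb v w (- int j * t ^ Suc j) (2 * (int j + 1) * t ^ j)" for j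
  proof (induction j)
    case 0
    show ?case using v w by (simp add: comb_def flip: w_def)
  next
    case (Suc j)
    have "(g ^^ Suc (Suc j)) v [^] (2 ^ Suc (Suc j) :: int) = (g ((g ^^ Suc j) v) [^] (2 ^ Suc j :: int)) [^] (2::int)"
      by (subst int_pow_pow) (use hom_in_carrier[OF g hom_in_carrier[OF g iter[OF v]]] in simp_all)
    also have "g ((g ^^ Suc j) v) [^] (2 ^ Suc j :: int) = g ((g ^^ Suc j) v [^] (2 ^ Suc j :: int))"
      by (rule endo_int_pow[OF is_group g iter[OF v], symmetric])
    also have "\<dots> [^] (2::int) = comb v w (- d * (2 * (int j + 1) * t ^ j) * 2)
        ((- int j * t ^ Suc j + t * (2 * (int j + 1) * t ^ j)) * 2)"
      unfolding Suc g_comb using b by (rule comb_pow)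
    also have "\<dots> = comb v w (- int (Suc j) * t ^ Suc (Suc j)) (2 * (int (Suc j) + 1) * t ^ Suc j)"
    proof (rule comb_cong[OF b])
      have "- d * (2 * (int j + 1) * t ^ j) * 2 - - int (Suc j) * t ^ Suc (Suc j) = (int j + 1) * t ^ j * (t\<^sup>2 - 4 * d)"
        by (simp add: algebra_simps power2_eq_square)
      then show "int q dvd - d * (2 * (int j + 1) * t ^ j) * 2 - - int (Suc j) * t ^ Suc (Suc j)"
        using disc by simp
    qed (simp add: algebra_simps)
    finally show ?case .
  qed
  have "k \<noteq> 0" using k by (metis dvd_0_right)
  then obtain j where j: "k = Suc j" by (cases k) auto
  have qp: "prime (int q)" using q by simp
  have q2: "\<not> int q dvd 2" using oddq q by (metis even_numeral primes_dvd_imp_eq of_nat_dvd_iff of_nat_numeral two_is_prime_nat)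
  have "comb v w (2 ^ k) 0 = comb v w (- int j * t ^ Suc j) (2 * (int j + 1) * t ^ j)"
    using power[of j] per[OF v] j v w by (simp add: comb_def)
  then have "int q dvd 0 - 2 * (int j + 1) * t ^ j" using comb_eq_iff[OF b] by blast
  moreover have "0 - 2 * (int j + 1) * t ^ j = - (2 * (int k * t ^ j))" using j by (simp add: algebra_simps)
  ultimately have "int q dvd 2 * (int k * t ^ j)" by (metis dvd_minus_iff)
  then have "int q dvd t ^ j" using qp q2 k by (auto simp: prime_dvd_mult_iff)
  then have qt: "int q dvd t" using qp prime_dvd_power by blast
  then have "int q dvd t\<^sup>2 - (t\<^sup>2 - 4 * d)" using disc by (metis dvd_diff dvd_power_same power2_eq_square dvd_mult)
  then have "int q dvd 2 * (2 * d)" by simp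
  then have qd: "int q dvd d" using qp q2 prime_dvd_multD by blast
  have "g w = comb v w 0 0" unfolding gw using qt qd by (intro comb_cong[OF b]) auto
  then have g1: "g w = \<one>" by (simp add: comb_def)
  have "(g ^^ i) \<one> = \<one>" for i using hom_one[OF g is_group is_group] by (induction i) auto
  then have "w = \<one>" using per[OF w] g1 j by (simp add: funpow_swap1)
  then have "comb v w 0 1 = \<one>" by (simp add: comb_def)
  then have "int q dvd 1" using comb_eq_one[OF b] by blast
  then show False using qp not_prime_unit by blast
qed

text \<open>
  The conjugate \<open>g' = y g y\<^sup>-\<^sup>1\<close> is of the form \<open>\<alpha> + \<beta> g\<close> and satisfies the same quadratic equation as \<open>g\<close>. Comparing
  coefficients gives \<open>(1 - \<beta>\<^sup>2) (t\<^sup>2 - 4 d) = 0\<close>, where the discriminant is nonzero. So \<open>\<beta> = 1\<close> or \<open>\<beta> = -1\<close>, that is,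
  conjugation by \<open>y\<close> fixes \<open>g\<close> or exchanges it with \<open>t - g\<close>; doing it twice fixes \<open>g\<close>.
\<close>

lemma conjugate_commuting_imp_square_commuting:
  assumes oddq: "odd q" and g: "g \<in> hom G G" and g': "g' \<in> hom G G" and y: "y \<in> hom G G"
    and ybij: "bij_betw y (carrier G) (carrier G)" and b: "basis v (g v)"
    and conj: "\<And>x. x \<in> carrier G \<Longrightarrow> g' (y x) = y (g x)"
    and comm: "\<And>x. x \<in> carrier G \<Longrightarrow> g' (g x) = g (g' x)"
    and per: "\<And>x. x \<in> carrier G \<Longrightarrow> (g ^^ k) x = x" and k: "\<not> q dvd k"
    and x: "x \<in> carrier G"
  shows "y (y (g x)) = g (y (y x))"
proof -
  define w where "w = g v"
  have b': "basis v w" using b by (simp add: w_def)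
  have v: "v \<in> carrier G" and w: "w \<in> carrier G" using basis_closed[OF b'] .
  note [simp] = hom_in_carrier[OF g] hom_in_carrier[OF g'] hom_in_carrier[OF y]
  have qp: "prime (int q)" using q by simp
  obtain d t where gw: "g (g v) = comb v (g v) (- d) t"
    using basis_spans[OF b hom_in_carrier[OF g w]] unfolding w_def by (metis add.inverse_inverse)
  obtain \<alpha> \<beta> where g'v: "g' v = comb v (g v) \<alpha> \<beta>"
    using basis_spans[OF b hom_in_carrier[OF g' v]] .
  have g'_eq: "g' z = z [^] \<alpha> \<otimes> g z [^] \<beta>" if "z \<in> carrier G" for z
    using commuting_hom_eq_polynomial[OF g' g b comm g'v] that by blast
  have gg: "g (g z) = z [^] (- d) \<otimes> g z [^] t" if "z \<in> carrier G" for z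
    using commuting_hom_eq_polynomial[of "\<lambda>z. g (g z)" g v "- d" t z] g b gw that
    by (simp add: hom_def Pi_iff)
  have g_comb: "g (comb v w i j) = comb v w (- d * j) (i + t * j)" for i j
  proof -
    have "w [^] i = comb v w 0 i" using v w by (simp add: comb_def)
    then show ?thesis
      using b' gw unfolding hom_comb[OF b' g] by (simp add: comb_pow comb_mult flip: w_def)
  qed
  have g'_comb: "g' (comb v w i j) = comb v w (i * \<alpha> - d * j * \<beta>) (j * \<alpha> + (i + t * j) * \<beta>)" for i j
    using b' by (simp add: g'_eq comb_closed g_comb comb_pow comb_mult)
  \<comment> \<open>\<open>g'\<close> satisfies the same quadratic relation as its conjugate \<open>g\<close>\<close>
  have "g' (g' v) = g' v [^] t \<otimes> v [^] (- d)"
  proof -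
    have "v \<in> y ` carrier G" using ybij v by (simp add: bij_betw_def)
    then obtain z where z: "z \<in> carrier G" "y z = v" by blast
    have "g' (g' v) = y (g (g z))" using conj z by (metis hom_in_carrier[OF g])
    also have "\<dots> = y z [^] (- d) \<otimes> y (g z) [^] t"
      using z(1) by (simp add: gg hom_mult[OF y] endo_int_pow[OF is_group y])
    also have "y (g z) = g' v" using conj z by metis
    finally show ?thesis using z v by (simp add: m_comm)
  qed
  moreover have "v [^] (- d) = comb v w (- d) 0" using v w by (simp add: comb_def)
  ultimately have "comb v w (\<alpha> * \<alpha> - d * \<beta> * \<beta>) (\<beta> * \<alpha> + (\<alpha> + t * \<beta>) * \<beta>) = comb v w (\<alpha> * t - d) (\<beta> * t)"
    using g'v b' by (simp add: g'_comb comb_pow comb_mult flip: w_def)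
  then have 1: "int q dvd (\<alpha> * \<alpha> - d * \<beta> * \<beta>) - (\<alpha> * t - d)"
    and 2: "int q dvd (\<beta> * \<alpha> + (\<alpha> + t * \<beta>) * \<beta>) - \<beta> * t"
    using comb_eq_iff[OF b'] by blast+
  have \<beta>: "\<not> int q dvd \<beta>"
  proof
    assume \<beta>: "int q dvd \<beta>"
    have "g' z = z [^] \<alpha>" if "z \<in> carrier G" for z using g'_eq[OF that] pow_dvd_eq_one[OF _ \<beta>] that by simp
    then have "y (g v) = y (v [^] \<alpha>)"
      using conj[OF v] v by (metis hom_in_carrier[OF y] endo_int_pow[OF is_group y])
    then have "g v = v [^] \<alpha>" using ybij v by (auto simp: bij_betw_def inj_on_def)
    then show False using b unfolding basis_def by blast
  qed
  have "(\<beta> * \<alpha> + (\<alpha> + t * \<beta>) * \<beta>) - \<beta> * t = \<beta> * (2 * \<alpha> - t * (1 - \<beta>))" by (simp add: algebra_simps)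
  then have 3: "int q dvd 2 * \<alpha> - t * (1 - \<beta>)" using 2 \<beta> qp by (metis prime_dvd_multD)
  \<comment> \<open>eliminate \<open>\<alpha>\<close> from the two congruences\<close>
  have "(1 - \<beta>\<^sup>2) * (t\<^sup>2 - 4 * d)
      = (2 * \<alpha> - t * (1 - \<beta>)) * (2 * \<alpha> + t * (1 - \<beta>) - 2 * t) - 4 * ((\<alpha> * \<alpha> - d * \<beta> * \<beta>) - (\<alpha> * t - d))"
    by (simp add: algebra_simps power2_eq_square)
  then have "int q dvd (1 - \<beta>\<^sup>2) * (t\<^sup>2 - 4 * d)" using 1 3 by (metis dvd_diff dvd_mult dvd_mult2)
  moreover have "\<not> int q dvd t\<^sup>2 - 4 * d" by (rule nonscalar_discriminant[OF oddq g b gw per k])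
  ultimately have \<beta>2: "int q dvd 1 - \<beta>\<^sup>2" using qp prime_dvd_multD by blast
  have q2: "\<not> int q dvd 2" using oddq q by (metis even_numeral primes_dvd_imp_eq of_nat_dvd_iff of_nat_numeral two_is_prime_nat)
  have "2 * (\<alpha> * (1 + \<beta>)) = (2 * \<alpha> - t * (1 - \<beta>)) * (1 + \<beta>) + t * (1 - \<beta>\<^sup>2)"
    by (simp add: algebra_simps power2_eq_square)
  then have "int q dvd 2 * (\<alpha> * (1 + \<beta>))" using 3 \<beta>2 by simp
  then have \<alpha>: "int q dvd \<alpha> * (1 + \<beta>)" using q2 qp prime_dvd_multD by blast
  define z where "z = y (y x)"
  have z: "z \<in> carrier G" using x by (simp add: z_def)
  have "y (y (g x)) = y (g' (y x))" using conj[OF x] by simp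
  also have "\<dots> = z [^] \<alpha> \<otimes> y (g (y x)) [^] \<beta>"
    using x g'_eq[of "y x"] by (simp add: hom_mult[OF y] endo_int_pow[OF is_group y] z_def)
  also have "y (g (y x)) = g' z" using conj[of "y x"] x by (simp add: z_def)
  also have "z [^] \<alpha> \<otimes> g' z [^] \<beta> = z [^] (\<alpha> * (1 + \<beta>)) \<otimes> g z [^] (\<beta> * \<beta>)"
    using z g'_eq[OF z] by (simp add: int_pow_distrib int_pow_pow distrib_left int_pow_mult m_assoc)
  also have "\<dots> = g z [^] (1::int)"
  proof -
    have "int q dvd \<beta> * \<beta> - 1" using \<beta>2 by (metis dvd_minus_iff minus_diff_eq power2_eq_square)
    then have "g z [^] (\<beta> * \<beta>) = g z [^] (1::int)" using z by (intro pow_cong) auto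
    then show ?thesis using pow_dvd_eq_one[OF z \<alpha>] z by simp
  qed
  finally show ?thesis using z by (simp add: z_def)
qed

end

section \<open>Homomorphisms with abelian image\<close>

lemma AutoGroup_mult_apply:
  assumes "f \<in> auto Q" "g \<in> auto Q" "x \<in> carrier Q"
  shows "(f \<otimes>\<^bsub>AutoGroup Q\<^esub> g) x = f (g x)"
  using assms by (simp add: AutoGroup_def BijGroup_def auto_def compose_def)

lemma AutoGroup_mult_closed:
  assumes "group Q" "f \<in> auto Q" "g \<in> auto Q"
  shows "f \<otimes>\<^bsub>AutoGroup Q\<^esub> g \<in> auto Q"
  using monoid.m_closed[OF group.is_monoid[OF group.AutoGroup[OF assms(1)]], of f g] assms(2,3)
  by (simp add: AutoGroup_def)

lemma auto_eqI:
  assumes "f \<in> auto Q" "g \<in> auto Q" "\<And>x. x \<in> carrier Q \<Longrightarrow> f x = g x"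
  shows "f = g"
  using assms by (auto simp: auto_def Bij_def intro: extensionalityI)

lemma AutoGroup_commute_iff:
  assumes "group Q" "f \<in> auto Q" "g \<in> auto Q"
  shows "f \<otimes>\<^bsub>AutoGroup Q\<^esub> g = g \<otimes>\<^bsub>AutoGroup Q\<^esub> f \<longleftrightarrow> (\<forall>x\<in>carrier Q. f (g x) = g (f x))"
  using AutoGroup_mult_apply[of f Q g] AutoGroup_mult_apply[of g Q f]
    auto_eqI[OF AutoGroup_mult_closed[OF assms] AutoGroup_mult_closed[OF assms(1,3,2)]] assms
  by metis

lemma carrier_AutoGroup [simp]: "carrier (AutoGroup Q) = auto Q"
  by (simp add: AutoGroup_def)

lemma auto_hom: "f \<in> auto Q \<Longrightarrow> f \<in> hom Q Q"
  by (simp add: auto_def)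

lemma auto_bij: "f \<in> auto Q \<Longrightarrow> bij_betw f (carrier Q) (carrier Q)"
  by (simp add: auto_def Bij_def)

lemma hom_AutoGroup_apply:
  assumes "\<phi> \<in> hom H (AutoGroup Q)" "h \<in> carrier H" "k \<in> carrier H" "x \<in> carrier Q"
  shows "\<phi> (h \<otimes>\<^bsub>H\<^esub> k) x = \<phi> h (\<phi> k x)"
  using assms hom_in_carrier[OF assms(1)] by (simp add: hom_mult[OF assms(1)] AutoGroup_mult_apply)

lemma (in group) commute_mult:
  assumes "z \<in> carrier G" "a \<in> carrier G" "b \<in> carrier G" "z \<otimes> a = a \<otimes> z" "z \<otimes> b = b \<otimes> z"
  shows "z \<otimes> (a \<otimes> b) = (a \<otimes> b) \<otimes> z"
  using assms by (metis m_assoc)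

text \<open>
  Let \<open>K\<close> be the normal complement of the Sylow subgroup \<open>P\<close> at the top of the tower. If \<open>K\<close> acts by scalars, then its
  image is central, and \<open>P\<close> is abelian. Otherwise some \<open>x\<close> in \<open>K\<close> acts by a nonscalar map \<open>g\<close>. The conjugates of \<open>g\<close> come from
  \<open>K\<close>, whose image is abelian by induction, so they commute with \<open>g\<close>. Hence the squares of all elements of \<open>H\<close> act by maps
  commuting with \<open>g\<close>, and so does \<open>H\<close> because its order is odd. The centralizer of \<open>g\<close> is commutative.
\<close>

lemma odd_cube_free_image_abelian:
  fixes H :: "('h, 'm) monoid_scheme"
  assumes "group H" "odd (order H)" "cube_free (order H)"
    and Q: "elementary_abelian_square Q q" and oddq: "odd q"
    and "\<not> q dvd order H" "\<phi> \<in> hom H (AutoGroup Q)"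
  shows "\<forall>x\<in>carrier H. \<forall>y\<in>carrier H. \<phi> x \<otimes>\<^bsub>AutoGroup Q\<^esub> \<phi> y = \<phi> y \<otimes>\<^bsub>AutoGroup Q\<^esub> \<phi> x"
  using assms(1-3,6,7)
proof (induction rule: odd_cube_free_group_induct)
  case (trivial H)
  then show ?case using group.order_one_triv_iff by fastforce
next
  case (extension H p e K P)
  note \<phi> = extension.prems(2)
  interpret Q: elementary_abelian_square Q q by fact
  interpret H: group H by fact
  interpret K: normal K H by fact
  interpret P: subgroup P H by fact
  interpret L: group "AutoGroup Q" by (rule Q.AutoGroup)
  let ?L = "AutoGroup Q"
  have \<phi>_auto: "\<phi> h \<in> auto Q" if "h \<in> carrier H" for h using hom_in_carrier[OF \<phi> that] by simp
  have \<phi>_hom: "\<phi> h \<in> hom Q Q" if "h \<in> carrier H" for h using \<phi>_auto[OF that] auto_hom by blast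
  have \<phi>_mult: "\<phi> (h \<otimes>\<^bsub>H\<^esub> k) = \<phi> h \<otimes>\<^bsub>?L\<^esub> \<phi> k" if "h \<in> carrier H" "k \<in> carrier H" for h k
    using hom_mult[OF \<phi> that] .
  have \<phi>_apply: "\<phi> (h \<otimes>\<^bsub>H\<^esub> k) x = \<phi> h (\<phi> k x)" if "h \<in> carrier H" "k \<in> carrier H" "x \<in> carrier Q" for h k x
    using hom_AutoGroup_apply[OF \<phi> that] .
  have fin: "finite (carrier H)" using cube_free_pos[OF extension.hyps(3)] H.order_gt_0_iff_finite by simp
  have Kdvd: "card K dvd order H" using extension.hyps(11) by (metis dvd_triv_left)
  have Kab: "\<phi> x \<otimes>\<^bsub>?L\<^esub> \<phi> y = \<phi> y \<otimes>\<^bsub>?L\<^esub> \<phi> x" if "x \<in> K" "y \<in> K" for x y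
  proof -
    have "\<not> q dvd order (H\<lparr>carrier := K\<rparr>)" using extension.prems(1) Kdvd dvd_trans by (auto simp: order_def)
    moreover have "\<phi> \<in> hom (H\<lparr>carrier := K\<rparr>) ?L" using \<phi> K.subset by (auto simp: hom_def)
    ultimately show ?thesis using extension.IH that by simp
  qed
  show ?case
  proof (cases "\<forall>x\<in>K. Q.scalar (\<phi> x)")
    case True
    have Kcentral: "\<phi> x \<otimes>\<^bsub>?L\<^esub> \<phi> y = \<phi> y \<otimes>\<^bsub>?L\<^esub> \<phi> x" if x: "x \<in> K" and y: "y \<in> carrier H" for x y
    proof -
      obtain i where i: "\<And>u. u \<in> carrier Q \<Longrightarrow> \<phi> x u = u [^]\<^bsub>Q\<^esub> (i::int)" using True x by (auto simp: Q.scalar_def)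
      show ?thesis
        using x y i hom_in_carrier[OF \<phi>_hom[OF y]] endo_int_pow[OF Q.is_group \<phi>_hom[OF y]]
        by (subst AutoGroup_commute_iff[OF Q.is_group]) (auto intro: \<phi>_auto)
    qed
    interpret PG: comm_group "H\<lparr>carrier := P\<rparr>"
      using group.order_prime_power_le_2_abelian[OF H.subgroup_imp_group[OF P.subgroup_axioms] extension.hyps(4) _ extension.hyps(7)]
        extension.hyps(10) by (simp add: order_def)
    have Pab: "\<phi> x \<otimes>\<^bsub>?L\<^esub> \<phi> y = \<phi> y \<otimes>\<^bsub>?L\<^esub> \<phi> x" if "x \<in> P" "y \<in> P" for x y
      using PG.m_comm[of x y] that by (simp flip: \<phi>_mult)
    have factor: "\<exists>k\<in>K. \<exists>x\<in>P. h = k \<otimes>\<^bsub>H\<^esub> x" if "h \<in> carrier H" for h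
      using H.coprime_subgroups_factorize[OF fin K.subgroup_axioms P.subgroup_axioms extension.hyps(12,11)] that
      by (fastforce simp: bij_betw_def image_iff)
    show ?thesis
    proof (intro ballI)
      fix x y assume x: "x \<in> carrier H" and y: "y \<in> carrier H"
      obtain k a where ka: "k \<in> K" "a \<in> P" "x = k \<otimes>\<^bsub>H\<^esub> a" using factor[OF x] by blast
      obtain l b where lb: "l \<in> K" "b \<in> P" "y = l \<otimes>\<^bsub>H\<^esub> b" using factor[OF y] by blast
      have mem: "\<phi> h \<in> carrier ?L" if "h \<in> carrier H" for h using \<phi>_auto that by simp
      have "\<phi> a \<otimes>\<^bsub>?L\<^esub> \<phi> y = \<phi> y \<otimes>\<^bsub>?L\<^esub> \<phi> a"
        using ka lb mem Kcentral[OF lb(1), of a] Pab[OF ka(2) lb(2)] L.commute_mult[of "\<phi> a" "\<phi> l" "\<phi> b"]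
        by (simp add: \<phi>_mult)
      moreover have "\<phi> k \<otimes>\<^bsub>?L\<^esub> \<phi> y = \<phi> y \<otimes>\<^bsub>?L\<^esub> \<phi> k" using Kcentral[OF ka(1) y] .
      ultimately show "\<phi> x \<otimes>\<^bsub>?L\<^esub> \<phi> y = \<phi> y \<otimes>\<^bsub>?L\<^esub> \<phi> x"
        using ka y mem L.commute_mult[of "\<phi> y" "\<phi> k" "\<phi> a"] by (simp add: \<phi>_mult)
    qed
  next
    case False
    then obtain x where x: "x \<in> K" "\<not> Q.scalar (\<phi> x)" by blast
    have xH: "x \<in> carrier H" using x by simp
    obtain v where b: "Q.basis v (\<phi> x v)" using Q.not_scalar_imp_basis[OF \<phi>_hom[OF xH] x(2)] .
    have one: "\<phi> \<one>\<^bsub>H\<^esub> u = u" if "u \<in> carrier Q" for u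
      using hom_one[OF \<phi> H.is_group L.is_group] that by (simp add: AutoGroup_def BijGroup_def)
    have iter: "(\<phi> h ^^ n) u = \<phi> (h [^]\<^bsub>H\<^esub> n) u" if h: "h \<in> carrier H" and u: "u \<in> carrier Q" for h u n
    proof (induction n)
      case (Suc n)
      have "\<phi> (h [^]\<^bsub>H\<^esub> Suc n) u = \<phi> (h \<otimes>\<^bsub>H\<^esub> h [^]\<^bsub>H\<^esub> n) u" using h by (simp add: H.nat_pow_Suc2 del: H.nat_pow_Suc nat_pow_Suc)
      then show ?case using Suc \<phi>_apply[OF h _ u] h by simp
    qed (use one u in simp)
    have centralizes: "\<phi> x (\<phi> y u) = \<phi> y (\<phi> x u)" if y: "y \<in> carrier H" and u: "u \<in> carrier Q" for y u
    proof -
      let ?x' = "y \<otimes>\<^bsub>H\<^esub> x \<otimes>\<^bsub>H\<^esub> inv\<^bsub>H\<^esub> y"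
      have x': "?x' \<in> K" "?x' \<in> carrier H" using K.inv_op_closed2[OF y x(1)] by auto
      have sq: "\<phi> y (\<phi> y (\<phi> x u)) = \<phi> x (\<phi> y (\<phi> y u))" if u: "u \<in> carrier Q" for u
      proof (rule Q.conjugate_commuting_imp_square_commuting[OF oddq \<phi>_hom[OF xH] \<phi>_hom[OF x'(2)] \<phi>_hom[OF y] _ b _ _ _ extension.prems(1) u])
        show "bij_betw (\<phi> y) (carrier Q) (carrier Q)" using \<phi>_auto[OF y] auto_bij by blast
        fix u assume u: "u \<in> carrier Q"
        have "?x' \<otimes>\<^bsub>H\<^esub> y = y \<otimes>\<^bsub>H\<^esub> x" using y xH by (simp add: H.m_assoc)
        then show "\<phi> ?x' (\<phi> y u) = \<phi> y (\<phi> x u)" using \<phi>_apply x'(2) y xH u by metis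
        show "\<phi> ?x' (\<phi> x u) = \<phi> x (\<phi> ?x' u)"
          using Kab[OF x'(1) x(1)] AutoGroup_commute_iff[OF Q.is_group \<phi>_auto[OF x'(2)] \<phi>_auto[OF xH]] u by blast
        show "(\<phi> x ^^ order H) u = u" using iter[OF xH u] H.pow_order_eq_1[OF xH] one[OF u] by simp
      qed
      \<comment> \<open>an element of odd order is a power of its square\<close>
      obtain m where m: "order H + 1 = 2 * m" using extension.hyps(2) by (metis even_Suc_div_two odd_two_times_div_two_succ Suc_eq_plus1 dvd_mult_div_cancel even_Suc)
      let ?z = "y \<otimes>\<^bsub>H\<^esub> y"
      have z: "?z \<in> carrier H" using y by simp
      have "?z [^]\<^bsub>H\<^esub> m = (y [^]\<^bsub>H\<^esub> (2::nat)) [^]\<^bsub>H\<^esub> m" using y by (simp add: numeral_2_eq_2)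
      also have "\<dots> = y [^]\<^bsub>H\<^esub> (order H + 1)" using y m by (simp add: H.nat_pow_pow)
      also have "\<dots> = y" using y H.pow_order_eq_1 by (simp flip: H.nat_pow_mult)
      finally have zy: "?z [^]\<^bsub>H\<^esub> m = y" .
      have "\<phi> x (\<phi> (?z [^]\<^bsub>H\<^esub> n) u) = \<phi> (?z [^]\<^bsub>H\<^esub> n) (\<phi> x u)" for n :: nat
      proof (induction n)
        case 0 show ?case using one u hom_in_carrier[OF \<phi>_hom[OF xH]] by simp
      next
        case (Suc n)
        let ?w = "\<phi> (?z [^]\<^bsub>H\<^esub> n) u"
        have w: "?w \<in> carrier Q" using hom_in_carrier[OF \<phi>_hom u] z by simp
        have expand: "\<phi> (?z [^]\<^bsub>H\<^esub> Suc n) u' = \<phi> y (\<phi> y (\<phi> (?z [^]\<^bsub>H\<^esub> n) u'))" if "u' \<in> carrier Q" for u'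
        proof -
          have "?z [^]\<^bsub>H\<^esub> Suc n = y \<otimes>\<^bsub>H\<^esub> (y \<otimes>\<^bsub>H\<^esub> ?z [^]\<^bsub>H\<^esub> n)"
            using y H.nat_pow_Suc2[OF z, of n] by (simp add: H.m_assoc)
          then show ?thesis using \<phi>_apply[OF y _ that] y z that by (metis H.m_closed H.nat_pow_closed)
        qed
        show ?case using expand[OF u] expand[OF hom_in_carrier[OF \<phi>_hom[OF xH] u]] sq[OF w] Suc by simp
      qed
      from this[of m] show ?thesis unfolding zy .
    qed
    show ?thesis
    proof (intro ballI)
      fix y z assume y: "y \<in> carrier H" and z: "z \<in> carrier H"
      show "\<phi> y \<otimes>\<^bsub>?L\<^esub> \<phi> z = \<phi> z \<otimes>\<^bsub>?L\<^esub> \<phi> y"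
        unfolding AutoGroup_commute_iff[OF Q.is_group \<phi>_auto[OF y] \<phi>_auto[OF z]]
        using Q.commuting_with_nonscalar_commute[OF \<phi>_hom[OF y] \<phi>_hom[OF z] \<phi>_hom[OF xH] b] centralizes y z by metis
    qed
  qed
qed

text \<open>
  For \<open>e > 0\<close> take any \<open>a \<noteq> \<one>\<close> and, if possible, an element \<open>b\<close> outside the subgroup generated by \<open>a\<close>.
\<close>

lemma (in group) prime_power_le_2_generators:
  assumes p: "prime p" and ord: "order G = p ^ e" and e: "e \<le> \<mu>" "\<mu> \<le> 2"
  shows "\<exists>x :: nat \<Rightarrow> 'a. (\<forall>i<\<mu>. x i \<in> carrier G) \<and> (\<forall>S. subgroup S G \<longrightarrow> (\<forall>i<\<mu>. x i \<in> S) \<longrightarrow> S = carrier G)"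
proof -
  have fin: "finite (carrier G)" using ord p by (metis order_gt_0_iff_finite prime_gt_0_nat zero_less_power)
  have card_sub: "\<exists>j\<le>e. card S = p ^ j" if "subgroup S G" for S
    using card_subgroup_dvd_order[OF that] ord p by (simp add: divides_primepow_nat)
  have full: "S = carrier G" if "subgroup S G" "card S = p ^ e" for S
    using that ord fin subgroup.subset[OF that(1)] by (intro card_subset_eq) (auto simp: order_def)
  show ?thesis
  proof (cases "e = 0")
    case True
    then have "carrier G = {\<one>}" using ord order_one_triv_iff by simp
    then show ?thesis by (intro exI[of _ "\<lambda>_. \<one>"]) (auto dest: subgroup.one_closed subgroup.mem_carrier)
  next
    case False
    then have "order G \<noteq> 1" using ord p by (metis prime_gt_1_nat one_less_power less_irrefl gr0I)
    then obtain a where a: "a \<in> carrier G" "a \<noteq> \<one>" using order_one_triv_iff by blast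
    let ?A = "generate G {a}"
    have A: "subgroup ?A G" "a \<in> ?A" using a generate_is_subgroup by (auto intro: generate.incl)
    have big: "1 < card S" if "subgroup S G" "a \<in> S" for S
    proof -
      have "{\<one>, a} \<subseteq> S" "finite S" using that subgroup.one_closed fin finite_subset subgroup.subset by blast+
      then have "card {\<one>, a} \<le> card S" by (intro card_mono)
      then show ?thesis using a by simp
    qed
    obtain b where b: "b \<in> carrier G" "?A = carrier G \<or> b \<notin> ?A" using a subgroup.subset[OF A(1)] by blast
    define x where "x i = (if i = (0::nat) then a else b)" for i
    have "S = carrier G" if S: "subgroup S G" "\<forall>i<\<mu>. x i \<in> S" for S
    proof -
      have aS: "a \<in> S" using S(2)[rule_format, of 0] False e by (simp add: x_def)
      obtain j where j: "j \<le> e" "card S = p ^ j" using card_sub[OF S(1)] by blast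
      have j0: "j \<noteq> 0" using big[OF S(1) aS] j by (intro notI) simp
      show ?thesis
      proof (cases "j = e")
        case True then show ?thesis using full S(1) j by blast
      next
        case False
        then have je: "j = 1" "e = 2" "\<mu> = 2" using j j0 e by auto
        have bS: "b \<in> S" using S(2)[rule_format, of 1] je by (simp add: x_def)
        have AS: "?A \<subseteq> S" using aS S(1) by (intro generate_subgroup_incl) auto
        obtain i where i: "i \<le> e" "card ?A = p ^ i" using card_sub[OF A(1)] by blast
        have "i \<noteq> 0" using big[OF A] i by (intro notI) simp
        then have "card S \<le> card ?A" using i j je self_le_power[OF prime_ge_1_nat[OF p]] by simp
        then have "?A = S" using AS fin subgroup.subset[OF S(1)] by (intro card_seteq) (auto intro: finite_subset)
        then show ?thesis using b(2) bS by blast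
      qed
    qed
    then show ?thesis using a b by (intro exI[of _ x]) (auto simp: x_def)
  qed
qed

text \<open>
  If \<open>Y i\<close> are such elements for \<open>K\<close> and \<open>x i\<close> generate \<open>P\<close>, then \<open>Y i \<otimes> x i\<close> will do. In the image the two factors
  commute and have coprime orders, so the image of \<open>x i\<close> is a power of the image of the product, with an exponent that
  depends only on the orders of \<open>K\<close> and \<open>P\<close>.
\<close>

lemma odd_cube_free_determining_elements:
  fixes G :: "('a, 'b) monoid_scheme"
  assumes "group G" "odd (order G)" "cube_free (order G)" and \<mu>: "\<mu> \<le> 2"
    and "\<forall>p. prime p \<longrightarrow> multiplicity p (order G) \<le> \<mu>"
  shows "\<exists>X :: nat \<Rightarrow> 'a. (\<forall>i<\<mu>. X i \<in> carrier G) \<and>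
    (\<forall>(L :: ('c, 'd) monoid_scheme) \<phi> \<psi>. group L \<longrightarrow> \<phi> \<in> hom G L \<longrightarrow> \<psi> \<in> hom G L \<longrightarrow>
      (\<forall>x\<in>carrier G. \<forall>y\<in>carrier G. \<phi> x \<otimes>\<^bsub>L\<^esub> \<phi> y = \<phi> y \<otimes>\<^bsub>L\<^esub> \<phi> x) \<longrightarrow>
      (\<forall>x\<in>carrier G. \<forall>y\<in>carrier G. \<psi> x \<otimes>\<^bsub>L\<^esub> \<psi> y = \<psi> y \<otimes>\<^bsub>L\<^esub> \<psi> x) \<longrightarrow>
      (\<forall>i<\<mu>. \<phi> (X i) = \<psi> (X i)) \<longrightarrow> (\<forall>x\<in>carrier G. \<phi> x = \<psi> x))"
  using assms(1-3,5)
proof (induction rule: odd_cube_free_group_induct)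
  case (trivial G)
  then have "carrier G = {\<one>\<^bsub>G\<^esub>}" using group.order_one_triv_iff by blast
  moreover have "\<phi> \<one>\<^bsub>G\<^esub> = \<psi> \<one>\<^bsub>G\<^esub>" if "group L" "\<phi> \<in> hom G L" "\<psi> \<in> hom G L"
    for L :: "('c, 'd) monoid_scheme" and \<phi> \<psi>
    using hom_one[OF that(2) trivial.hyps(1) that(1)] hom_one[OF that(3) trivial.hyps(1) that(1)] by simp
  ultimately show ?case by (intro exI[of _ "\<lambda>_. \<one>\<^bsub>G\<^esub>"]) simp
next
  case (extension G p e K P)
  interpret G: group G by fact
  interpret K: normal K G by fact
  interpret P: subgroup P G by fact
  have pos: "order G > 0" using cube_free_pos[OF extension.hyps(3)] .
  then have fin: "finite (carrier G)" using G.order_gt_0_iff_finite by simp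
  have Kdvd: "card K dvd order G" and Pdvd: "p ^ e dvd order G" using extension.hyps by (metis dvd_triv_left dvd_triv_right)+
  have "multiplicity r (card K) \<le> \<mu>" if "prime r" for r
    using extension.prems[rule_format, OF that] dvd_imp_multiplicity_le[OF Kdvd, of r] pos by simp
  then obtain Y where Y: "\<forall>i<\<mu>. Y i \<in> K" and Y_det:
    "\<And>(L :: ('c, 'd) monoid_scheme) \<phi> \<psi>. group L \<Longrightarrow> \<phi> \<in> hom (G\<lparr>carrier := K\<rparr>) L \<Longrightarrow> \<psi> \<in> hom (G\<lparr>carrier := K\<rparr>) L \<Longrightarrow>
      (\<forall>x\<in>K. \<forall>y\<in>K. \<phi> x \<otimes>\<^bsub>L\<^esub> \<phi> y = \<phi> y \<otimes>\<^bsub>L\<^esub> \<phi> x) \<Longrightarrow>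
      (\<forall>x\<in>K. \<forall>y\<in>K. \<psi> x \<otimes>\<^bsub>L\<^esub> \<psi> y = \<psi> y \<otimes>\<^bsub>L\<^esub> \<psi> x) \<Longrightarrow>
      (\<forall>i<\<mu>. \<phi> (Y i) = \<psi> (Y i)) \<Longrightarrow> (\<forall>x\<in>K. \<phi> x = \<psi> x)"
    using extension.IH by (auto simp: order_def)
  have "e \<le> multiplicity p (order G)"
    using Pdvd pos extension.hyps(4) by (intro multiplicity_geI) auto
  then have e\<mu>: "e \<le> \<mu>" using extension.prems extension.hyps(4) le_trans by blast
  have ordP: "order (G\<lparr>carrier := P\<rparr>) = p ^ e" using extension.hyps(10) by (simp add: order_def)
  obtain x where x: "\<forall>i<\<mu>. x i \<in> P" and x_gen: "\<And>S. subgroup S (G\<lparr>carrier := P\<rparr>) \<Longrightarrow> (\<forall>i<\<mu>. x i \<in> S) \<Longrightarrow> S = P"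
    using group.prime_power_le_2_generators[OF G.subgroup_imp_group[OF P.subgroup_axioms] extension.hyps(4) ordP e\<mu> \<mu>]
    by auto
  have K0: "card K \<noteq> 0" using Kdvd pos by (metis dvd_0_left_iff less_irrefl)
  \<comment> \<open>raising to the power \<open>card K * r\<close> is trivial on \<open>K\<close> and the identity on \<open>P\<close>\<close>
  obtain r t where rt: "card K * r = card P * t + 1"
    using bezout_nat[OF K0, of "card P"] extension.hyps(12) by (metis coprime_imp_gcd_eq_1)
  interpret KG: group "G\<lparr>carrier := K\<rparr>" by (rule G.subgroup_imp_group[OF K.subgroup_axioms])
  interpret PG: group "G\<lparr>carrier := P\<rparr>" by (rule G.subgroup_imp_group[OF P.subgroup_axioms])
  have powK: "y [^]\<^bsub>G\<^esub> card K = \<one>\<^bsub>G\<^esub>" if "y \<in> K" for y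
    using KG.pow_order_eq_1[of y] that by (simp add: order_def flip: G.nat_pow_consistent)
  have powP: "y [^]\<^bsub>G\<^esub> card P = \<one>\<^bsub>G\<^esub>" if "y \<in> P" for y
    using PG.pow_order_eq_1[of y] that by (simp add: order_def flip: G.nat_pow_consistent)
  have "\<forall>z\<in>carrier G. \<phi> z = \<psi> z"
    if L: "group L" and \<phi>: "\<phi> \<in> hom G L" and \<psi>: "\<psi> \<in> hom G L"
      and \<phi>_ab: "\<forall>x\<in>carrier G. \<forall>y\<in>carrier G. \<phi> x \<otimes>\<^bsub>L\<^esub> \<phi> y = \<phi> y \<otimes>\<^bsub>L\<^esub> \<phi> x"
      and \<psi>_ab: "\<forall>x\<in>carrier G. \<forall>y\<in>carrier G. \<psi> x \<otimes>\<^bsub>L\<^esub> \<psi> y = \<psi> y \<otimes>\<^bsub>L\<^esub> \<psi> x"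
      and eq: "\<forall>i<\<mu>. \<phi> (Y i \<otimes>\<^bsub>G\<^esub> x i) = \<psi> (Y i \<otimes>\<^bsub>G\<^esub> x i)" for L :: "('c, 'd) monoid_scheme" and \<phi> \<psi>
  proof -
    interpret L: group L by fact
    interpret F: group_hom G L \<phi> by (intro group_hom.intro group_hom_axioms.intro G.is_group L \<phi>)
    interpret F': group_hom G L \<psi> by (intro group_hom.intro group_hom_axioms.intro G.is_group L \<psi>)
    have project: "\<chi> (Y i \<otimes>\<^bsub>G\<^esub> x i) [^]\<^bsub>L\<^esub> (card K * r) = \<chi> (x i)"
      if \<chi>: "\<chi> \<in> hom G L" and ab: "\<forall>x\<in>carrier G. \<forall>y\<in>carrier G. \<chi> x \<otimes>\<^bsub>L\<^esub> \<chi> y = \<chi> y \<otimes>\<^bsub>L\<^esub> \<chi> x" and i: "i < \<mu>" for \<chi> i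
    proof -
      have Yi: "Y i \<in> K" "Y i \<in> carrier G" and xi: "x i \<in> P" "x i \<in> carrier G" using Y x i by auto
      have "\<chi> (Y i \<otimes>\<^bsub>G\<^esub> x i) [^]\<^bsub>L\<^esub> (card K * r) = \<chi> (Y i) [^]\<^bsub>L\<^esub> (card K * r) \<otimes>\<^bsub>L\<^esub> \<chi> (x i) [^]\<^bsub>L\<^esub> (card K * r)"
        using ab Yi xi hom_in_carrier[OF \<chi>] by (simp add: hom_mult[OF \<chi>] L.pow_mult_distrib)
      also have "\<chi> (Y i) [^]\<^bsub>L\<^esub> (card K * r) = \<chi> ((Y i [^]\<^bsub>G\<^esub> card K) [^]\<^bsub>G\<^esub> r)"
        using Yi by (simp add: G.nat_pow_pow hom_nat_pow[OF \<chi> _ G.is_group L])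
      also have "\<dots> = \<one>\<^bsub>L\<^esub>" using powK[OF Yi(1)] hom_one[OF \<chi> G.is_group L] by simp
      also have "\<chi> (x i) [^]\<^bsub>L\<^esub> (card K * r) = \<chi> (x i [^]\<^bsub>G\<^esub> (card K * r))"
        using xi by (simp add: hom_nat_pow[OF \<chi> _ G.is_group L])
      also have "x i [^]\<^bsub>G\<^esub> (card K * r) = x i"
        unfolding rt using xi powP[OF xi(1)] by (simp flip: G.nat_pow_mult G.nat_pow_pow)
      finally show ?thesis using hom_in_carrier[OF \<chi> xi(2)] by simp
    qed
    have x_eq: "\<phi> (x i) = \<psi> (x i)" if i: "i < \<mu>" for i
      using project[OF \<phi> \<phi>_ab i] project[OF \<psi> \<psi>_ab i] eq i by simp
    have Y_eq: "\<phi> (Y i) = \<psi> (Y i)" if i: "i < \<mu>" for i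
    proof -
      have Yi: "Y i \<in> carrier G" and xi: "x i \<in> carrier G" using Y x i by auto
      have "\<phi> (Y i) \<otimes>\<^bsub>L\<^esub> \<phi> (x i) = \<psi> (Y i) \<otimes>\<^bsub>L\<^esub> \<phi> (x i)"
        using eq i Yi xi x_eq[OF i] by (metis hom_mult[OF \<phi>] hom_mult[OF \<psi>])
      then show ?thesis using Yi xi hom_in_carrier[OF \<phi>] hom_in_carrier[OF \<psi>] L.right_cancel by blast
    qed
    have restrict: "\<chi> \<in> hom (G\<lparr>carrier := K\<rparr>) L" if "\<chi> \<in> hom G L" for \<chi>
      using that K.subset by (auto simp: hom_def)
    have onK: "\<forall>y\<in>K. \<phi> y = \<psi> y"
    proof (rule Y_det[OF L restrict[OF \<phi>] restrict[OF \<psi>]])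
      show "\<forall>x\<in>K. \<forall>y\<in>K. \<phi> x \<otimes>\<^bsub>L\<^esub> \<phi> y = \<phi> y \<otimes>\<^bsub>L\<^esub> \<phi> x" using \<phi>_ab by simp
      show "\<forall>x\<in>K. \<forall>y\<in>K. \<psi> x \<otimes>\<^bsub>L\<^esub> \<psi> y = \<psi> y \<otimes>\<^bsub>L\<^esub> \<psi> x" using \<psi>_ab by simp
    qed (use Y_eq in blast)
    have "subgroup {y \<in> P. \<phi> y = \<psi> y} (G\<lparr>carrier := P\<rparr>)"
    proof (rule G.subgroup_incl[OF _ P.subgroup_axioms])
      show "subgroup {y \<in> P. \<phi> y = \<psi> y} G"
      proof (rule G.subgroupI)
        have "\<one>\<^bsub>G\<^esub> \<in> {y \<in> P. \<phi> y = \<psi> y}" by simp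
        then show "{y \<in> P. \<phi> y = \<psi> y} \<noteq> {}" by blast
        fix a b assume a: "a \<in> {y \<in> P. \<phi> y = \<psi> y}"
        show "inv\<^bsub>G\<^esub> a \<in> {y \<in> P. \<phi> y = \<psi> y}" using a by simp
        assume "b \<in> {y \<in> P. \<phi> y = \<psi> y}"
        then show "a \<otimes>\<^bsub>G\<^esub> b \<in> {y \<in> P. \<phi> y = \<psi> y}" using a by simp
      qed auto
    qed auto
    then have "{y \<in> P. \<phi> y = \<psi> y} = P" using x x_eq by (intro x_gen) auto
    then have onP: "\<forall>y\<in>P. \<phi> y = \<psi> y" by blast
    show ?thesis
    proof
      fix z assume "z \<in> carrier G"
      then have "z \<in> (\<lambda>(k, y). k \<otimes>\<^bsub>G\<^esub> y) ` (K \<times> P)"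
        using G.coprime_subgroups_factorize[OF fin K.subgroup_axioms P.subgroup_axioms extension.hyps(12,11)]
        by (simp add: bij_betw_def)
      then obtain k y where "k \<in> K" "y \<in> P" "z = k \<otimes>\<^bsub>G\<^esub> y" by auto
      then show "\<phi> z = \<psi> z" using onK onP by simp
    qed
  qed
  moreover have "\<forall>i<\<mu>. Y i \<otimes>\<^bsub>G\<^esub> x i \<in> carrier G" using Y x by simp
  ultimately show ?case by (intro exI[of _ "\<lambda>i. Y i \<otimes>\<^bsub>G\<^esub> x i"]) blast
qed

section \<open>Counting actions on a Sylow subgroup\<close>

text \<open>
  Fixing the values outside the carrier makes this a finite set that counts each homomorphism once.
\<close>

definition ext_homs :: "('h, 'm) monoid_scheme \<Rightarrow> ('l, 'n) monoid_scheme \<Rightarrow> ('h \<Rightarrow> 'l) set" where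
  "ext_homs H L = hom H L \<inter> extensional (carrier H)"

lemma ext_homs_subset_PiE: "ext_homs H L \<subseteq> carrier H \<rightarrow>\<^sub>E carrier L"
  by (auto simp: ext_homs_def hom_def PiE_def)

lemma finite_ext_homs: "finite (carrier H) \<Longrightarrow> finite (carrier L) \<Longrightarrow> finite (ext_homs H L)"
  by (rule finite_subset[OF ext_homs_subset_PiE]) (simp add: finite_PiE)

lemma finite_auto: "finite (carrier Q) \<Longrightarrow> finite (auto Q)"
proof -
  assume fin: "finite (carrier Q)"
  have "auto Q \<subseteq> carrier Q \<rightarrow>\<^sub>E carrier Q" by (auto simp: auto_def Bij_def PiE_def hom_def)
  then show ?thesis by (rule finite_subset) (simp add: fin finite_PiE)
qed

lemma card_ext_homs_abelian_le:
  fixes H :: "('h, 'm) monoid_scheme" and L :: "('l, 'n) monoid_scheme"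
  assumes "group H" "odd (order H)" "cube_free (order H)" "\<mu> \<le> 2"
    and "\<forall>p. prime p \<longrightarrow> multiplicity p (order H) \<le> \<mu>"
    and L: "group L" "finite (carrier L)"
    and ab: "\<And>\<phi>. \<phi> \<in> hom H L \<Longrightarrow> \<forall>x\<in>carrier H. \<forall>y\<in>carrier H. \<phi> x \<otimes>\<^bsub>L\<^esub> \<phi> y = \<phi> y \<otimes>\<^bsub>L\<^esub> \<phi> x"
  shows "card (ext_homs H L) \<le> card {f \<in> {..<\<mu>} \<rightarrow>\<^sub>E carrier L. \<forall>i<\<mu>. \<forall>j<\<mu>. f i \<otimes>\<^bsub>L\<^esub> f j = f j \<otimes>\<^bsub>L\<^esub> f i}"
proof -
  from odd_cube_free_determining_elements[OF assms(1-5), where 'c = 'l and 'd = 'n]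
  obtain X :: "nat \<Rightarrow> 'h" where X: "\<forall>i<\<mu>. X i \<in> carrier H" and det_all:
    "\<forall>(L :: ('l, 'n) monoid_scheme) \<phi> \<psi>. group L \<longrightarrow> \<phi> \<in> hom H L \<longrightarrow> \<psi> \<in> hom H L \<longrightarrow>
      (\<forall>x\<in>carrier H. \<forall>y\<in>carrier H. \<phi> x \<otimes>\<^bsub>L\<^esub> \<phi> y = \<phi> y \<otimes>\<^bsub>L\<^esub> \<phi> x) \<longrightarrow>
      (\<forall>x\<in>carrier H. \<forall>y\<in>carrier H. \<psi> x \<otimes>\<^bsub>L\<^esub> \<psi> y = \<psi> y \<otimes>\<^bsub>L\<^esub> \<psi> x) \<longrightarrow>
      (\<forall>i<\<mu>. \<phi> (X i) = \<psi> (X i)) \<longrightarrow> (\<forall>x\<in>carrier H. \<phi> x = \<psi> x)"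
    by (elim exE conjE)
  have det: "\<forall>x\<in>carrier H. \<phi> x = \<psi> x"
    if "\<phi> \<in> hom H L" "\<psi> \<in> hom H L" "\<forall>i<\<mu>. \<phi> (X i) = \<psi> (X i)" for \<phi> \<psi>
    by (rule det_all[THEN spec[of _ L], THEN spec[of _ \<phi>], THEN spec[of _ \<psi>], THEN mp, THEN mp, THEN mp, THEN mp, THEN mp, THEN mp])
       (fact L(1) that(1) that(2) ab[OF that(1)] ab[OF that(2)] that(3))+
  show ?thesis
  proof (rule card_inj_on_le[of "\<lambda>\<phi>. \<lambda>i\<in>{..<\<mu>}. \<phi> (X i)"])
    show "inj_on (\<lambda>\<phi>. \<lambda>i\<in>{..<\<mu>}. \<phi> (X i)) (ext_homs H L)"
    proof (rule inj_onI)
      fix \<phi> \<psi> assume *: "\<phi> \<in> ext_homs H L" "\<psi> \<in> ext_homs H L" "(\<lambda>i\<in>{..<\<mu>}. \<phi> (X i)) = (\<lambda>i\<in>{..<\<mu>}. \<psi> (X i))"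
      then have "\<forall>i<\<mu>. \<phi> (X i) = \<psi> (X i)" by (metis lessThan_iff restrict_apply')
      then show "\<phi> = \<psi>" using det[of \<phi> \<psi>] * by (auto simp: ext_homs_def intro: extensionalityI)
    qed
    show "(\<lambda>\<phi>. \<lambda>i\<in>{..<\<mu>}. \<phi> (X i)) ` ext_homs H L \<subseteq> {f \<in> {..<\<mu>} \<rightarrow>\<^sub>E carrier L. \<forall>i<\<mu>. \<forall>j<\<mu>. f i \<otimes>\<^bsub>L\<^esub> f j = f j \<otimes>\<^bsub>L\<^esub> f i}"
      using X ab by (auto simp: ext_homs_def hom_in_carrier split: if_splits)
    have "finite ({..<\<mu>} \<rightarrow>\<^sub>E carrier L)" using L(2) by (intro finite_PiE) auto
    then show "finite {f \<in> {..<\<mu>} \<rightarrow>\<^sub>E carrier L. \<forall>i<\<mu>. \<forall>j<\<mu>. f i \<otimes>\<^bsub>L\<^esub> f j = f j \<otimes>\<^bsub>L\<^esub> f i}"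
      by simp
  qed
qed

lemma auto_ne_one:
  assumes "group Q" "f \<in> auto Q" "x \<in> carrier Q" "x \<noteq> \<one>\<^bsub>Q\<^esub>"
  shows "f x \<in> carrier Q - {\<one>\<^bsub>Q\<^esub>}"
proof -
  have "f \<one>\<^bsub>Q\<^esub> = \<one>\<^bsub>Q\<^esub>" using hom_one[OF auto_hom[OF assms(2)] assms(1,1)] .
  moreover have "inj_on f (carrier Q)" using auto_bij[OF assms(2)] by (simp add: bij_betw_def)
  ultimately have "f x \<noteq> \<one>\<^bsub>Q\<^esub>" using assms(1,3,4) by (metis group.is_monoid inj_onD monoid.one_closed)
  then show ?thesis using hom_in_carrier[OF auto_hom[OF assms(2)] assms(3)] by simp
qed

text \<open>
  An automorphism is determined by the image of a generator, and the automorphisms commute.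
\<close>

lemma card_ext_homs_cyclic_le:
  fixes H :: "('h, 'm) monoid_scheme" and Q :: "('q, 'n) monoid_scheme"
  assumes H: "group H" "odd (order H)" "cube_free (order H)" "\<mu> \<le> 2"
      "\<forall>p. prime p \<longrightarrow> multiplicity p (order H) \<le> \<mu>"
    and Q: "group Q" "cyclic_group Q" "order Q > 1"
  shows "card (ext_homs H (AutoGroup Q)) \<le> (order Q - 1) ^ \<mu>"
proof -
  interpret Q: group Q by fact
  interpret L: group "AutoGroup Q" by (rule Q.AutoGroup)
  have fin: "finite (carrier Q)" using Q(3) Q.order_gt_0_iff_finite by simp
  obtain v where v: "v \<in> carrier Q" "carrier Q = range (\<lambda>n::int. v [^]\<^bsub>Q\<^esub> n)"
    using Q(2) Q.cyclic_group by blast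
  have gen: "\<exists>n::int. x = v [^]\<^bsub>Q\<^esub> n" if "x \<in> carrier Q" for x using that unfolding v(2) by auto
  have v1: "v \<noteq> \<one>\<^bsub>Q\<^esub>"
  proof
    assume "v = \<one>\<^bsub>Q\<^esub>"
    then have "carrier Q = {\<one>\<^bsub>Q\<^esub>}" unfolding v(2) by auto
    then show False using Q.order_one_triv_iff Q(3) by simp
  qed
  have f_pow: "f (v [^]\<^bsub>Q\<^esub> (n::int)) = f v [^]\<^bsub>Q\<^esub> n" if "f \<in> auto Q" for f n
    by (rule endo_int_pow[OF Q(1) auto_hom[OF that] v(1)])
  have ab: "f \<otimes>\<^bsub>AutoGroup Q\<^esub> g = g \<otimes>\<^bsub>AutoGroup Q\<^esub> f" if fg: "f \<in> auto Q" "g \<in> auto Q" for f g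
    unfolding AutoGroup_commute_iff[OF Q(1) fg]
  proof
    fix x assume "x \<in> carrier Q"
    then obtain n where n: "x = v [^]\<^bsub>Q\<^esub> (n::int)" using gen by blast
    obtain a where a: "f v = v [^]\<^bsub>Q\<^esub> (a::int)" using gen[OF hom_in_carrier[OF auto_hom[OF fg(1)] v(1)]] by blast
    obtain b where b: "g v = v [^]\<^bsub>Q\<^esub> (b::int)" using gen[OF hom_in_carrier[OF auto_hom[OF fg(2)] v(1)]] by blast
    note ab = a b
    show "f (g x) = g (f x)"
      unfolding n f_pow[OF fg(1)] f_pow[OF fg(2)] ab Q.int_pow_pow[OF v(1)]
      unfolding f_pow[OF fg(1)] f_pow[OF fg(2)] ab Q.int_pow_pow[OF v(1)] by (simp add: mult_ac)
  qed
  have "card (ext_homs H (AutoGroup Q)) \<le> card {f \<in> {..<\<mu>} \<rightarrow>\<^sub>E carrier (AutoGroup Q). \<forall>i<\<mu>. \<forall>j<\<mu>.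
      f i \<otimes>\<^bsub>AutoGroup Q\<^esub> f j = f j \<otimes>\<^bsub>AutoGroup Q\<^esub> f i}"
    using hom_in_carrier ab by (intro card_ext_homs_abelian_le[OF H Q.AutoGroup]) (fastforce simp: finite_auto[OF fin])+
  also have "\<dots> \<le> card ({..<\<mu>} \<rightarrow>\<^sub>E auto Q)"
    using finite_auto[OF fin] by (intro card_mono finite_PiE) auto
  also have "\<dots> = card (auto Q) ^ \<mu>" by (simp add: card_PiE)
  also have "card (auto Q) \<le> card (carrier Q - {\<one>\<^bsub>Q\<^esub>})"
  proof (rule card_inj_on_le[of "\<lambda>f. f v"])
    show "inj_on (\<lambda>f. f v) (auto Q)"
    proof (rule inj_onI)
      fix f g assume fg: "f \<in> auto Q" "g \<in> auto Q" "f v = g v"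
      show "f = g"
      proof (rule auto_eqI[OF fg(1,2)])
        fix x assume "x \<in> carrier Q"
        then obtain n where "x = v [^]\<^bsub>Q\<^esub> (n::int)" using gen by blast
        then show "f x = g x" using f_pow[OF fg(1), of n] f_pow[OF fg(2), of n] fg(3) by simp
      qed
    qed
    show "(\<lambda>f. f v) ` auto Q \<subseteq> carrier Q - {\<one>\<^bsub>Q\<^esub>}"
      by (rule image_subsetI, rule auto_ne_one[OF Q(1) _ v(1) v1])
  qed (use fin in simp)
  also have "card (carrier Q - {\<one>\<^bsub>Q\<^esub>}) = order Q - 1" using fin by (simp add: order_def)
  finally show ?thesis by (simp add: power_mono)
qed

lemma (in elementary_abelian_square) finite_carrier: "finite (carrier G)"
  using order_eq q by (metis order_gt_0_iff_finite prime_gt_0_nat zero_less_power)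

lemma (in elementary_abelian_square) basis_exists: "\<exists>v w. basis v w"
proof -
  have q1: "1 < q" using q by (rule prime_gt_1_nat)
  have "carrier G \<noteq> {\<one>}"
    using order_eq order_one_triv_iff q1 by (metis one_less_power less_irrefl zero_less_numeral)
  then obtain v where v: "v \<in> carrier G" "v \<noteq> \<one>" by blast
  have "\<exists>w\<in>carrier G. \<forall>i::int. w \<noteq> v [^] i"
  proof (rule ccontr)
    assume "\<not> ?thesis"
    then have all: "\<exists>i::int. w = v [^] i" if "w \<in> carrier G" for w using that by blast
    have "carrier G \<subseteq> (\<lambda>i. v [^] i) ` {0..<int q}"
    proof
      fix w assume "w \<in> carrier G"
      then obtain i where "w = v [^] (i::int)" using all by blast
      also have "\<dots> = v [^] (i mod int q)" using v(1) by (intro pow_cong) (auto simp: minus_mod_eq_mult_div)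
      finally show "w \<in> (\<lambda>i. v [^] i) ` {0..<int q}" using q1 by (auto intro!: image_eqI[of _ _ "i mod int q"])
    qed
    then have "card (carrier G) \<le> card {0..<int q}" by (meson card_image_le card_mono finite_atLeastLessThan_int finite_imageI le_trans)
    then show False using order_eq q1 by (simp add: order_def power2_eq_square)
  qed
  then show ?thesis using v by (auto simp: basis_def)
qed

text \<open>
  There are at most \<open>(q\<^sup>2 - 1)\<^sup>2\<close> automorphisms, since they are determined by the images of two basis vectors. Among them
  at most \<open>q - 1\<close> are scalar. If \<open>f\<close> is not scalar and \<open>v\<close> is a cyclic vector for \<open>f\<close>, then an automorphism
  commuting with \<open>f\<close> is determined by the image of \<open>v\<close>, which leaves \<open>q\<^sup>2 - 1\<close> possibilities.
\<close>

lemma (in elementary_abelian_square) card_commuting_pairs_le: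
  defines "N \<equiv> q ^ 2 - 1"
  shows "card {(f, g) \<in> auto G \<times> auto G. \<forall>x\<in>carrier G. f (g x) = g (f x)} \<le> N ^ 2 * (q ^ 2 + q - 2)"
proof -
  have q1: "1 < q" using q by (rule prime_gt_1_nat)
  have fin: "finite (auto G)" using finite_auto[OF finite_carrier] .
  have N: "card (carrier G - {\<one>}) = N" using order_eq finite_carrier by (simp add: order_def N_def)
  let ?C = "\<lambda>f. {g \<in> auto G. \<forall>x\<in>carrier G. f (g x) = g (f x)}"
  let ?S = "{f \<in> auto G. scalar f}"
  have finC: "finite (?C f)" for f using fin by simp
  have auto_le: "card (auto G) \<le> N ^ 2"
  proof -
    obtain v w where b: "basis v w" using basis_exists by blast
    have v: "v \<in> carrier G" "v \<noteq> \<one>" and w: "w \<in> carrier G" "w \<noteq> \<one>"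
      using b unfolding basis_def by (auto dest: spec[of _ "0::int"])
    have "card (auto G) \<le> card ((carrier G - {\<one>}) \<times> (carrier G - {\<one>}))"
    proof (rule card_inj_on_le[of "\<lambda>f. (f v, f w)"])
      show "inj_on (\<lambda>f. (f v, f w)) (auto G)"
        using hom_eq_on_basis[OF b auto_hom auto_hom] by (auto intro!: inj_onI auto_eqI)
      show "(\<lambda>f. (f v, f w)) ` auto G \<subseteq> (carrier G - {\<one>}) \<times> (carrier G - {\<one>})"
        using auto_ne_one[OF is_group _ v] auto_ne_one[OF is_group _ w] by blast
    qed (use finite_carrier in simp)
    then show ?thesis using N by (simp add: card_cartesian_product power2_eq_square)
  qed
  have scalar_le: "card ?S \<le> q - 1"
  proof -
    have "?S \<subseteq> (\<lambda>i. \<lambda>x\<in>carrier G. x [^] i) ` {1..<int q}"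
    proof
      fix f assume f: "f \<in> ?S"
      then obtain i where i: "\<And>x. x \<in> carrier G \<Longrightarrow> f x = x [^] (i::int)" by (auto simp: scalar_def)
      let ?j = "i mod int q"
      have fj: "f x = x [^] ?j" if "x \<in> carrier G" for x
        using i[OF that] pow_cong[OF that, of i ?j] by (simp add: minus_mod_eq_mult_div)
      have "?j \<noteq> 0"
      proof
        assume j0: "?j = 0"
        obtain v where v: "v \<in> carrier G" "v \<noteq> \<one>" using basis_exists by (auto simp: basis_def)
        have "f v = \<one>" using fj[OF v(1)] j0 by simp
        then show False using auto_ne_one[OF is_group _ v, of f] f by simp
      qed
      moreover have "0 \<le> ?j" "?j < int q" using q1 by auto
      moreover have "f = (\<lambda>x\<in>carrier G. x [^] ?j)"
        using f fj by (auto simp: auto_def Bij_def extensional_def)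
      ultimately show "f \<in> (\<lambda>i. \<lambda>x\<in>carrier G. x [^] i) ` {1..<int q}"
        by (intro image_eqI[of _ _ ?j]) auto
    qed
    then have "card ?S \<le> card {1..<int q}" by (meson card_image_le card_mono finite_atLeastLessThan_int finite_imageI le_trans)
    then show ?thesis by simp
  qed
  have C_nonscalar: "card (?C f) \<le> N" if f: "f \<in> auto G" "\<not> scalar f" for f
  proof -
    obtain v where b: "basis v (f v)" using not_scalar_imp_basis[OF auto_hom[OF f(1)] f(2)] .
    have v: "v \<in> carrier G" "v \<noteq> \<one>" using b by (auto simp: basis_def)
    have "card (?C f) \<le> card (carrier G - {\<one>})"
    proof (rule card_inj_on_le[of "\<lambda>g. g v"])
      show "inj_on (\<lambda>g. g v) (?C f)"
      proof (rule inj_onI)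
        fix g h assume gh: "g \<in> ?C f" "h \<in> ?C f" "g v = h v"
        then have "g (f v) = h (f v)" using v(1) by (metis (mono_tags, lifting) mem_Collect_eq)
        then show "g = h" using gh hom_eq_on_basis[OF b auto_hom auto_hom] by (auto intro!: auto_eqI)
      qed
      show "(\<lambda>g. g v) ` ?C f \<subseteq> carrier G - {\<one>}"
        by (rule image_subsetI, rule auto_ne_one[OF is_group _ v]) simp
    qed (use finite_carrier in simp)
    then show ?thesis using N by simp
  qed
  have "{(f, g) \<in> auto G \<times> auto G. \<forall>x\<in>carrier G. f (g x) = g (f x)} = (SIGMA f:auto G. ?C f)" by auto
  then have "card {(f, g) \<in> auto G \<times> auto G. \<forall>x\<in>carrier G. f (g x) = g (f x)} = (\<Sum>f\<in>auto G. card (?C f))"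
    using fin finC by simp
  also have "\<dots> = (\<Sum>f\<in>?S. card (?C f)) + (\<Sum>f\<in>auto G - ?S. card (?C f))"
    using fin by (subst sum.subset_diff[of ?S]) auto
  also have "\<dots> \<le> (\<Sum>f\<in>?S. N ^ 2) + (\<Sum>f\<in>auto G - ?S. N)"
  proof (intro add_mono sum_mono)
    fix f
    have "card (?C f) \<le> card (auto G)" using fin by (intro card_mono) auto
    then show "card (?C f) \<le> N ^ 2" using auto_le by simp
  qed (use C_nonscalar in auto)
  also have "\<dots> = card ?S * N ^ 2 + card (auto G - ?S) * N" by simp
  also have "\<dots> \<le> (q - 1) * N ^ 2 + N ^ 2 * N"
    using scalar_le auto_le card_mono[OF fin, of "auto G - ?S"] by (intro add_mono mult_right_mono) auto
  also have "\<dots> = N ^ 2 * (q ^ 2 + q - 2)"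
  proof -
    have "q ^ 2 + q - 2 = (q - 1) + N" using q1 unfolding N_def by (simp add: power2_eq_square)
    then show ?thesis by (simp add: algebra_simps)
  qed
  finally show ?thesis .
qed

lemma card_ext_homs_elementary_le:
  fixes H :: "('h, 'm) monoid_scheme" and Q :: "('q, 'n) monoid_scheme"
  assumes H: "group H" "odd (order H)" "cube_free (order H)"
    and Q: "elementary_abelian_square Q q" and "odd q" "\<not> q dvd order H"
  shows "card (ext_homs H (AutoGroup Q)) \<le> (q ^ 2 - 1) ^ 2 * (q ^ 2 + q - 2)"
proof -
  interpret Q: elementary_abelian_square Q q by fact
  have fin: "finite (auto Q)" using finite_auto[OF Q.finite_carrier] .
  have "card (ext_homs H (AutoGroup Q)) \<le> card {f \<in> {..<2::nat} \<rightarrow>\<^sub>E carrier (AutoGroup Q). \<forall>i<2. \<forall>j<2.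
      f i \<otimes>\<^bsub>AutoGroup Q\<^esub> f j = f j \<otimes>\<^bsub>AutoGroup Q\<^esub> f i}"
  proof (rule card_ext_homs_abelian_le[OF H _ _ Q.AutoGroup])
    show "\<forall>p. prime p \<longrightarrow> multiplicity p (order H) \<le> 2" using cube_free_multiplicity_le[OF H(3)] by blast
    show "finite (carrier (AutoGroup Q))" using fin by simp
    show "\<forall>x\<in>carrier H. \<forall>y\<in>carrier H. \<phi> x \<otimes>\<^bsub>AutoGroup Q\<^esub> \<phi> y = \<phi> y \<otimes>\<^bsub>AutoGroup Q\<^esub> \<phi> x"
      if "\<phi> \<in> hom H (AutoGroup Q)" for \<phi>
      by (rule odd_cube_free_image_abelian[OF H Q assms(5,6) that])
  qed simp
  also have "\<dots> \<le> card {(f, g) \<in> auto Q \<times> auto Q. \<forall>x\<in>carrier Q. f (g x) = g (f x)}"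
  proof (rule card_inj_on_le[of "\<lambda>f. (f 0, f 1)"])
    show "inj_on (\<lambda>f. (f 0, f 1)) {f \<in> {..<2::nat} \<rightarrow>\<^sub>E carrier (AutoGroup Q). \<forall>i<2. \<forall>j<2.
      f i \<otimes>\<^bsub>AutoGroup Q\<^esub> f j = f j \<otimes>\<^bsub>AutoGroup Q\<^esub> f i}"
    proof (rule inj_onI)
      fix f g :: "nat \<Rightarrow> 'q \<Rightarrow> 'q"
      assume f: "f \<in> {f \<in> {..<2} \<rightarrow>\<^sub>E carrier (AutoGroup Q). \<forall>i<2. \<forall>j<2. f i \<otimes>\<^bsub>AutoGroup Q\<^esub> f j = f j \<otimes>\<^bsub>AutoGroup Q\<^esub> f i}"
        and g: "g \<in> {f \<in> {..<2} \<rightarrow>\<^sub>E carrier (AutoGroup Q). \<forall>i<2. \<forall>j<2. f i \<otimes>\<^bsub>AutoGroup Q\<^esub> f j = f j \<otimes>\<^bsub>AutoGroup Q\<^esub> f i}"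
        and eq: "(f 0, f 1) = (g 0, g 1)"
      have fE: "f \<in> {..<2} \<rightarrow>\<^sub>E carrier (AutoGroup Q)" and gE: "g \<in> {..<2} \<rightarrow>\<^sub>E carrier (AutoGroup Q)" using f g by blast+
      show "f = g"
      proof (rule PiE_ext[OF fE gE])
        fix i :: nat assume "i \<in> {..<2}"
        then have "i = 0 \<or> i = 1" by auto
        then show "f i = g i" using eq by auto
      qed
    qed
    show "(\<lambda>f. (f 0, f 1)) ` {f \<in> {..<2::nat} \<rightarrow>\<^sub>E carrier (AutoGroup Q). \<forall>i<2. \<forall>j<2.
      f i \<otimes>\<^bsub>AutoGroup Q\<^esub> f j = f j \<otimes>\<^bsub>AutoGroup Q\<^esub> f i} \<subseteq> {(f, g) \<in> auto Q \<times> auto Q. \<forall>x\<in>carrier Q. f (g x) = g (f x)}"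
    proof (rule image_subsetI)
      fix f :: "nat \<Rightarrow> 'q \<Rightarrow> 'q"
      assume f: "f \<in> {f \<in> {..<2} \<rightarrow>\<^sub>E carrier (AutoGroup Q). \<forall>i<2. \<forall>j<2. f i \<otimes>\<^bsub>AutoGroup Q\<^esub> f j = f j \<otimes>\<^bsub>AutoGroup Q\<^esub> f i}"
      then have fE: "f \<in> {..<2} \<rightarrow>\<^sub>E carrier (AutoGroup Q)" by blast
      have 0: "f 0 \<in> auto Q" and 1: "f 1 \<in> auto Q" using PiE_mem[OF fE, of 0] PiE_mem[OF fE, of 1] by simp_all
      have "f 0 \<otimes>\<^bsub>AutoGroup Q\<^esub> f 1 = f 1 \<otimes>\<^bsub>AutoGroup Q\<^esub> f 0" using f by simp
      then show "(f 0, f 1) \<in> {(f, g) \<in> auto Q \<times> auto Q. \<forall>x\<in>carrier Q. f (g x) = g (f x)}"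
        using 0 1 unfolding AutoGroup_commute_iff[OF Q.is_group 0 1] by blast
    qed
    have "finite (auto Q \<times> auto Q)" using fin by simp
    then show "finite {(f, g) \<in> auto Q \<times> auto Q. \<forall>x\<in>carrier Q. f (g x) = g (f x)}"
      by (rule rev_finite_subset) auto
  qed
  also have "\<dots> \<le> (q ^ 2 - 1) ^ 2 * (q ^ 2 + q - 2)" by (rule Q.card_commuting_pairs_le)
  finally show ?thesis .
qed

lemma cyclic_group_iso_integer_mod_group:
  assumes "group Q" "cyclic_group Q" "order Q = N" "N > 0"
  shows "integer_mod_group N \<cong> Q"
proof -
  interpret Q: group Q by fact
  obtain v where v: "v \<in> carrier Q" "carrier Q = range (\<lambda>n::int. v [^]\<^bsub>Q\<^esub> n)"
    using assms(2) Q.cyclic_group by blast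
  have ord: "Q.ord v = N"
    using Q.cyclic_order_is_ord[OF v(1)] Q.carrier_subgroup_generated_by_singleton[OF v(1)] v(2) assms(3)
    by (simp add: order_def)
  have eq: "v [^]\<^bsub>Q\<^esub> (i::int) = v [^]\<^bsub>Q\<^esub> j \<longleftrightarrow> int N dvd j - i" for i j
    using Q.int_pow_eq[OF v(1)] ord by simp
  have car: "carrier (integer_mod_group N) = {0..<int N}" using assms(4) by (simp add: carrier_integer_mod_group)
  have red: "v [^]\<^bsub>Q\<^esub> (i mod int N) = v [^]\<^bsub>Q\<^esub> i" for i
    unfolding eq by (simp add: minus_mod_eq_mult_div)
  have "(\<lambda>i. v [^]\<^bsub>Q\<^esub> i) \<in> iso (integer_mod_group N) Q"
    unfolding iso_def
  proof (intro CollectI conjI IntI)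
    show "(\<lambda>i. v [^]\<^bsub>Q\<^esub> i) \<in> hom (integer_mod_group N) Q"
      using v(1) by (intro homI) (auto simp: red Q.int_pow_mult)
    show "bij_betw (\<lambda>i. v [^]\<^bsub>Q\<^esub> i) (carrier (integer_mod_group N)) (carrier Q)"
      unfolding car bij_betw_def
    proof
      show "inj_on (\<lambda>i. v [^]\<^bsub>Q\<^esub> i) {0..<int N}"
      proof (rule inj_onI)
        fix i j assume *: "i \<in> {0..<int N}" "j \<in> {0..<int N}" "v [^]\<^bsub>Q\<^esub> i = v [^]\<^bsub>Q\<^esub> j"
        then have "j mod int N = i mod int N" using eq[of i j] by (metis mod_eq_dvd_iff)
        then show "i = j" using * by simp
      qed
      show "(\<lambda>i. v [^]\<^bsub>Q\<^esub> i) ` {0..<int N} = carrier Q"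
      proof
        show "carrier Q \<subseteq> (\<lambda>i. v [^]\<^bsub>Q\<^esub> i) ` {0..<int N}"
        proof
          fix x assume "x \<in> carrier Q"
          then obtain n where "x = v [^]\<^bsub>Q\<^esub> (n::int)" using v(2) by blast
          then have "x = v [^]\<^bsub>Q\<^esub> (n mod int N)" by (simp add: red)
          then show "x \<in> (\<lambda>i. v [^]\<^bsub>Q\<^esub> i) ` {0..<int N}" using assms(4) by (intro image_eqI[of _ _ "n mod int N"]) auto
        qed
      qed (use v(1) in auto)
    qed
  qed
  then show ?thesis by (rule is_isoI)
qed

lemma cyclic_integer_mod_group: "n > 1 \<Longrightarrow> cyclic_group (integer_mod_group n)"
proof -
  assume n: "n > 1"
  have "carrier (integer_mod_group n) = range (\<lambda>k::int. 1 [^]\<^bsub>integer_mod_group n\<^esub> k)"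
    using n by (auto simp: carrier_integer_mod_group int_pow_integer_mod_group image_iff) (metis mod_pos_pos_trivial)
  then show ?thesis using n group.cyclic_group[OF group_integer_mod_group] by (metis integer_mod_group_1 less_irrefl)
qed

lemma order_integer_mod_group: "n > 0 \<Longrightarrow> order (integer_mod_group n) = n"
  by (simp add: order_def carrier_integer_mod_group)

lemma elementary_integer_mod_square:
  assumes "prime q"
  shows "elementary_abelian_square (integer_mod_group q \<times>\<times> integer_mod_group q) q"
proof -
  let ?Z = "integer_mod_group q"
  have q0: "q > 0" using assms by (rule prime_gt_0_nat)
  interpret group "?Z \<times>\<times> ?Z" by (intro DirProd_group group_integer_mod_group)
  interpret comm_group "?Z \<times>\<times> ?Z"
    by (rule group_comm_groupI) (auto simp: add.commute)
  show ?thesis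
  proof unfold_locales
    show "order (?Z \<times>\<times> ?Z) = q ^ 2"
      using order_integer_mod_group[OF q0] by (simp add: order_def card_cartesian_product power2_eq_square)
    fix x assume x: "x \<in> carrier (?Z \<times>\<times> ?Z)"
    have "(fst x, snd x) [^]\<^bsub>?Z \<times>\<times> ?Z\<^esub> n = (fst x [^]\<^bsub>?Z\<^esub> n, snd x [^]\<^bsub>?Z\<^esub> n)" for n :: nat
      by (induction n) (simp_all add: mult_DirProd' del: pow_integer_mod_group mult_integer_mod_group)
    from this[of q] show "x [^]\<^bsub>?Z \<times>\<times> ?Z\<^esub> q = \<one>\<^bsub>?Z \<times>\<times> ?Z\<^esub>" by simp
  qed (rule assms)
qed

lemma (in elementary_abelian_square) iso_integer_mod_square:
  "integer_mod_group q \<times>\<times> integer_mod_group q \<cong> G"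
proof -
  let ?Z = "integer_mod_group q"
  have q0: "q > 0" using q by (rule prime_gt_0_nat)
  interpret E: elementary_abelian_square "?Z \<times>\<times> ?Z" q by (rule elementary_integer_mod_square[OF q])
  obtain v w where b: "basis v w" using basis_exists by blast
  let ?f = "\<lambda>(i, j). comb v w i j"
  have car: "carrier (?Z \<times>\<times> ?Z) = {0..<int q} \<times> {0..<int q}" using q0 by (simp add: carrier_integer_mod_group)
  have hom: "?f \<in> hom (?Z \<times>\<times> ?Z) G"
  proof (rule homI)
    fix x y
    show "?f (x \<otimes>\<^bsub>?Z \<times>\<times> ?Z\<^esub> y) = ?f x \<otimes> ?f y"
      by (cases x; cases y) (simp add: comb_mult[OF b] comb_eq_iff[OF b] minus_mod_eq_mult_div mod_eq_dvd_iff flip: mod_eq_dvd_iff)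
  qed (use comb_closed[OF b] in auto)
  have small: "i = k" if "int q dvd i - k" "0 \<le> i" "i < int q" "0 \<le> k" "k < int q" for i k
    using that by (metis mod_eq_dvd_iff mod_pos_pos_trivial)
  have inj: "inj_on ?f (carrier (?Z \<times>\<times> ?Z))"
    unfolding car by (auto simp: inj_on_def comb_eq_iff[OF b] intro: small)
  have "?f ` carrier (?Z \<times>\<times> ?Z) = carrier G"
    using inj finite_carrier order_eq E.order_eq comb_closed[OF b]
    by (intro card_subset_eq) (auto simp: card_image order_def)
  then show ?thesis using hom inj by (intro is_isoI[of ?f]) (auto simp: iso_def bij_betw_def)
qed

lemma (in group) prime_order_cyclic:
  assumes "prime p" "order G = p"
  shows "cyclic_group G"
proof -
  have fin: "finite (carrier G)" using assms order_gt_0_iff_finite prime_gt_0_nat by metis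
  have "order G \<noteq> 1" using assms by auto
  then obtain a where a: "a \<in> carrier G" "a \<noteq> \<one>" using order_one_triv_iff by blast
  have "ord a dvd p" "ord a \<noteq> 1" using a ord_dvd_group_order assms ord_eq_1 by auto
  then have "ord a = p" using assms(1) prime_nat_iff by blast
  then have "card (carrier (subgroup_generated G {a})) = card (carrier G)"
    using cyclic_order_is_ord[OF a(1)] assms(2) by (simp add: order_def)
  then have "carrier (subgroup_generated G {a}) = carrier G"
    using fin carrier_subgroup_generated_subset by (intro card_subset_eq) auto
  then show ?thesis unfolding cyclic_group using carrier_subgroup_generated_by_singleton[OF a(1)] a(1) by metis
qed

lemma (in group) noncyclic_prime_square_elementary:
  assumes p: "prime p" and ord: "order G = p ^ 2" and nc: "\<not> cyclic_group G"
  shows "elementary_abelian_square G p"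
proof -
  interpret comm_group G using order_prime_power_le_2_abelian[OF p ord] by simp
  have fin: "finite (carrier G)" using ord p by (metis order_gt_0_iff_finite prime_gt_0_nat zero_less_power)
  show ?thesis
  proof unfold_locales
    fix x assume x: "x \<in> carrier G"
    have "ord x dvd p ^ 2" using ord_dvd_group_order[OF x] ord by simp
    then obtain i where i: "i \<le> 2" "ord x = p ^ i" using p by (auto simp: divides_primepow_nat)
    have "i \<noteq> 2"
    proof
      assume "i = 2"
      then have "card (carrier (subgroup_generated G {x})) = card (carrier G)"
        using cyclic_order_is_ord[OF x] ord i by (simp add: order_def)
      then have "carrier (subgroup_generated G {x}) = carrier G"
        using fin carrier_subgroup_generated_subset by (intro card_subset_eq) auto
      then show False using nc unfolding cyclic_group using carrier_subgroup_generated_by_singleton[OF x] x by metis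
    qed
    then have "i = 0 \<or> i = 1" using i by auto
    then have "ord x dvd p" using i by auto
    then show "x [^] p = \<one>" using pow_eq_id[OF x] by simp
  qed (fact p ord)+
qed

section \<open>Counting semidirect products\<close>

text \<open>
  The group \<open>G\<close> is an inner semidirect product of copies of \<open>T\<close> and \<open>H\<close>, where \<open>H\<close> acts on \<open>T\<close> by \<open>\<phi>\<close>.
\<close>

definition internal_semidirect ::
  "('h, 'm) monoid_scheme \<Rightarrow> ('t, 'n) monoid_scheme \<Rightarrow> ('h \<Rightarrow> 't \<Rightarrow> 't) \<Rightarrow> ('a, 'k) monoid_scheme \<Rightarrow> bool" where
  "internal_semidirect H T \<phi> G \<longleftrightarrow> (\<exists>a b. a \<in> hom T G \<and> b \<in> hom H G \<and>
    bij_betw (\<lambda>(x, h). a x \<otimes>\<^bsub>G\<^esub> b h) (carrier T \<times> carrier H) (carrier G) \<and>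
    (\<forall>h\<in>carrier H. \<forall>x\<in>carrier T. b h \<otimes>\<^bsub>G\<^esub> a x = a (\<phi> h x) \<otimes>\<^bsub>G\<^esub> b h))"

text \<open>
  Both groups are isomorphic to the product set of \<open>T\<close> and \<open>H\<close> with the multiplication \<open>mul\<close> twisted by \<open>\<phi>\<close>.
\<close>

lemma internal_semidirect_unique:
  assumes "group G" "group G'" "group H" "group T" and \<phi>: "\<phi> \<in> ext_homs H (AutoGroup T)"
    and G: "internal_semidirect H T \<phi> G" and G': "internal_semidirect H T \<phi> G'"
  shows "G \<cong> G'"
proof -
  interpret T: group T by fact
  interpret H: group H by fact
  let ?S = "carrier T \<times> carrier H"
  define mul where "mul s t = (fst s \<otimes>\<^bsub>T\<^esub> \<phi> (snd s) (fst t), snd s \<otimes>\<^bsub>H\<^esub> snd t)" for s t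
  have \<phi>_closed: "\<phi> h x \<in> carrier T" if "h \<in> carrier H" "x \<in> carrier T" for h x
  proof -
    have "\<phi> h \<in> auto T" using \<phi> hom_in_carrier[of \<phi> H "AutoGroup T", OF _ that(1)] by (simp add: ext_homs_def)
    then show ?thesis by (rule hom_in_carrier[OF auto_hom that(2)])
  qed
  have mul_closed: "mul s t \<in> ?S" if "s \<in> ?S" "t \<in> ?S" for s t
  proof -
    have "\<phi> (snd s) (fst t) \<in> carrier T"
      by (rule \<phi>_closed) (use that in auto)
    then show ?thesis using that by (auto simp: mul_def)
  qed
  have iso: "\<exists>F. bij_betw F ?S (carrier X) \<and> (\<forall>s\<in>?S. \<forall>t\<in>?S. F (mul s t) = F s \<otimes>\<^bsub>X\<^esub> F t)"
    if X: "group X" "internal_semidirect H T \<phi> X" for X :: "('x, 'y) monoid_scheme"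
  proof -
    interpret X: group X by fact
    obtain a b where a: "a \<in> hom T X" and b: "b \<in> hom H X"
      and bij: "bij_betw (\<lambda>(x, h). a x \<otimes>\<^bsub>X\<^esub> b h) ?S (carrier X)"
      and act: "\<And>h x. h \<in> carrier H \<Longrightarrow> x \<in> carrier T \<Longrightarrow> b h \<otimes>\<^bsub>X\<^esub> a x = a (\<phi> h x) \<otimes>\<^bsub>X\<^esub> b h"
      using X(2) unfolding internal_semidirect_def by blast
    let ?F = "\<lambda>(x, h). a x \<otimes>\<^bsub>X\<^esub> b h"
    have "?F (mul s t) = ?F s \<otimes>\<^bsub>X\<^esub> ?F t" if st: "s \<in> ?S" "t \<in> ?S" for s t
    proof -
      obtain x h y k where eq: "s = (x, h)" "t = (y, k)" by (cases s, cases t)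
      have mem: "x \<in> carrier T" "h \<in> carrier H" "y \<in> carrier T" "k \<in> carrier H" using st eq by auto
      have \<phi>y: "\<phi> h y \<in> carrier T" using \<phi>_closed mem by blast
      note cl = hom_in_carrier[OF a] hom_in_carrier[OF b]
      have "?F s \<otimes>\<^bsub>X\<^esub> ?F t = a x \<otimes>\<^bsub>X\<^esub> (b h \<otimes>\<^bsub>X\<^esub> a y) \<otimes>\<^bsub>X\<^esub> b k"
        using mem eq cl by (simp add: X.m_assoc)
      also have "\<dots> = ?F (mul s t)"
        using mem eq cl \<phi>y act[OF mem(2,3)] by (simp add: mul_def hom_mult[OF a] hom_mult[OF b] X.m_assoc)
      finally show ?thesis by simp
    qed
    then show ?thesis using bij by blast
  qed
  obtain F where F: "bij_betw F ?S (carrier G)" "\<And>s t. s \<in> ?S \<Longrightarrow> t \<in> ?S \<Longrightarrow> F (mul s t) = F s \<otimes>\<^bsub>G\<^esub> F t"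
    using iso[OF assms(1) G] by blast
  obtain F' where F': "bij_betw F' ?S (carrier G')" "\<And>s t. s \<in> ?S \<Longrightarrow> t \<in> ?S \<Longrightarrow> F' (mul s t) = F' s \<otimes>\<^bsub>G'\<^esub> F' t"
    using iso[OF assms(2) G'] by blast
  let ?i = "inv_into ?S F"
  have i: "bij_betw ?i (carrier G) ?S" using F(1) by (rule bij_betw_inv_into)
  have i_mem: "?i x \<in> ?S" and F_i: "F (?i x) = x" if "x \<in> carrier G" for x
    using bij_betwE[OF i] bij_betw_inv_into_right[OF F(1)] that by blast+
  have i_F: "?i (F s) = s" if "s \<in> ?S" for s using bij_betw_inv_into_left[OF F(1) that] .
  have "F' \<circ> ?i \<in> iso G G'"
  proof (rule isoI)
    show bij: "bij_betw (F' \<circ> ?i) (carrier G) (carrier G')" using i F'(1) by (rule bij_betw_trans)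
    show "F' \<circ> ?i \<in> hom G G'"
    proof (rule homI)
      fix x y assume x: "x \<in> carrier G" and y: "y \<in> carrier G"
      show "(F' \<circ> ?i) x \<in> carrier G'" using bij_betwE[OF bij] x by blast
      have "?i (x \<otimes>\<^bsub>G\<^esub> y) = mul (?i x) (?i y)"
        using F(2)[OF i_mem[OF x] i_mem[OF y]] F_i x y i_F[OF mul_closed[OF i_mem[OF x] i_mem[OF y]]] by simp
      then show "(F' \<circ> ?i) (x \<otimes>\<^bsub>G\<^esub> y) = (F' \<circ> ?i) x \<otimes>\<^bsub>G'\<^esub> (F' \<circ> ?i) y"
        using F'(2)[OF i_mem[OF x] i_mem[OF y]] by simp
    qed
  qed
  then show ?thesis by (rule is_isoI)
qed

lemma internal_semidirect_exists:
  assumes "group G" "finite (carrier G)" and Q: "Q \<lhd> G" and K: "subgroup K G"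
    and cop: "coprime (card Q) (card K)" "card Q * card K = order G"
    and T: "group T" "T \<cong> G\<lparr>carrier := Q\<rparr>" and H: "group H" "H \<cong> G\<lparr>carrier := K\<rparr>"
  shows "\<exists>\<phi>\<in>ext_homs H (AutoGroup T). internal_semidirect H T \<phi> G"
proof -
  interpret G: group G by fact
  interpret Q: normal Q G by fact
  interpret K: subgroup K G by fact
  interpret T: group T by fact
  interpret H: group H by fact
  obtain a where a: "a \<in> iso T (G\<lparr>carrier := Q\<rparr>)" using T(2) by (auto simp: is_iso_def)
  obtain b where b: "b \<in> iso H (G\<lparr>carrier := K\<rparr>)" using H(2) by (auto simp: is_iso_def)
  have a_bij: "bij_betw a (carrier T) Q" and b_bij: "bij_betw b (carrier H) K"
    using a b by (auto simp: iso_def)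
  have aQ: "a x \<in> Q" if "x \<in> carrier T" for x using bij_betwE[OF a_bij] that by blast
  have bK: "b h \<in> K" if "h \<in> carrier H" for h using bij_betwE[OF b_bij] that by blast
  have a_mult: "a (x \<otimes>\<^bsub>T\<^esub> y) = a x \<otimes>\<^bsub>G\<^esub> a y" if "x \<in> carrier T" "y \<in> carrier T" for x y
    using a that by (simp add: iso_def hom_def)
  have b_mult: "b (h \<otimes>\<^bsub>H\<^esub> k) = b h \<otimes>\<^bsub>G\<^esub> b k" if "h \<in> carrier H" "k \<in> carrier H" for h k
    using b that by (simp add: iso_def hom_def)
  let ?a' = "inv_into (carrier T) a"
  have a'_mem: "?a' u \<in> carrier T" and a_a': "a (?a' u) = u" if "u \<in> Q" for u
    using bij_betwE[OF bij_betw_inv_into[OF a_bij]] bij_betw_inv_into_right[OF a_bij] that by blast+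
  have a_inj: "x = y" if "a x = a y" "x \<in> carrier T" "y \<in> carrier T" for x y
    using a_bij that by (auto simp: bij_betw_def inj_on_def)
  define \<phi> where "\<phi> = (\<lambda>h\<in>carrier H. \<lambda>x\<in>carrier T. ?a' (b h \<otimes>\<^bsub>G\<^esub> a x \<otimes>\<^bsub>G\<^esub> inv\<^bsub>G\<^esub> (b h)))"
  have conj_mem: "b h \<otimes>\<^bsub>G\<^esub> a x \<otimes>\<^bsub>G\<^esub> inv\<^bsub>G\<^esub> (b h) \<in> Q" if "h \<in> carrier H" "x \<in> carrier T" for h x
    using Q.inv_op_closed2 aQ bK that by simp
  have \<phi>_mem: "\<phi> h x \<in> carrier T" if "h \<in> carrier H" "x \<in> carrier T" for h x
    using a'_mem[OF conj_mem[OF that]] that by (simp add: \<phi>_def)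
  have a_\<phi>: "a (\<phi> h x) = b h \<otimes>\<^bsub>G\<^esub> a x \<otimes>\<^bsub>G\<^esub> inv\<^bsub>G\<^esub> (b h)" if "h \<in> carrier H" "x \<in> carrier T" for h x
    using a_a'[OF conj_mem[OF that]] that by (simp add: \<phi>_def)
  have \<phi>_comp: "\<phi> (h \<otimes>\<^bsub>H\<^esub> k) x = \<phi> h (\<phi> k x)" if "h \<in> carrier H" "k \<in> carrier H" "x \<in> carrier T" for h k x
    by (rule a_inj) (use that \<phi>_mem aQ bK in \<open>simp_all add: a_\<phi> b_mult G.m_assoc G.inv_mult_group\<close>)
  have "b \<one>\<^bsub>H\<^esub> = \<one>\<^bsub>G\<^esub>"
  proof -
    have "b \<one>\<^bsub>H\<^esub> \<otimes>\<^bsub>G\<^esub> b \<one>\<^bsub>H\<^esub> = b \<one>\<^bsub>H\<^esub>" by (simp flip: b_mult)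
    then show ?thesis using bK[of "\<one>\<^bsub>H\<^esub>"] by (simp add: G.l_cancel_one)
  qed
  then have \<phi>_one: "\<phi> \<one>\<^bsub>H\<^esub> x = x" if "x \<in> carrier T" for x
    by (intro a_inj) (use that \<phi>_mem aQ in \<open>simp_all add: a_\<phi>\<close>)
  have \<phi>_mult: "\<phi> h (x \<otimes>\<^bsub>T\<^esub> y) = \<phi> h x \<otimes>\<^bsub>T\<^esub> \<phi> h y" if "h \<in> carrier H" "x \<in> carrier T" "y \<in> carrier T" for h x y
    by (rule a_inj) (use that \<phi>_mem aQ bK in \<open>simp_all add: a_\<phi> a_mult G.m_assoc G.inv_mult_cancel\<close>)
  have \<phi>_auto: "\<phi> h \<in> auto T" if h: "h \<in> carrier H" for h
  proof -
    have "bij_betw (\<phi> h) (carrier T) (carrier T)"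
    proof (rule bij_betwI[where g = "\<phi> (inv\<^bsub>H\<^esub> h)"])
      show "\<phi> (inv\<^bsub>H\<^esub> h) (\<phi> h x) = x" if "x \<in> carrier T" for x
        using \<phi>_comp[of "inv\<^bsub>H\<^esub> h" h x] \<phi>_one h that by simp
      show "\<phi> h (\<phi> (inv\<^bsub>H\<^esub> h) x) = x" if "x \<in> carrier T" for x
        using \<phi>_comp[of h "inv\<^bsub>H\<^esub> h" x] \<phi>_one h that by simp
    qed (use \<phi>_mem h in auto)
    moreover have "\<phi> h \<in> extensional (carrier T)" using h by (simp add: \<phi>_def)
    moreover have "\<phi> h \<in> hom T T" using \<phi>_mem \<phi>_mult h by (auto simp: hom_def)
    ultimately show ?thesis by (simp add: auto_def Bij_def)
  qed
  have "\<phi> \<in> hom H (AutoGroup T)"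
  proof (rule homI)
    fix h k assume hk: "h \<in> carrier H" "k \<in> carrier H"
    show "\<phi> (h \<otimes>\<^bsub>H\<^esub> k) = \<phi> h \<otimes>\<^bsub>AutoGroup T\<^esub> \<phi> k"
      using hk \<phi>_comp AutoGroup_mult_apply[OF \<phi>_auto[OF hk(1)] \<phi>_auto[OF hk(2)]]
      by (intro auto_eqI[OF \<phi>_auto AutoGroup_mult_closed[OF T(1)]]) (auto intro: \<phi>_auto)
  qed (simp add: \<phi>_auto)
  moreover have "\<phi> \<in> extensional (carrier H)" by (simp add: \<phi>_def)
  moreover have "internal_semidirect H T \<phi> G"
    unfolding internal_semidirect_def
  proof (intro exI conjI ballI)
    show "a \<in> hom T G" using aQ a_mult by (intro homI) auto
    show "b \<in> hom H G" using bK b_mult by (intro homI) auto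
    have "bij_betw (map_prod a b) (carrier T \<times> carrier H) (Q \<times> K)"
      using a_bij b_bij by (intro bij_betw_map_prod)
    from bij_betw_trans[OF this G.coprime_subgroups_factorize[OF assms(2) Q.subgroup_axioms K cop]]
    show "bij_betw (\<lambda>(x, h). a x \<otimes>\<^bsub>G\<^esub> b h) (carrier T \<times> carrier H) (carrier G)"
      by (simp add: comp_def case_prod_unfold)
    fix h x assume "h \<in> carrier H" "x \<in> carrier T"
    then show "b h \<otimes>\<^bsub>G\<^esub> a x = a (\<phi> h x) \<otimes>\<^bsub>G\<^esub> b h"
      using aQ bK by (simp add: a_\<phi> G.m_assoc)
  qed
  ultimately show ?thesis by (auto simp: ext_homs_def)
qed

text \<open>
  An isomorphism class is determined by the representative \<open>H\<close> and the action \<open>\<phi>\<close>.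
\<close>

lemma card_semidirect_classes_le:
  assumes T: "group T" and R: "finite R" "\<And>H. H \<in> R \<Longrightarrow> group H"
    and B: "\<And>H. H \<in> R \<Longrightarrow> finite (ext_homs H (AutoGroup T))" "\<And>H. H \<in> R \<Longrightarrow> card (ext_homs H (AutoGroup T)) \<le> B"
    and sub: "\<G> \<subseteq> groups_of_order n"
    and ex: "\<And>G. G \<in> \<G> \<Longrightarrow> \<exists>H\<in>R. \<exists>\<phi>\<in>ext_homs H (AutoGroup T). internal_semidirect H T \<phi> G"
  shows "card ((\<lambda>G. group_iso_rel n `` {G}) ` \<G>) \<le> card R * B"
proof -
  let ?K = "SIGMA H:R. ext_homs H (AutoGroup T)"
  let ?c = "\<lambda>(H, \<phi>). group_iso_rel n `` {SOME G. G \<in> \<G> \<and> internal_semidirect H T \<phi> G}"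
  have finK: "finite ?K" using R(1) B(1) by (intro finite_SigmaI) auto
  have "(\<lambda>G. group_iso_rel n `` {G}) ` \<G> \<subseteq> ?c ` ?K"
  proof (rule image_subsetI)
    fix G assume G: "G \<in> \<G>"
    obtain H \<phi> where H: "H \<in> R" "\<phi> \<in> ext_homs H (AutoGroup T)" "internal_semidirect H T \<phi> G"
      using ex[OF G] by blast
    let ?G = "SOME G. G \<in> \<G> \<and> internal_semidirect H T \<phi> G"
    have G': "?G \<in> \<G> \<and> internal_semidirect H T \<phi> ?G" by (rule someI[of _ G]) (use G H in simp)
    have ord: "G \<in> groups_of_order n" "?G \<in> groups_of_order n" using sub G G' by blast+
    then have grp: "group G" "group ?G" by (auto simp: groups_of_order_def)
    have "G \<cong> ?G"
      using internal_semidirect_unique[OF grp R(2)[OF H(1)] T H(2,3)] G' by blast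
    then have "(G, ?G) \<in> group_iso_rel n" using ord by (simp add: group_iso_rel_def)
    then have "group_iso_rel n `` {G} = group_iso_rel n `` {?G}"
      by (rule equiv_class_eq[OF equiv_group_iso_rel])
    then show "group_iso_rel n `` {G} \<in> ?c ` ?K" using H by (intro image_eqI[of _ _ "(H, \<phi>)"]) auto
  qed
  then have "card ((\<lambda>G. group_iso_rel n `` {G}) ` \<G>) \<le> card ?K"
    using finK by (meson card_image_le card_mono finite_imageI le_trans)
  also have "\<dots> = (\<Sum>H\<in>R. card (ext_homs H (AutoGroup T)))" using R(1) B(1) by simp
  also have "\<dots> \<le> card R * B" using sum_bounded_above[of R _ B] B(2) by simp
  finally show ?thesis .
qed

lemma group_class_representatives:
  assumes "m > 0"
  obtains R where "finite R" "card R \<le> num_groups m" "R \<subseteq> groups_of_order m"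
    "\<And>K :: ('a, 'b) monoid_scheme. group K \<Longrightarrow> order K = m \<Longrightarrow> \<exists>H\<in>R. H \<cong> K"
proof -
  let ?C = "groups_of_order m // group_iso_rel m"
  let ?r = "\<lambda>c. SOME G. G \<in> c"
  have fin: "finite ?C" by (rule finite_group_classes[OF assms])
  have r: "?r c \<in> c" if "c \<in> ?C" for c
    using in_quotient_imp_non_empty[OF equiv_group_iso_rel that] by (simp add: some_in_eq)
  show ?thesis
  proof (rule that[of "?r ` ?C"])
    show "finite (?r ` ?C)" using fin by simp
    show "card (?r ` ?C) \<le> num_groups m" unfolding num_groups_def by (rule card_image_le[OF fin])
    show "?r ` ?C \<subseteq> groups_of_order m"
      using r in_quotient_imp_subset[OF equiv_group_iso_rel] by blast
    fix K :: "('a, 'b) monoid_scheme" assume K: "group K" "order K = m"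
    obtain H where H: "H \<in> groups_of_order m" "K \<cong> H" using groups_of_order_complete[OF K assms] by blast
    let ?c = "group_iso_rel m `` {H}"
    have c: "?c \<in> ?C" using H(1) by (rule quotientI)
    have "?r ?c \<in> ?c" by (rule r[OF c])
    then have "H \<cong> ?r ?c" "?r ?c \<in> groups_of_order m" by (auto simp: group_iso_rel_def)
    then have "K \<cong> ?r ?c" using H(2) iso_trans by blast
    then have "?r ?c \<cong> K" by (rule group.iso_sym[OF K(1)])
    then show "\<exists>H\<in>?r ` ?C. H \<cong> K" using c by blast
  qed
qed

lemma num_groups_1: "num_groups 1 \<le> 1"
proof -
  have "c = d" if cd: "c \<in> groups_of_order 1 // group_iso_rel 1" "d \<in> groups_of_order 1 // group_iso_rel 1" for c d
  proof -
    obtain G where G: "c = group_iso_rel 1 `` {G}" "G \<in> groups_of_order 1" using cd(1) by (rule quotientE)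
    obtain H where H: "d = group_iso_rel 1 `` {H}" "H \<in> groups_of_order 1" using cd(2) by (rule quotientE)
    interpret G: group G using G by (simp add: groups_of_order_def)
    interpret H: group H using H by (simp add: groups_of_order_def)
    have "carrier G = {\<one>\<^bsub>G\<^esub>}" "carrier H = {\<one>\<^bsub>H\<^esub>}"
      using G H G.order_one_triv_iff H.order_one_triv_iff by (auto simp: groups_of_order_def)
    then have "(\<lambda>_. \<one>\<^bsub>H\<^esub>) \<in> iso G H" by (auto simp: iso_def hom_def bij_betw_def)
    then have "(G, H) \<in> group_iso_rel 1" using G H by (auto simp: group_iso_rel_def is_iso_def)
    then show ?thesis unfolding G H by (rule equiv_class_eq[OF equiv_group_iso_rel])
  qed
  then show ?thesis unfolding num_groups_def
    by (metis One_nat_def card_le_Suc0_iff_eq finite_group_classes zero_less_one)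
qed

text \<open>
  A group of order \<open>n\<close> splits over its normal Sylow subgroup for the largest prime \<open>q\<close>. If this subgroup is cyclic, the number
  of actions of a given group of order \<open>m\<close> on it is at most \<open>(q\<^sup>e - 1)\<^sup>\<mu>\<close>, and if it is elementary abelian of order \<open>q\<^sup>2\<close>, at most
  \<open>(q\<^sup>2 - 1)\<^sup>2 (q\<^sup>2 + q - 2)\<close>; for \<open>e = 2\<close> both types occur and the two numbers add up.
\<close>

lemma num_groups_recursion:
  fixes q m \<mu> :: nat
  assumes n: "n = q ^ e * m" and odd: "odd n" and cf: "cube_free n" and q: "prime q" "\<not> q dvd m"
    and largest: "\<And>r. prime r \<Longrightarrow> r dvd n \<Longrightarrow> r \<le> q" and e: "1 \<le> e" "e \<le> \<mu>" and \<mu>: "\<mu> \<le> 2"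
    and mult: "\<forall>p. prime p \<longrightarrow> multiplicity p n \<le> \<mu>"
  shows "num_groups n \<le> num_groups m * (if e = 1 then (q - 1) ^ \<mu> else (q ^ 2 - 1) ^ 2 * (q ^ 2 + q - 1))"
proof -
  have n0: "n > 0" using cube_free_pos[OF cf] .
  then have m0: "m > 0" using n by (intro gr0I) simp
  have mdvd: "m dvd n" using n by simp
  have q1: "q > 1" using q(1) by (rule prime_gt_1_nat)
  have qe: "multiplicity q n = e" using n q m0 q1
    by (intro multiplicity_eqI) (auto simp: mult.commute)
  have oddm: "odd m" and cfm: "cube_free m" using odd mdvd dvd_trans cube_free_dvd[OF cf mdvd] by blast+
  have oddq: "odd q" using odd n e q1 by (auto simp: dvd_power)
  have multm: "\<forall>p. prime p \<longrightarrow> multiplicity p m \<le> \<mu>"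
    using mult dvd_imp_multiplicity_le[OF mdvd] n0 by (metis le_trans neq0_conv)
  have cop: "coprime (q ^ e) m" using q by (metis coprime_power_left_iff prime_imp_coprime)
  obtain R where R: "finite R" "card R \<le> num_groups m" "R \<subseteq> groups_of_order m"
    and R_rep: "\<And>K :: nat monoid. group K \<Longrightarrow> order K = m \<Longrightarrow> \<exists>H\<in>R. H \<cong> K"
    using group_class_representatives[OF m0, where 'a = nat and 'b = unit] by blast
  have RH: "group H" "order H = m" if "H \<in> R" for H using R(3) that by (auto simp: groups_of_order_def)
  have finH: "finite (carrier H)" if "H \<in> R" for H
    using RH[OF that] m0 monoid.order_gt_0_iff_finite[OF group.is_monoid] by metis
  \<comment> \<open>every group of order \<open>n\<close> splits over its Sylow \<open>q\<close>-subgroup\<close>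
  have split: "\<exists>Q K H. Q \<lhd> G \<and> card Q = q ^ e \<and> subgroup K G \<and> coprime (card Q) (card K) \<and>
      card Q * card K = order G \<and> H \<in> R \<and> H \<cong> G\<lparr>carrier := K\<rparr>"
    if G: "G \<in> groups_of_order n" for G
  proof -
    interpret G: group G using G by (simp add: groups_of_order_def)
    have ordG: "order G = n" using G by (simp add: groups_of_order_def)
    have fin: "finite (carrier G)" using n0 ordG G.order_gt_0_iff_finite by simp
    have "q dvd n" using n e by (simp add: dvd_power)
    then obtain Q where Q: "Q \<lhd> G" "card Q = q ^ e"
      using largest_prime_sylow_normal[OF G.is_group, of q] ordG odd cf q(1) largest qe by auto
    interpret Q: normal Q G by fact
    interpret QG: comm_group "G\<lparr>carrier := Q\<rparr>"
      using group.order_prime_power_le_2_abelian[OF G.subgroup_imp_group[OF Q.subgroup_axioms] q(1) _ le_trans[OF e(2) \<mu>]] Q(2)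
      by (simp add: order_def)
    have "card (rcosets\<^bsub>G\<^esub> Q) * q ^ e = m * q ^ e"
      using G.lagrange[OF Q.subgroup_axioms] ordG n Q(2) by (simp add: mult.commute)
    then have index: "card (rcosets\<^bsub>G\<^esub> Q) = m" using q1 by simp
    obtain K where K: "subgroup K G" "card K * card Q = order G"
      using G.normal_abelian_coprime_complement[OF fin Q(1)] QG.m_comm cop Q(2) index by auto
    have "card K * q ^ e = m * q ^ e" using K(2) Q(2) ordG n by (simp add: mult.commute)
    then have cardK: "card K = m" using q1 by simp
    obtain H where H: "H \<in> R" "H \<cong> G\<lparr>carrier := K\<rparr>"
      using R_rep[OF G.subgroup_imp_group[OF K(1)]] cardK by (auto simp: order_def)
    have "coprime (card Q) (card K)" "card Q * card K = order G"
      using Q(2) cardK cop K(2) by (simp_all add: mult.commute)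
    then show ?thesis using Q K(1) H by blast
  qed
  let ?cl = "\<lambda>G. group_iso_rel n `` {G}"
  let ?Z = "integer_mod_group (q ^ e)"
  have qe1: "q ^ e > 1" using q1 e by (intro one_less_power) auto
  define \<G> where "\<G> = {G \<in> groups_of_order n. \<exists>H\<in>R. \<exists>\<phi>\<in>ext_homs H (AutoGroup ?Z). internal_semidirect H ?Z \<phi> G}"
  have cyc: "card (?cl ` \<G>) \<le> card R * (q ^ e - 1) ^ \<mu>"
  proof (rule card_semidirect_classes_le[of ?Z R])
    fix H assume H: "H \<in> R"
    have ordZ: "order ?Z = q ^ e" by (rule order_integer_mod_group) (use q1 in simp)
    have finZ: "finite (carrier ?Z)" using q1 by (simp add: carrier_integer_mod_group)
    show "finite (ext_homs H (AutoGroup ?Z))"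
      by (rule finite_ext_homs[OF finH[OF H]]) (simp add: finite_auto[OF finZ])
    show "card (ext_homs H (AutoGroup ?Z)) \<le> (q ^ e - 1) ^ \<mu>"
      using card_ext_homs_cyclic_le[OF RH(1)[OF H] _ _ \<mu> _ group_integer_mod_group cyclic_integer_mod_group[OF qe1]]
        RH(2)[OF H] oddm cfm multm qe1 ordZ by simp
  qed (use R(1) RH(1) in \<open>auto simp: \<G>_def\<close>)
  have quotient: "groups_of_order n // group_iso_rel n = ?cl ` groups_of_order n"
    by (auto simp: quotient_def)
  show ?thesis
  proof (cases "e = 1")
    case True
    have "groups_of_order n \<subseteq> \<G>"
    proof
      fix G assume G: "G \<in> groups_of_order n"
      interpret G: group G using G by (simp add: groups_of_order_def)
      have fin: "finite (carrier G)" using G n0 G.order_gt_0_iff_finite by (simp add: groups_of_order_def)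
      obtain Q K H where Q: "Q \<lhd> G" "card Q = q ^ e" and K: "subgroup K G" "coprime (card Q) (card K)"
        "card Q * card K = order G" and H: "H \<in> R" "H \<cong> G\<lparr>carrier := K\<rparr>" using split[OF G] by blast
      have grp: "group (G\<lparr>carrier := Q\<rparr>)" using G.subgroup_imp_group[OF normal_imp_subgroup[OF Q(1)]] .
      have ord: "order (G\<lparr>carrier := Q\<rparr>) = q ^ e" using Q(2) by (simp add: order_def)
      have "cyclic_group (G\<lparr>carrier := Q\<rparr>)" using group.prime_order_cyclic[OF grp q(1)] ord True by simp
      then have "?Z \<cong> G\<lparr>carrier := Q\<rparr>" using cyclic_group_iso_integer_mod_group[OF grp _ ord] q1 by simp
      from internal_semidirect_exists[OF G.is_group fin Q(1) K group_integer_mod_group this RH(1)[OF H(1)] H(2)]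
      show "G \<in> \<G>" using G H(1) by (auto simp: \<G>_def)
    qed
    then have "\<G> = groups_of_order n" by (auto simp: \<G>_def)
    then have "num_groups n \<le> card R * (q - 1) ^ \<mu>" using cyc True by (simp add: num_groups_def quotient)
    also have "\<dots> \<le> num_groups m * (q - 1) ^ \<mu>" using R(2) by simp
    finally show ?thesis using True by simp
  next
    case False
    then have e2: "e = 2" "\<mu> = 2" using e \<mu> by auto
    let ?E = "integer_mod_group q \<times>\<times> integer_mod_group q"
    interpret E: elementary_abelian_square ?E q by (rule elementary_integer_mod_square[OF q(1)])
    define \<E> where "\<E> = {G \<in> groups_of_order n. \<exists>H\<in>R. \<exists>\<phi>\<in>ext_homs H (AutoGroup ?E). internal_semidirect H ?E \<phi> G}"
    have elem: "card (?cl ` \<E>) \<le> card R * ((q ^ 2 - 1) ^ 2 * (q ^ 2 + q - 2))"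
    proof (rule card_semidirect_classes_le[of ?E R])
      fix H assume H: "H \<in> R"
      show "finite (ext_homs H (AutoGroup ?E))"
        by (rule finite_ext_homs[OF finH[OF H]]) (simp add: finite_auto[OF E.finite_carrier])
      show "card (ext_homs H (AutoGroup ?E)) \<le> (q ^ 2 - 1) ^ 2 * (q ^ 2 + q - 2)"
        using card_ext_homs_elementary_le[OF RH(1)[OF H] _ _ E.elementary_abelian_square_axioms oddq]
          RH(2)[OF H] oddm cfm q(2) by simp
    qed (use R(1) RH(1) E.is_group in \<open>auto simp: \<E>_def\<close>)
    have "groups_of_order n \<subseteq> \<G> \<union> \<E>"
    proof
      fix G assume G: "G \<in> groups_of_order n"
      interpret G: group G using G by (simp add: groups_of_order_def)
      have fin: "finite (carrier G)" using G n0 G.order_gt_0_iff_finite by (simp add: groups_of_order_def)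
      obtain Q K H where Q: "Q \<lhd> G" "card Q = q ^ e" and K: "subgroup K G" "coprime (card Q) (card K)"
        "card Q * card K = order G" and H: "H \<in> R" "H \<cong> G\<lparr>carrier := K\<rparr>" using split[OF G] by blast
      have grp: "group (G\<lparr>carrier := Q\<rparr>)" using G.subgroup_imp_group[OF normal_imp_subgroup[OF Q(1)]] .
      have ord: "order (G\<lparr>carrier := Q\<rparr>) = q ^ e" using Q(2) by (simp add: order_def)
      show "G \<in> \<G> \<union> \<E>"
      proof (cases "cyclic_group (G\<lparr>carrier := Q\<rparr>)")
        case True
        then have "?Z \<cong> G\<lparr>carrier := Q\<rparr>" using cyclic_group_iso_integer_mod_group[OF grp _ ord] q1 by simp
        from internal_semidirect_exists[OF G.is_group fin Q(1) K group_integer_mod_group this RH(1)[OF H(1)] H(2)]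
        show ?thesis using G H(1) by (auto simp: \<G>_def)
      next
        case False
        then have "elementary_abelian_square (G\<lparr>carrier := Q\<rparr>) q"
          using group.noncyclic_prime_square_elementary[OF grp q(1)] ord e2 by simp
        then have "?E \<cong> G\<lparr>carrier := Q\<rparr>" by (rule elementary_abelian_square.iso_integer_mod_square)
        from internal_semidirect_exists[OF G.is_group fin Q(1) K E.is_group this RH(1)[OF H(1)] H(2)]
        show ?thesis using G H(1) by (auto simp: \<E>_def)
      qed
    qed
    moreover have "\<G> \<union> \<E> \<subseteq> groups_of_order n" by (auto simp: \<G>_def \<E>_def)
    ultimately have "groups_of_order n = \<G> \<union> \<E>" by (rule subset_antisym)
    then have "?cl ` groups_of_order n = ?cl ` \<G> \<union> ?cl ` \<E>" by (simp only: image_Un)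
    then have "num_groups n \<le> card (?cl ` \<G>) + card (?cl ` \<E>)"
      by (simp add: num_groups_def quotient card_Un_le)
    also have "\<dots> \<le> card R * (q ^ 2 - 1) ^ 2 + card R * ((q ^ 2 - 1) ^ 2 * (q ^ 2 + q - 2))"
      using cyc elem e2 by simp
    also have "\<dots> = card R * ((q ^ 2 - 1) ^ 2 * (q ^ 2 + q - 1))"
    proof -
      have "q ^ 2 + q - 1 = Suc (q ^ 2 + q - 2)" using q1 by (simp add: power2_eq_square)
      then show ?thesis by (simp only: mult_Suc_right distrib_left)
    qed
    also have "\<dots> \<le> num_groups m * ((q ^ 2 - 1) ^ 2 * (q ^ 2 + q - 1))" using R(2) by (rule mult_right_mono) simp
    finally show ?thesis using False by simp
  qed
qed

section \<open>The numerical bound\<close>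

lemma powr_bounds_ge_3:
  assumes "x \<ge> (3::real)"
  shows "5 \<le> x powr (3 / 2)" "2 \<le> x powr (3 / 4)"
proof -
  have sq: "(y powr a) ^ 2 = y powr (a * 2)" for y a :: real
    by (simp add: power2_eq_square mult.commute flip: powr_add)
  have "5 ^ 2 \<le> (3::real) powr 3" by simp
  also have "\<dots> = (3 powr (3 / 2)) ^ 2" unfolding sq by simp
  finally have "5 \<le> (3::real) powr (3 / 2)" by (rule power2_le_imp_le) simp
  also have "\<dots> \<le> x powr (3 / 2)" using assms by (intro powr_mono2) auto
  finally show 5: "5 \<le> x powr (3 / 2)" .
  have "2 ^ 2 \<le> x powr (3 / 4 * 2)" using 5 by simp
  also have "\<dots> = (x powr (3 / 4)) ^ 2" by (rule sq[symmetric])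
  finally show "2 \<le> x powr (3 / 4)" by (rule power2_le_imp_le) simp
qed

lemma factor_bound_1:
  assumes "q \<ge> (3::nat)"
  shows "real (q - 1) * 2 \<le> real q powr (7 / 4)"
proof -
  have "real (q - 1) * 2 \<le> real q * 2" by simp
  also have "\<dots> \<le> real q * real q powr (3 / 4)" using powr_bounds_ge_3(2)[of "real q"] assms by (intro mult_left_mono) auto
  also have "\<dots> = real q powr 1 * real q powr (3 / 4)" using assms by simp
  also have "\<dots> = real q powr (7 / 4)" by (simp only: powr_add[symmetric]) simp
  finally show ?thesis .
qed

lemma factor_bound_2:
  assumes "q \<ge> (3::nat)"
  shows "real ((q - 1) ^ 2) * 4 \<le> real q powr (15 / 4)"
proof -
  have "real ((q - 1) ^ 2) * 4 = (real (q - 1) * 2) ^ 2" by (simp add: power_mult_distrib)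
  also have "\<dots> \<le> (real q powr (7 / 4)) ^ 2" using factor_bound_1[OF assms] by (intro power_mono) auto
  also have "\<dots> = real q powr (7 / 4 * 2)" by (simp add: power2_eq_square flip: powr_add)
  also have "\<dots> \<le> real q powr (15 / 4)" using assms by (intro powr_mono) auto
  finally show ?thesis .
qed

text \<open>
  The constant 5 is small enough to be a lower bound for \<open>q\<^sup>3\<^sup>/\<^sup>2\<close> already at \<open>q = 3\<close>, and large enough for the
  left-hand side to be at most \<open>5 q\<^sup>6\<close>.
\<close>

lemma factor_bound_3:
  assumes "q \<ge> (3::nat)"
  shows "real ((q ^ 2 - 1) ^ 2 * (q ^ 2 + q - 1)) * 4 \<le> real (q ^ 2) powr (15 / 4)"
proof -
  define x where "x = real q"
  have x: "x \<ge> 3" using assms by (simp add: x_def)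
  have "1 \<le> q ^ 2" using assms by simp
  then have "real ((q ^ 2 - 1) ^ 2 * (q ^ 2 + q - 1)) * 4 = (x ^ 2 - 1) ^ 2 * (x ^ 2 + x - 1) * 4"
    by (simp add: x_def of_nat_diff)
  also have "\<dots> \<le> x ^ 6 * 5"
  proof -
    have "x ^ 6 * 5 - (x ^ 2 - 1) ^ 2 * (x ^ 2 + x - 1) * 4
        = x ^ 4 * (x - 2) ^ 2 + 8 * x ^ 2 * (x ^ 2 - 4) + 8 * x ^ 3 + 20 * x ^ 2 - 4 * x + 4"
      by (simp add: algebra_simps power2_eq_square power3_eq_cube power4_eq_xxxx eval_nat_numeral)
    moreover have "0 \<le> x ^ 4 * (x - 2) ^ 2" "0 \<le> 8 * x ^ 3" using x by auto
    moreover have "0 \<le> 8 * x ^ 2 * (x ^ 2 - 4)"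
      using x power_mono[of 2 x 2] by simp
    moreover have "4 * x \<le> 20 * x ^ 2" using x by (simp add: power2_eq_square)
    ultimately show ?thesis by linarith
  qed
  also have "\<dots> \<le> x ^ 6 * x powr (3 / 2)" using powr_bounds_ge_3(1)[OF x] x by (intro mult_left_mono) auto
  also have "\<dots> = x powr 6 * x powr (3 / 2)" using x by simp
  also have "\<dots> = x powr (2 * (15 / 4))" by (simp only: powr_add[symmetric]) simp
  also have "\<dots> = (x powr 2) powr (15 / 4)" by (rule powr_powr[symmetric])
  also have "x powr 2 = real (q ^ 2)" using x by (simp add: x_def)
  finally show ?thesis .
qed

text \<open>
  Here \<open>\<mu>\<close> is only an upper bound for the exponents, so that it stays fixed when the largest prime is split off.
\<close>

lemma num_groups_le_odd_cube_free:
  assumes "odd n" "cube_free n" and \<mu>: "\<mu> = 1 \<or> \<mu> = 2"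
    and "\<forall>p. prime p \<longrightarrow> multiplicity p n \<le> \<mu>"
  shows "real (num_groups n) * 2 ^ (num_prime_divisors n * \<mu>) \<le> real n powr (2 * real \<mu> - 1 / 4)"
  using assms(1,2,4)
proof (induction n rule: less_induct)
  case (less n)
  have n0: "n > 0" using cube_free_pos[OF less.prems(2)] .
  show ?case
  proof (cases "n = 1")
    case True
    have "{p::nat. prime p \<and> p dvd 1} = {}" by auto
    then have "num_prime_divisors n = 0" using True by (simp add: num_prime_divisors_def)
    then show ?thesis using num_groups_1 True by simp
  next
    case False
    let ?D = "{p. prime p \<and> p dvd n}"
    have finD: "finite ?D" using n0 by (auto intro: finite_subset[OF _ finite_divisors_nat])
    have "?D \<noteq> {}" using False prime_factor_nat by blast
    define q where "q = Max ?D"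
    have "q \<in> ?D" unfolding q_def using finD \<open>?D \<noteq> {}\<close> by (rule Max_in)
    then have q: "prime q" "q dvd n" by auto
    have largest: "r \<le> q" if "prime r" "r dvd n" for r unfolding q_def using finD that by (intro Max_ge) auto
    define e where "e = multiplicity q n"
    obtain m where m: "n = q ^ e * m" "\<not> q dvd m"
      using prime_power_decompose[OF q(1), of n] n0 unfolding e_def by blast
    have "e > 0" using q n0 unfolding e_def by (subst prime_multiplicity_gt_zero_iff) auto
    then have e1: "1 \<le> e" by simp
    have e\<mu>: "e \<le> \<mu>" using less.prems(3) q(1) by (simp add: e_def)
    have "odd q" using q(2) less.prems(1) dvd_trans by blast
    then have q3: "q \<ge> 3" using prime_ge_2_nat[OF q(1)] by (cases "q = 2") auto
    have m0: "m > 0" using m n0 by (intro gr0I) simp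
    have qe1: "1 < q ^ e" using q3 e1 by (intro one_less_power) auto
    have mn: "m < n" using m(1) m0 qe1 by simp
    have mdvd: "m dvd n" using m(1) by simp
    have IH: "real (num_groups m) * 2 ^ (num_prime_divisors m * \<mu>) \<le> real m powr (2 * real \<mu> - 1 / 4)"
    proof (rule less.IH[OF mn])
      show "odd m" using less.prems(1) mdvd dvd_trans by blast
      show "cube_free m" using cube_free_dvd[OF less.prems(2) mdvd] .
      show "\<forall>p. prime p \<longrightarrow> multiplicity p m \<le> \<mu>"
        using less.prems(3) dvd_imp_multiplicity_le[OF mdvd] n0 by (metis le_trans neq0_conv)
    qed
    have "r = q" if "prime r" "r dvd q ^ e" for r
      using that q(1) by (metis prime_dvd_power primes_dvd_imp_eq)
    then have "?D = insert q {p. prime p \<and> p dvd m}"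
      using q m(1) by (auto simp: prime_dvd_mult_iff)
    moreover have "finite {p. prime p \<and> p dvd m}" using m0 by (auto intro: finite_subset[OF _ finite_divisors_nat])
    ultimately have \<omega>: "num_prime_divisors n = Suc (num_prime_divisors m)"
      using m(2) by (simp add: num_prime_divisors_def)
    define B where "B = (if e = 1 then (q - 1) ^ \<mu> else (q ^ 2 - 1) ^ 2 * (q ^ 2 + q - 1))"
    have rec: "num_groups n \<le> num_groups m * B"
      unfolding B_def using \<mu> less.prems(3)
      by (intro num_groups_recursion[OF m(1) less.prems(1,2) q(1) m(2) largest e1 e\<mu>]) auto
    have B: "real B * 2 ^ \<mu> \<le> real (q ^ e) powr (2 * real \<mu> - 1 / 4)"
      using \<mu>
    proof
      assume "\<mu> = 1"
      then show ?thesis using factor_bound_1[OF q3] e1 e\<mu> by (simp add: B_def)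
    next
      assume \<mu>2: "\<mu> = 2"
      then have "e = 1 \<or> e = 2" using e1 e\<mu> by auto
      then show ?thesis using factor_bound_2[OF q3] factor_bound_3[OF q3] \<mu>2 by (auto simp: B_def)
    qed
    have "real (num_groups n) * 2 ^ (num_prime_divisors n * \<mu>)
        \<le> real (num_groups m * B) * 2 ^ (num_prime_divisors n * \<mu>)"
      using rec by (intro mult_right_mono) (simp_all flip: of_nat_mult)
    also have "\<dots> = (real (num_groups m) * 2 ^ (num_prime_divisors m * \<mu>)) * (real B * 2 ^ \<mu>)"
      by (simp add: \<omega> power_add)
    also have "\<dots> \<le> real m powr (2 * real \<mu> - 1 / 4) * real (q ^ e) powr (2 * real \<mu> - 1 / 4)"
      using IH B by (intro mult_mono) auto
    also have "\<dots> = real n powr (2 * real \<mu> - 1 / 4)"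
      unfolding m(1) by (simp add: powr_mult mult.commute)
    finally show ?thesis .
  qed
qed

theorem theorem1p1:
  fixes n :: nat
  assumes "n > 0" and "odd n" and "cube_free n"
  shows "real (num_groups n) \<le>
    2 powr (- (real (num_prime_divisors n) * real (max_prime_exponent n))) *
    real n powr (2 * real (max_prime_exponent n) - 1 / 4)"
proof (cases "n = 1")
  case True
  have "{multiplicity p (1::nat) | p. prime p} = {0}" using two_is_prime_nat by auto
  then have "max_prime_exponent n = 0" using True by (simp add: max_prime_exponent_def)
  then show ?thesis using num_groups_1 True by simp
next
  case False
  define \<mu> where "\<mu> = max_prime_exponent n"
  have fin: "finite {multiplicity p n | p. prime p}" by (rule finite_prime_exponents[OF assms(1)])
  have le: "multiplicity p n \<le> \<mu>" if "prime p" for p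
    unfolding \<mu>_def max_prime_exponent_def using fin that by (intro Max_ge) auto
  have "\<mu> \<in> {multiplicity p n | p. prime p}"
    unfolding \<mu>_def max_prime_exponent_def using fin two_is_prime_nat by (intro Max_in) auto
  then have "\<mu> \<le> 2" using cube_free_multiplicity_le[OF assms(3)] by auto
  moreover obtain p where p: "prime p" "p dvd n" using False prime_factor_nat by blast
  then have "multiplicity p n > 0" using assms(1) by (subst prime_multiplicity_gt_zero_iff) auto
  then have "\<mu> \<ge> 1" using le[OF p(1)] by simp
  ultimately have \<mu>: "\<mu> = 1 \<or> \<mu> = 2" by auto
  have "real (num_groups n) * 2 ^ (num_prime_divisors n * \<mu>) \<le> real n powr (2 * real \<mu> - 1 / 4)"
    using num_groups_le_odd_cube_free[OF assms(2,3) \<mu>] le by blast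
  moreover have "2 powr (- (real (num_prime_divisors n) * real \<mu>)) = inverse ((2::real) ^ (num_prime_divisors n * \<mu>))"
    by (simp add: powr_minus flip: powr_realpow)
  moreover have "x \<le> inverse A * y" if "x * A \<le> y" "A > 0" for x y A :: real
    using that by (simp add: field_simps)
  ultimately show ?thesis unfolding \<mu>_def[symmetric] by (metis zero_less_numeral zero_less_power)
qed

end
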